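(* Let $b$ be a non-constant function in the closed unit ball of $H^\infty$ with $\log(1-|b|)\in L^1(\mathbb T)$, and let $a$ be its Pythagorean mate. Let $f\in\mathcal H(b)$ and $\lambda\in\mathbb D$. Then $fk_\lambda\in\mathcal H(b)$ and $$(fk_\lambda)^+=f^+k_\lambda+\frac{\overline{\lambda g(\lambda)}}{\overline{a(\lambda)}}\,k_\lambda,$$ where $g\in H^2$ is the (unique) function satisfying $\overline{b}f=\overline{a}f^++\overline{zg}$ almost everywhere on $\mathbb T$.
   Context: $\mathbb D$ is the open unit disk, $\mathbb T$ its boundary with normalized Lebesgue measure $m$; $H^p$ are the Hardy spaces of $\mathbb D$, identified via radial limits with subspaces of $L^p(\mathbb T)$. $P_+:L^2(\mathbb T)\to H^2$ is the orthogonal projection, and for $\varphi\in L^\infty(\mathbb T)$ the Toeplitz operator is $T_\varphi f=P_+(\varphi f)$ on $H^2$. For $\lambda\in\mathbb D$, $k_\lambda(z)=\frac{1}{1-\overline\lambda z}$. For $b$ in the closed unit ball of $H^\infty$, $\mathcal H(b)$ is the reproducing kernel Hilbert space on $\mathbb D$ with kernel $k^b_\lambda(z)=\frac{1-\overline{b(\lambda)}b(z)}{1-\overline\lambda z}$. When $\log(1-|b|)\in L^1(\mathbb T)$, the Pythagorean mate of $b$ is the unique outer function $a\in H^\infty$ with $a(0)>0$ and $|a|^2+|b|^2=1$ a.e. on $\mathbb T$. In this case, $f\in H^2$ belongs to $\mathcal H(b)$ if and only if there is $f^+\in H^2$ with $T_{\bar b}f=T_{\bar a}f^+$; the function $f^+$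 is then unique, and there is a unique $g\in H^2$ with $\overline bf=\overline af^++\overline{zg}$ a.e. on $\mathbb T$. *)

theory Defs
  imports "HOL-Complex_Analysis.Complex_Analysis"
begin

text \<open>
  A function on the unit disc is encoded as a function on all of \<open>\<complex>\<close> that vanishes off
  the disc. Equality of functions on the disc is then equality, the spaces below are genuine vector
  spaces, and definite descriptions of such functions are meaningful. Functions on the unit circle
  are functions on \<open>\<complex>\<close> considered almost everywhere with respect to the measure
  \<open>circle\<close>, which is concentrated on the circle.
\<close>

abbreviation disc :: "complex set" where
  "disc \<equiv> ball 0 1"

definition circle :: "complex measure" where
  "circle = distr (uniform_measure lborel {0..2 * pi}) borel cis"

definition hol_disc :: "(complex \<Rightarrow> complex) set" where
  "hol_disc = {f. f holomorphic_on disc \<and> (\<forall>z. z \<notin> disc \<longrightarrow> f z = 0)}"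

definition Hinf :: "(complex \<Rightarrow> complex) set" where
  "Hinf = {f \<in> hol_disc. bounded (f ` disc)}"

definition Hinf_unit_ball :: "(complex \<Rightarrow> complex) set" where
  "Hinf_unit_ball = {f \<in> Hinf. \<forall>z\<in>disc. norm (f z) \<le> 1}"

definition H2 :: "(complex \<Rightarrow> complex) set" where
  "H2 = {f \<in> hol_disc.
     bdd_above ((\<lambda>r::real. LINT \<zeta>|circle. (norm (f (of_real r * \<zeta>)))\<^sup>2) ` {0..<1})}"

text \<open>Radial boundary values; at points without a radial limit the value is unspecified.\<close>

definition bdry :: "(complex \<Rightarrow> complex) \<Rightarrow> complex \<Rightarrow> complex" where
  "bdry f \<zeta> = Lim (at_left 1) (\<lambda>r::real. f (of_real r * \<zeta>))"

definition L2_inner :: "(complex \<Rightarrow> complex) \<Rightarrow> (complex \<Rightarrow> complex) \<Rightarrow> complex" where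
  "L2_inner u v = (LINT \<zeta>|circle. u \<zeta> * cnj (v \<zeta>))"

text \<open>
  The orthogonal projection of \<open>L\<^sup>2\<close> of the circle onto \<open>H\<^sup>2\<close>; meaningful for
  square integrable \<open>u\<close>. The projection is returned as a function on the disc.
\<close>

definition P_plus :: "(complex \<Rightarrow> complex) \<Rightarrow> complex \<Rightarrow> complex" where
  "P_plus u = (THE F. F \<in> H2 \<and> (\<forall>G\<in>H2. L2_inner (\<lambda>\<zeta>. u \<zeta> - bdry F \<zeta>) (bdry G) = 0))"

text \<open>The symbol \<open>\<phi>\<close> is a function on the circle, the argument a function on the disc.\<close>

definition toeplitz ::
  "(complex \<Rightarrow> complex) \<Rightarrow> (complex \<Rightarrow> complex) \<Rightarrow> complex \<Rightarrow> complex" where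
  "toeplitz \<phi> f = P_plus (\<lambda>\<zeta>. \<phi> \<zeta> * bdry f \<zeta>)"

definition szego :: "complex \<Rightarrow> complex \<Rightarrow> complex" where
  "szego w z = (if z \<in> disc then 1 / (1 - cnj w * z) else 0)"

text \<open>
  A reproducing kernel Hilbert space on \<open>D\<close>: a Hilbert space \<open>(H, ip)\<close> of functions on \<open>D\<close>
  (extended by zero), where \<open>K w\<close> is the kernel function at \<open>w\<close>.
\<close>

locale rkhs =
  fixes D :: "'a set"
    and K :: "'a \<Rightarrow> 'a \<Rightarrow> complex"
    and H :: "('a \<Rightarrow> complex) set"
    and ip :: "('a \<Rightarrow> complex) \<Rightarrow> ('a \<Rightarrow> complex) \<Rightarrow> complex"
  assumes support: "f \<in> H \<Longrightarrow> z \<notin> D \<Longrightarrow> f z = 0"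
    and zero_mem: "(\<lambda>z. 0) \<in> H"
    and add_mem: "f \<in> H \<Longrightarrow> g \<in> H \<Longrightarrow> (\<lambda>z. f z + g z) \<in> H"
    and scale_mem: "f \<in> H \<Longrightarrow> (\<lambda>z. c * f z) \<in> H"
    and ip_add: "f \<in> H \<Longrightarrow> g \<in> H \<Longrightarrow> h \<in> H \<Longrightarrow> ip (\<lambda>z. f z + g z) h = ip f h + ip g h"
    and ip_scale: "f \<in> H \<Longrightarrow> h \<in> H \<Longrightarrow> ip (\<lambda>z. c * f z) h = c * ip f h"
    and ip_cnj: "f \<in> H \<Longrightarrow> g \<in> H \<Longrightarrow> ip g f = cnj (ip f g)"
    and ip_pos: "f \<in> H \<Longrightarrow> f \<noteq> (\<lambda>z. 0) \<Longrightarrow> 0 < Re (ip f f)"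
    and complete: "(\<And>n. X n \<in> H) \<Longrightarrow>
      (\<And>e. 0 < e \<Longrightarrow> \<exists>N::nat. \<forall>m\<ge>N. \<forall>n\<ge>N.
         sqrt (Re (ip (\<lambda>z. X m z - X n z) (\<lambda>z. X m z - X n z))) < e) \<Longrightarrow>
      \<exists>f\<in>H. (\<lambda>n. sqrt (Re (ip (\<lambda>z. X n z - f z) (\<lambda>z. X n z - f z)))) \<longlonglongrightarrow> 0"
    and kernel_mem: "w \<in> D \<Longrightarrow> K w \<in> H"
    and reproducing: "w \<in> D \<Longrightarrow> f \<in> H \<Longrightarrow> ip f (K w) = f w"

definition dbr_kernel :: "(complex \<Rightarrow> complex) \<Rightarrow> complex \<Rightarrow> complex \<Rightarrow> complex" where
  "dbr_kernel b w z = (if z \<in> disc then (1 - cnj (b w) * b z) / (1 - cnj w * z) else 0)"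

text \<open>The de Branges--Rovnyak space \<open>\<H>(b)\<close>.\<close>

definition dbr_space :: "(complex \<Rightarrow> complex) \<Rightarrow> (complex \<Rightarrow> complex) set" where
  "dbr_space b = (THE H. \<exists>ip. rkhs disc (dbr_kernel b) H ip)"

text \<open>
  \<open>log u \<in> L\<^sup>1\<close> of the circle. Positivity almost everywhere is stated separately because
  \<open>ln 0 = 0\<close> in the library.
\<close>

definition log_integrable :: "(complex \<Rightarrow> real) \<Rightarrow> bool" where
  "log_integrable u \<longleftrightarrow> (AE \<zeta> in circle. 0 < u \<zeta>) \<and> integrable circle (\<lambda>\<zeta>. ln (u \<zeta>))"

text \<open>Outer functions, with \<open>k\<close> the logarithm of the boundary modulus.\<close>

definition outer :: "(complex \<Rightarrow> complex) \<Rightarrow> bool" where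
  "outer F \<longleftrightarrow> F \<in> hol_disc \<and> (\<exists>c (k :: complex \<Rightarrow> real). norm c = 1 \<and> integrable circle k \<and>
     (\<forall>z\<in>disc. F z = c * exp (LINT \<zeta>|circle. (\<zeta> + z) / (\<zeta> - z) * of_real (k \<zeta>))))"

definition pythagorean_mate :: "(complex \<Rightarrow> complex) \<Rightarrow> (complex \<Rightarrow> complex) \<Rightarrow> bool" where
  "pythagorean_mate b a \<longleftrightarrow> a \<in> Hinf \<and> outer a \<and> Im (a 0) = 0 \<and> 0 < Re (a 0) \<and>
     (AE \<zeta> in circle. (norm (bdry a \<zeta>))\<^sup>2 + (norm (bdry b \<zeta>))\<^sup>2 = 1)"

text \<open>The function \<open>f\<^sup>+\<close>, where \<open>a\<close> is the mate of \<open>b\<close>.\<close>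

definition dbr_plus ::
  "(complex \<Rightarrow> complex) \<Rightarrow> (complex \<Rightarrow> complex) \<Rightarrow> (complex \<Rightarrow> complex) \<Rightarrow> complex \<Rightarrow> complex" where
  "dbr_plus b a f = (THE h. h \<in> H2 \<and>
     toeplitz (\<lambda>\<zeta>. cnj (bdry b \<zeta>)) f = toeplitz (\<lambda>\<zeta>. cnj (bdry a \<zeta>)) h)"

text \<open>The function \<open>g\<close> that describes the antianalytic part of \<open>cnj b * f - cnj a * f\<^sup>+\<close>.\<close>

definition dbr_coanalytic ::
  "(complex \<Rightarrow> complex) \<Rightarrow> (complex \<Rightarrow> complex) \<Rightarrow> (complex \<Rightarrow> complex) \<Rightarrow> complex \<Rightarrow> complex" where
  "dbr_coanalytic b a f = (THE g. g \<in> H2 \<and> (AE \<zeta> in circle.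
     cnj (bdry b \<zeta>) * bdry f \<zeta> =
       cnj (bdry a \<zeta>) * bdry (dbr_plus b a f) \<zeta> + cnj (\<zeta> * bdry g \<zeta>)))"

end

theory Submission
  imports Defs
begin

text \<open>
  Put \<open>\<langle>f, g\<rangle>\<^sub>b = \<langle>f, g\<rangle> + \<langle>f\<^sup>+, g\<^sup>+\<rangle>\<close> on the space of all \<open>f \<in> H\<^sup>2\<close> that have a partner
  \<open>f\<^sup>+\<close>. From \<open>|a|\<^sup>2 + |b|\<^sup>2 = 1\<close> the kernel function \<open>(1 - cnj b(w) b) k\<^sub>w\<close> has the partner
  \<open>cnj b(w) a k\<^sub>w\<close>, so this is a Hilbert space with the kernel of \<open>\<H>(b)\<close>, hence it is \<open>\<H>(b)\<close>.
  Partners are unique because an outer function \<open>a\<close> is cyclic. For the formula, let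
  \<open>\<gamma> = w g(w) / a(w)\<close>. Then \<open>cnj b f k\<^sub>w - cnj a (f\<^sup>+ + cnj \<gamma>) k\<^sub>w\<close> is the conjugate of
  \<open>(z g - \<gamma> a) cnj k\<^sub>w\<close>, and its nonnegative Fourier coefficients vanish by Cauchy's formula since
  \<open>z g - \<gamma> a\<close> vanishes at \<open>w\<close>.

  Radial limits of \<open>H\<^sup>2\<close> functions exist almost everywhere by the \<open>L\<^sup>2\<close> maximal inequality,
  which is obtained by a \<open>T T\<^sup>*\<close> argument that needs no covering lemma.
\<close>

section \<open>Uniqueness of the space with a given reproducing kernel\<close>

text \<open>\<open>dbr_space\<close>, \<open>dbr_plus\<close> and \<open>dbr_coanalytic\<close> are
  definite descriptions, so they say nothing until existence and uniqueness are proved for each of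
  them. Boundary values are pointwise radial limits. Convergence of the dilates in mean square would
  produce some boundary function, but would not identify it with \<open>bdry\<close>, nor show that
  \<open>bdry\<close> respects products, which every computation on the circle uses. This is why
  convergence almost everywhere, and with it a maximal inequality, comes in. Behind the kernel
  computation and the final formula lies one fact: the Szego kernel at \<open>w\<close> is an
  eigenvector of every Toeplitz operator with symbol \<open>cnj G\<close>, \<open>G\<close>
  analytic, and the eigenvalue is \<open>cnj (G w)\<close>. The correction term in the formula is
  the one that makes such an eigenvalue vanish.\<close>

context rkhs
begin

lemma diff_mem: "f \<in> H \<Longrightarrow> g \<in> H \<Longrightarrow> (\<lambda>z. f z - g z) \<in> H"
  using add_mem[of f "\<lambda>z. (-1) * g z"] scale_mem[of g "-1"] by simp

lemma ip_diff: "f \<in> H \<Longrightarrow> g \<in> H \<Longrightarrow> h \<in> H \<Longrightarrow> ip (\<lambda>z. f z - g z) h = ip f h - ip g h"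
  using ip_add[of f "\<lambda>z. (-1) * g z" h] ip_scale[of g h "-1"] scale_mem[of g "-1"] by simp

lemma ip_add_right: "f \<in> H \<Longrightarrow> g \<in> H \<Longrightarrow> h \<in> H \<Longrightarrow> ip h (\<lambda>z. f z + g z) = ip h f + ip h g"
  using ip_cnj[of "\<lambda>z. f z + g z" h] ip_cnj[of f h] ip_cnj[of g h] ip_add[of f g h] add_mem[of f g]
  by simp

lemma ip_diff_right: "f \<in> H \<Longrightarrow> g \<in> H \<Longrightarrow> h \<in> H \<Longrightarrow> ip h (\<lambda>z. f z - g z) = ip h f - ip h g"
  using ip_cnj[of "\<lambda>z. f z - g z" h] ip_cnj[of f h] ip_cnj[of g h] ip_diff[of f g h] diff_mem[of f g]
  by simp

lemma ip_scale_right: "f \<in> H \<Longrightarrow> h \<in> H \<Longrightarrow> ip h (\<lambda>z. c * f z) = cnj c * ip h f"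
  using ip_cnj[of "\<lambda>z. c * f z" h] ip_cnj[of f h] ip_scale[of f h c] scale_mem[of f c]
  by simp

definition sqn :: "('a \<Rightarrow> complex) \<Rightarrow> real" where
  "sqn f = Re (ip f f)"

lemma sqn_nonneg: "f \<in> H \<Longrightarrow> 0 \<le> sqn f"
  using ip_pos[of f] ip_scale[OF zero_mem zero_mem, of 0]
  by (cases "f = (\<lambda>z. 0)") (auto simp: sqn_def)

lemma parallelogram:
  assumes "f \<in> H" "g \<in> H"
  shows "sqn (\<lambda>z. f z - g z) + sqn (\<lambda>z. f z + g z) = 2 * sqn f + 2 * sqn g"
  using assms by (simp add: sqn_def ip_add ip_diff ip_add_right ip_diff_right add_mem diff_mem)

lemma sqn_scale: "f \<in> H \<Longrightarrow> sqn (\<lambda>z. c * f z) = (norm c)\<^sup>2 * sqn f"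
proof -
  assume f: "f \<in> H"
  have "ip (\<lambda>z. c * f z) (\<lambda>z. c * f z) = (c * cnj c) * ip f f"
    using f by (simp add: ip_scale ip_scale_right scale_mem)
  also have "c * cnj c = of_real ((norm c)\<^sup>2)"
    by (rule complex_norm_square[symmetric])
  finally show ?thesis by (simp add: sqn_def)
qed

lemma sqn_diff_kernel:
  assumes f: "f \<in> H" and w: "w \<in> D"
  shows "sqn (\<lambda>z. f z - (of_real t * f w) * K w z) =
    sqn f - (norm (f w))\<^sup>2 * (2 * t - t\<^sup>2 * sqn (K w))"
proof -
  note K = kernel_mem[OF w]
  define c where "c = of_real t * f w"
  have cK: "(\<lambda>z. c * K w z) \<in> H" by (rule scale_mem[OF K])
  have e1: "ip f (K w) = f w" by (rule reproducing[OF w f])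
  have e2: "ip (K w) f = cnj (f w)" using ip_cnj[OF f K] e1 by simp
  have "ip (\<lambda>z. f z - c * K w z) (\<lambda>z. f z - c * K w z) =
     ip f f - cnj c * f w - c * cnj (f w) + c * cnj c * ip (K w) (K w)"
    using f K cK diff_mem[OF f cK]
    by (simp add: ip_diff ip_diff_right ip_scale ip_scale_right e1 e2 algebra_simps)
  moreover have "f w * cnj (f w) = of_real ((norm (f w))\<^sup>2)"
    by (rule complex_norm_square[symmetric])
  ultimately have "ip (\<lambda>z. f z - c * K w z) (\<lambda>z. f z - c * K w z) =
     ip f f - of_real ((norm (f w))\<^sup>2) * (2 * of_real t - of_real (t\<^sup>2) * ip (K w) (K w))"
    by (simp add: c_def algebra_simps power2_eq_square)
  then show ?thesis
    by (simp add: sqn_def c_def)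
qed

text \<open>A large value at \<open>w\<close> would allow the squared norm to be lowered noticeably
  by subtracting a multiple of \<open>K w\<close>, and \<open>d\<close> limits this. With
  \<open>d = 0\<close> this is continuity of evaluation; with \<open>d\<close> the squared distance
  to the kernel span it gives pointwise convergence of a minimizing sequence.\<close>

lemma evaluation_bound:
  assumes f: "f \<in> H" and w: "w \<in> D" and d: "\<And>c. d \<le> sqn (\<lambda>z. f z - c * K w z)"
  shows "(norm (f w))\<^sup>2 \<le> (sqn (K w) + 1) * (sqn f - d)"
proof -
  define k where "k = sqn (K w)"
  have k: "0 \<le> k" unfolding k_def by (rule sqn_nonneg[OF kernel_mem[OF w]])
  \<comment> \<open>The best choice would be the inverse of \<open>k\<close>; the added 1 covers
    \<open>k = 0\<close> and costs only a constant.\<close>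
  define t where "t = 1 / (k + 1)"
  have t: "t > 0" "t * (k + 1) = 1" using k by (auto simp: t_def)
  have "t\<^sup>2 * k = t * (t * (k + 1) - t)" by (simp add: power2_eq_square algebra_simps)
  also have "\<dots> = t - t\<^sup>2" using t by (simp add: power2_eq_square algebra_simps)
  finally have "t \<le> 2 * t - t\<^sup>2 * k" by simp
  then have "(norm (f w))\<^sup>2 * t \<le> (norm (f w))\<^sup>2 * (2 * t - t\<^sup>2 * k)"
    by (intro mult_left_mono) auto
  also have "\<dots> \<le> sqn f - d"
    using d[of "of_real t * f w"] sqn_diff_kernel[OF f w, of t] by (simp add: k_def)
  finally have "(norm (f w))\<^sup>2 \<le> (sqn f - d) / t"
    using t by (simp add: pos_le_divide_eq)
  then show ?thesis by (simp add: t_def k_def mult.commute)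
qed

text \<open>Built by adding one kernel multiple at a time, so that facts about two spaces sharing
  \<open>K\<close> transfer by induction.\<close>

inductive_set kernel_span where
  zero: "(\<lambda>z. 0) \<in> kernel_span"
| step: "s \<in> kernel_span \<Longrightarrow> w \<in> D \<Longrightarrow> (\<lambda>z. s z + c * K w z) \<in> kernel_span"

lemma kernel_span_mem: "s \<in> kernel_span \<Longrightarrow> s \<in> H"
  by (induction rule: kernel_span.induct) (auto intro!: zero_mem add_mem scale_mem[of "K w" for w] kernel_mem)

lemma kernel_span_add:
  "t \<in> kernel_span \<Longrightarrow> s \<in> kernel_span \<Longrightarrow> (\<lambda>z. s z + t z) \<in> kernel_span"
proof (induction rule: kernel_span.induct)
  case (step t w c)
  then have "(\<lambda>z. (s z + t z) + c * K w z) \<in> kernel_span"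
    by (intro kernel_span.step)
  then show ?case by (simp add: add.assoc)
qed simp

lemma kernel_span_scale: "t \<in> kernel_span \<Longrightarrow> (\<lambda>z. a * t z) \<in> kernel_span"
proof (induction rule: kernel_span.induct)
  case (step t w c)
  then have "(\<lambda>z. a * t z + (a * c) * K w z) \<in> kernel_span"
    by (intro kernel_span.step)
  then show ?case by (simp add: algebra_simps)
qed (simp add: kernel_span.zero)

lemma kernel_span_diff:
  "s \<in> kernel_span \<Longrightarrow> t \<in> kernel_span \<Longrightarrow> (\<lambda>z. s z - t z) \<in> kernel_span"
  using kernel_span_add[OF kernel_span_scale[of t "-1"], of s] by simp

text \<open>A minimizing sequence for the distance to the span of the kernel functions.\<close>

lemma kernel_span_approx:
  assumes f: "f \<in> H"
  obtains s where "\<And>n. s n \<in> kernel_span"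
    "\<And>m n. sqn (\<lambda>z. s m z - s n z) \<le> 2 / real (Suc m) + 2 / real (Suc n)"
    "\<And>w. w \<in> D \<Longrightarrow> (\<lambda>n. s n w) \<longlonglongrightarrow> f w"
proof -
  define V where "V = (\<lambda>s. sqn (\<lambda>z. f z - s z)) ` kernel_span"
  define d where "d = Inf V"
  have bdd: "bdd_below V"
    unfolding V_def bdd_below_def
    using sqn_nonneg[OF diff_mem[OF f kernel_span_mem]] by blast
  have le: "d \<le> sqn (\<lambda>z. f z - s z)" if "s \<in> kernel_span" for s
    unfolding d_def by (rule cInf_lower[OF _ bdd]) (use that in \<open>auto simp: V_def\<close>)
  have "\<exists>s\<in>kernel_span. sqn (\<lambda>z. f z - s z) < d + 1 / real (Suc n)" for n
  proof -
    have "V \<noteq> {}" using kernel_span.zero by (auto simp: V_def)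
    then have "\<exists>x\<in>V. x < d + 1 / real (Suc n)"
      using cInf_less_iff[OF _ bdd, of "d + 1 / real (Suc n)"] by (simp add: d_def)
    then show ?thesis by (auto simp: V_def)
  qed
  then obtain s where s: "\<And>n. s n \<in> kernel_span"
    and sd: "\<And>n. sqn (\<lambda>z. f z - s n z) < d + 1 / real (Suc n)"
    by metis
  have sH: "s n \<in> H" for n by (rule kernel_span_mem[OF s])
  have fs: "(\<lambda>z. f z - s n z) \<in> H" for n by (rule diff_mem[OF f sH])
  show thesis
  proof (rule that[OF s])
    fix m n
    \<comment> \<open>The midpoint lies in the span, so its squared distance to \<open>f\<close> is
      at least \<open>d\<close>; the parallelogram identity then turns near-minimality into
      closeness of \<open>s m\<close> and \<open>s n\<close>.\<close>
    define u where "u = (\<lambda>z. (1/2) * (s m z + s n z))"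
    have u: "u \<in> kernel_span"
      unfolding u_def by (intro kernel_span_scale kernel_span_add s)
    have "sqn (\<lambda>z. (f z - s n z) - (f z - s m z)) + sqn (\<lambda>z. (f z - s n z) + (f z - s m z)) =
       2 * sqn (\<lambda>z. f z - s n z) + 2 * sqn (\<lambda>z. f z - s m z)"
      by (rule parallelogram[OF fs fs])
    moreover have "(\<lambda>z. (f z - s n z) - (f z - s m z)) = (\<lambda>z. s m z - s n z)" by auto
    moreover have "(\<lambda>z. (f z - s n z) + (f z - s m z)) = (\<lambda>z. 2 * (f z - u z))"
      by (auto simp: u_def algebra_simps)
    moreover have "sqn (\<lambda>z. 2 * (f z - u z)) = 4 * sqn (\<lambda>z. f z - u z)"
      using sqn_scale[OF diff_mem[OF f kernel_span_mem[OF u]], of 2] by simp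
    ultimately show "sqn (\<lambda>z. s m z - s n z) \<le> 2 / real (Suc m) + 2 / real (Suc n)"
      using le[OF u] sd[of m] sd[of n] by simp
  next
    fix w assume w: "w \<in> D"
    \<comment> \<open>A further shift by a multiple of \<open>K w\<close> stays in the span, so
      \<open>d\<close> still bounds the distance from below and near-minimality controls the value
      of the residual at \<open>w\<close>.\<close>
    have b: "(norm (f w - s n w))\<^sup>2 \<le> (sqn (K w) + 1) * (1 / real (Suc n))" for n
    proof -
      have "(norm (f w - s n w))\<^sup>2 \<le> (sqn (K w) + 1) * (sqn (\<lambda>z. f z - s n z) - d)"
      proof (rule evaluation_bound[OF fs w])
        fix c
        show "d \<le> sqn (\<lambda>z. f z - s n z - c * K w z)"
          using le[OF kernel_span.step[OF s w], of n c] by (simp add: diff_diff_eq)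
      qed
      also have "\<dots> \<le> (sqn (K w) + 1) * (1 / real (Suc n))"
        using sd[of n] sqn_nonneg[OF kernel_mem[OF w]] by (intro mult_left_mono) auto
      finally show ?thesis .
    qed
    have "(\<lambda>n. (norm (f w - s n w))\<^sup>2) \<longlonglongrightarrow> 0"
    proof (rule tendsto_sandwich[OF _ _ tendsto_const])
      show "(\<lambda>n. (sqn (K w) + 1) * (1 / real (Suc n))) \<longlonglongrightarrow> 0"
        using LIMSEQ_inverse_real_of_nat
        by (intro tendsto_mult_right_zero) (simp add: inverse_eq_divide)
    qed (use b in auto)
    then have "(\<lambda>n. norm (f w - s n w)) \<longlonglongrightarrow> 0"
      by (simp add: power_tendsto_0_iff)
    then have "(\<lambda>n. f w - s n w) \<longlonglongrightarrow> 0" by (rule tendsto_norm_zero_cancel)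
    from tendsto_diff[OF tendsto_const[of "f w"] this] show "(\<lambda>n. s n w) \<longlonglongrightarrow> f w" by simp
  qed
qed

end

text \<open>On the common kernel span the two inner products agree, because the reproducing property
  computes both. A Cauchy sequence of the span that converges pointwise to \<open>f\<close> is
  therefore Cauchy in the other space as well, and its limit there has the values of
  \<open>f\<close>.\<close>

lemma rkhs_subset:
  assumes 1: "rkhs D K HA ip1" and 2: "rkhs D K HB ip2"
  shows "HA \<subseteq> HB"
proof
  interpret A: rkhs D K HA ip1 by fact
  interpret B: rkhs D K HB ip2 by fact
  have span: "A.kernel_span = B.kernel_span"
  proof (intro equalityI subsetI)
    show "s \<in> B.kernel_span" if "s \<in> A.kernel_span" for s
      using that by (induction rule: A.kernel_span.induct) (auto intro: B.kernel_span.intros)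
    show "s \<in> A.kernel_span" if "s \<in> B.kernel_span" for s
      using that by (induction rule: B.kernel_span.induct) (auto intro: A.kernel_span.intros)
  qed
  have ip: "ip1 s t = ip2 s t" if "t \<in> A.kernel_span" "s \<in> A.kernel_span" for s t
    using that
  proof (induction rule: A.kernel_span.induct)
    case zero
    then have "s \<in> HA" "s \<in> HB" using A.kernel_span_mem B.kernel_span_mem span by auto
    then show ?case
      using A.ip_scale_right[OF A.zero_mem, of s 0] B.ip_scale_right[OF B.zero_mem, of s 0] by simp
  next
    case (step t w c)
    then have m: "s \<in> HA" "s \<in> HB" "t \<in> HA" "t \<in> HB"
      using A.kernel_span_mem B.kernel_span_mem span by auto
    note k = A.kernel_mem[OF step(2)] B.kernel_mem[OF step(2)]
    show ?case
      using step m k A.scale_mem[OF k(1)] B.scale_mem[OF k(2)]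
      by (simp add: A.ip_add_right B.ip_add_right A.ip_scale_right B.ip_scale_right
          A.reproducing B.reproducing)
  qed
  fix f assume f: "f \<in> HA"
  obtain s where s: "\<And>n. s n \<in> A.kernel_span"
    "\<And>m n. A.sqn (\<lambda>z. s m z - s n z) \<le> 2 / real (Suc m) + 2 / real (Suc n)"
    "\<And>w. w \<in> D \<Longrightarrow> (\<lambda>n. s n w) \<longlonglongrightarrow> f w"
    using A.kernel_span_approx[OF f] by blast
  have sH: "s n \<in> HB" for n using s(1) span B.kernel_span_mem by auto
  have bound: "B.sqn (\<lambda>z. s m z - s n z) \<le> 2 / real (Suc m) + 2 / real (Suc n)" for m n
    using s(2)[of m n] ip[OF A.kernel_span_diff A.kernel_span_diff, OF s(1) s(1) s(1) s(1), of m n m n]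
    by (simp add: A.sqn_def B.sqn_def)
  have "\<exists>g\<in>HB. (\<lambda>n. sqrt (Re (ip2 (\<lambda>z. s n z - g z) (\<lambda>z. s n z - g z)))) \<longlonglongrightarrow> 0"
  proof (rule B.complete[OF sH])
    fix e :: real assume e: "0 < e"
    have "(\<lambda>n. 4 / real (Suc n)) \<longlonglongrightarrow> 0"
      using tendsto_mult_right_zero[OF LIMSEQ_inverse_real_of_nat, of 4]
      by (simp add: inverse_eq_divide)
    moreover have "0 < e\<^sup>2" using e by simp
    ultimately have "\<forall>\<^sub>F n in sequentially. 4 / real (Suc n) < e\<^sup>2"
      by (rule order_tendstoD(2))
    then obtain N where N: "4 / real (Suc N) < e\<^sup>2"
      by (auto simp: eventually_sequentially)
    have "sqrt (B.sqn (\<lambda>z. s m z - s n z)) < e" if "m \<ge> N" "n \<ge> N" for m n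
    proof -
      have "2 / real (Suc m) \<le> 2 / real (Suc N)" "2 / real (Suc n) \<le> 2 / real (Suc N)"
        using that by (auto intro!: divide_left_mono)
      then have "B.sqn (\<lambda>z. s m z - s n z) < e\<^sup>2"
        using bound[of m n] N by simp
      then show ?thesis using e by (simp add: real_sqrt_less_iff real_less_lsqrt)
    qed
    then show "\<exists>N. \<forall>m\<ge>N. \<forall>n\<ge>N. sqrt (Re (ip2 (\<lambda>z. s m z - s n z) (\<lambda>z. s m z - s n z))) < e"
      by (auto simp: B.sqn_def)
  qed
  then obtain g where g: "g \<in> HB" and lim: "(\<lambda>n. sqrt (B.sqn (\<lambda>z. s n z - g z))) \<longlonglongrightarrow> 0"
    by (auto simp: B.sqn_def)
  have lim': "(\<lambda>n. B.sqn (\<lambda>z. s n z - g z)) \<longlonglongrightarrow> 0"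
  proof -
    have "(sqrt (B.sqn (\<lambda>z. s n z - g z)))\<^sup>2 = B.sqn (\<lambda>z. s n z - g z)" for n
      using B.sqn_nonneg[OF B.diff_mem[OF sH g]] by simp
    with tendsto_power[OF lim, of 2] show ?thesis by simp
  qed
  have "f w = g w" for w
  proof (cases "w \<in> D")
    case w: True
    have b: "(norm (s n w - g w))\<^sup>2 \<le> (B.sqn (K w) + 1) * B.sqn (\<lambda>z. s n z - g z)" for n
      using B.evaluation_bound[OF B.diff_mem[OF sH g] w, of 0 n]
        B.sqn_nonneg[OF B.diff_mem[OF B.diff_mem[OF sH g] B.scale_mem[OF B.kernel_mem[OF w]]]]
      by simp
    have "(\<lambda>n. (norm (s n w - g w))\<^sup>2) \<longlonglongrightarrow> 0"
    proof (rule tendsto_sandwich[OF _ _ tendsto_const])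
      show "(\<lambda>n. (B.sqn (K w) + 1) * B.sqn (\<lambda>z. s n z - g z)) \<longlonglongrightarrow> 0"
        by (rule tendsto_mult_right_zero[OF lim'])
    qed (use b in auto)
    then have "(\<lambda>n. norm (s n w - g w)) \<longlonglongrightarrow> 0"
      by (simp add: power_tendsto_0_iff)
    then have "(\<lambda>n. s n w) \<longlonglongrightarrow> g w"
      by (rule LIM_zero_cancel[OF tendsto_norm_zero_cancel])
    with s(3)[OF w] show ?thesis using LIMSEQ_unique by blast
  next
    case False
    then show ?thesis using A.support[OF f] B.support[OF g] by simp
  qed
  then have "f = g" by auto
  with g show "f \<in> HB" by simp
qed

lemma rkhs_unique: "rkhs D K HA ip1 \<Longrightarrow> rkhs D K HB ip2 \<Longrightarrow> HA = HB"
  using rkhs_subset by blast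

section \<open>Fourier coefficients on the circle\<close>

lemma sets_circle [measurable_cong, simp]: "sets circle = sets borel"
  by (simp add: circle_def)

lemma space_circle [simp]: "space circle = UNIV"
  by (simp add: circle_def)

lemma cis_borel [measurable]: "cis \<in> borel_measurable borel"
  by (intro borel_measurable_continuous_onI) (auto intro!: continuous_intros simp: cis_conv_exp)

lemma cnj_borel [measurable]: "cnj \<in> borel_measurable borel"
  by (intro borel_measurable_continuous_onI continuous_on_cnj continuous_on_id)

lemma emeasure_period: "emeasure lborel {0..2 * pi} = ennreal (2 * pi)"
  by simp

lemma emeasure_circle: "emeasure circle UNIV = 1"
  unfolding circle_def by (subst emeasure_distr) (auto simp: emeasure_uniform_measure_1)

interpretation circle: finite_measure circle
  by standard (simp add: emeasure_circle)

lemma measure_circle [simp]: "measure circle UNIV = 1"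
  by (simp add: measure_def emeasure_circle)

lemma AE_circle_norm: "AE \<zeta> in circle. norm \<zeta> = 1"
proof -
  have "AE t in uniform_measure lborel {0..2 * pi}. norm (cis t) = 1" by simp
  then show ?thesis unfolding circle_def by (subst AE_distr_iff) auto
qed

lemma AE_circleI: "(\<And>\<zeta>. norm \<zeta> = 1 \<Longrightarrow> P \<zeta>) \<Longrightarrow> AE \<zeta> in circle. P \<zeta>"
  using AE_circle_norm by (rule eventually_mono) auto

lemma integral_circle_cong:
  fixes u v :: "complex \<Rightarrow> 'a::{banach, second_countable_topology}"
  assumes "u \<in> borel_measurable borel" "v \<in> borel_measurable borel"
    "\<And>\<zeta>. norm \<zeta> = 1 \<Longrightarrow> u \<zeta> = v \<zeta>"
  shows "(LINT \<zeta>|circle. u \<zeta>) = (LINT \<zeta>|circle. v \<zeta>)"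
  by (rule integral_cong_AE) (use assms in \<open>auto intro: AE_circleI\<close>)

lemma integrable_circle_bounded:
  fixes u :: "complex \<Rightarrow> 'a::{banach, second_countable_topology}"
  assumes "u \<in> borel_measurable borel" "\<And>\<zeta>. norm \<zeta> = 1 \<Longrightarrow> norm (u \<zeta>) \<le> B"
  shows "integrable circle u"
  by (rule circle.integrable_const_bound[of u B]) (use assms in \<open>auto intro: AE_circleI\<close>)

lemma integral_circle_power: "(LINT \<zeta>|circle. \<zeta> ^ n) = (if n = 0 then 1 else 0)"
proof (cases "n = 0")
  case False
  have "(LINT \<zeta>|circle. \<zeta> ^ n) = (LINT t|uniform_measure lborel {0..2 * pi}. cis t ^ n)"
    unfolding circle_def by (rule integral_distr) auto
  also have "uniform_measure lborel {0..2 * pi} =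
      density lborel (\<lambda>t. ennreal (indicator {0..2 * pi} t / (2 * pi)))"
    unfolding uniform_measure_def emeasure_period
    by (intro density_cong) (auto split: split_indicator simp: divide_ennreal ennreal_1[symmetric] simp del: ennreal_1)
  also have "(LINT t|\<dots>. cis t ^ n) = (LINT t|lborel. (indicator {0..2 * pi} t / (2 * pi)) *\<^sub>R cis t ^ n)"
    by (rule integral_density) auto
  also have "\<dots> = (LINT t|lborel. indicator {0..2 * pi} t *\<^sub>R (cis (real n * t) /\<^sub>R (2 * pi)))"
    by (simp only: Complex.DeMoivre scaleR_conv_of_real of_real_divide of_real_mult of_real_inverse divide_inverse mult.assoc mult.commute mult.left_commute)
  also have "\<dots> = (cis (real n * (2 * pi)) / (\<i> * of_nat n)) /\<^sub>R (2 * pi)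
      - (cis (real n * 0) / (\<i> * of_nat n)) /\<^sub>R (2 * pi)"
  proof (rule integral_FTC_Icc)
    fix t :: real
    have "((\<lambda>t. cis (real n * t)) has_vector_derivative (real n *\<^sub>R (\<i> * cis (real n * t)))) (at t within {0..2 * pi})"
      by (auto intro!: derivative_eq_intros simp: has_vector_derivative_def algebra_simps)
    then show "((\<lambda>t. (cis (real n * t) / (\<i> * of_nat n)) /\<^sub>R (2 * pi)) has_vector_derivative
        cis (real n * t) /\<^sub>R (2 * pi)) (at t within {0..2 * pi})"
      using False by (auto intro!: derivative_eq_intros simp: scaleR_conv_of_real field_simps)
  qed (auto intro!: continuous_intros simp: cis_conv_exp)
  also have "\<dots> = 0"
    using cis_multiple_2pi[of "real n"] by (simp add: mult_ac)
  finally show ?thesis using False by simp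
qed simp

lemma integral_circle_power_cnj: "(LINT \<zeta>|circle. cnj \<zeta> ^ n) = (if n = 0 then 1 else 0)"
proof -
  have "(LINT \<zeta>|circle. cnj (\<zeta> ^ n)) = cnj (LINT \<zeta>|circle. \<zeta> ^ n)"
    by (rule Bochner_Integration.integral_cnj)
  then show ?thesis by (simp add: integral_circle_power)
qed

lemma circle_cancel:
  fixes \<zeta> :: complex assumes "norm \<zeta> = 1" shows "\<zeta> * cnj \<zeta> = 1" "cnj \<zeta> * \<zeta> = 1"
  using assms complex_norm_square[of \<zeta>] by (auto simp: mult.commute)

lemma circle_cancel_power:
  fixes \<zeta> :: complex assumes "norm \<zeta> = 1" shows "\<zeta> ^ n * cnj \<zeta> ^ n = 1" "cnj \<zeta> ^ n * \<zeta> ^ n = 1"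
  using circle_cancel[OF assms] by (metis power_mult_distrib power_one)+

lemma integral_circle_powers:
  "(LINT \<zeta>|circle. \<zeta> ^ m * cnj \<zeta> ^ n) = (if m = n then 1 else 0)"
proof (cases "n \<le> m")
  case True
  then obtain k where k: "m = n + k" using le_Suc_ex by blast
  have "(LINT \<zeta>|circle. \<zeta> ^ m * cnj \<zeta> ^ n) = (LINT \<zeta>|circle. \<zeta> ^ k)"
    by (rule integral_circle_cong) (auto simp: k power_add circle_cancel_power algebra_simps)
  then show ?thesis using k by (auto simp: integral_circle_power)
next
  case False
  then obtain k where k: "n = m + k" using le_Suc_ex by (metis nat_le_linear)
  have "(LINT \<zeta>|circle. \<zeta> ^ m * cnj \<zeta> ^ n) = (LINT \<zeta>|circle. cnj \<zeta> ^ k)"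
    by (rule integral_circle_cong) (auto simp: k power_add circle_cancel_power mult.assoc[symmetric])
  then show ?thesis using k False by (auto simp: integral_circle_power_cnj)
qed

lemma norm_mult_le_squares:
  fixes x y :: complex
  shows "norm (x * y) \<le> (norm x)\<^sup>2 + (norm y)\<^sup>2"
proof -
  have "2 * (norm x * norm y) \<le> (norm x)\<^sup>2 + (norm y)\<^sup>2"
    using sum_squares_bound[of "norm x" "norm y"] by (simp add: mult.assoc)
  moreover have "0 \<le> norm x * norm y" by simp
  ultimately show ?thesis unfolding norm_mult by linarith
qed

lemma norm_add_square_le:
  fixes x y :: complex
  shows "(norm (x + y))\<^sup>2 \<le> 2 * (norm x)\<^sup>2 + 2 * (norm y)\<^sup>2"
proof -
  have "(norm (x + y))\<^sup>2 \<le> (norm x + norm y)\<^sup>2" by (intro power_mono norm_triangle_ineq) auto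
  also have "\<dots> \<le> 2 * (norm x)\<^sup>2 + 2 * (norm y)\<^sup>2"
    using sum_squares_bound[of "norm x" "norm y"] by (simp add: power2_sum)
  finally show ?thesis .
qed

lemma nonpos_if_le_epsilon_mult:
  fixes x C :: real
  assumes "0 \<le> C" and le: "\<And>e. 0 < e \<Longrightarrow> x \<le> e * C"
  shows "x \<le> 0"
proof (rule field_le_epsilon)
  fix e :: real assume e: "0 < e"
  have "x \<le> e / (C + 1) * C" using e assms(1) by (intro le) simp
  also have "\<dots> \<le> e" using e assms(1) by (simp add: field_simps)
  finally show "x \<le> 0 + e" by simp
qed

section \<open>Square-integrable functions on the circle\<close>

definition L2_circle :: "(complex \<Rightarrow> complex) set" where
  "L2_circle = {u \<in> borel_measurable borel. integrable circle (\<lambda>\<zeta>. (norm (u \<zeta>))\<^sup>2)}"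

lemma L2_circle_measurable: "u \<in> L2_circle \<Longrightarrow> u \<in> borel_measurable borel"
  by (simp add: L2_circle_def)

lemma L2_circle_bounded:
  assumes "u \<in> borel_measurable borel" "\<And>\<zeta>. norm \<zeta> = 1 \<Longrightarrow> norm (u \<zeta>) \<le> B"
  shows "u \<in> L2_circle"
proof -
  have [measurable]: "u \<in> borel_measurable borel" by fact
  have "integrable circle (\<lambda>\<zeta>. (norm (u \<zeta>))\<^sup>2)"
    by (rule integrable_circle_bounded[where B = "B\<^sup>2"]) (auto intro!: power_mono assms)
  then show ?thesis by (simp add: L2_circle_def)
qed

lemma L2_circle_dominated:
  assumes "u \<in> L2_circle" "v \<in> borel_measurable borel"
    "AE \<zeta> in circle. norm (v \<zeta>) \<le> B * norm (u \<zeta>)"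
  shows "v \<in> L2_circle"
proof -
  have [measurable]: "u \<in> borel_measurable borel" "v \<in> borel_measurable borel"
    using assms by (auto simp: L2_circle_def)
  have "integrable circle (\<lambda>\<zeta>. (norm (v \<zeta>))\<^sup>2)"
  proof (rule Bochner_Integration.integrable_bound)
    show "integrable circle (\<lambda>\<zeta>. B\<^sup>2 * (norm (u \<zeta>))\<^sup>2)"
      using assms by (simp add: L2_circle_def)
    show "AE \<zeta> in circle. norm ((norm (v \<zeta>))\<^sup>2) \<le> norm (B\<^sup>2 * (norm (u \<zeta>))\<^sup>2)"
      using assms(3) by eventually_elim (auto simp: power_mult_distrib[symmetric] intro!: power_mono)
  qed simp
  then show ?thesis by (simp add: L2_circle_def)
qed

lemma L2_circle_add:
  assumes "u \<in> L2_circle" "v \<in> L2_circle"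
  shows "(\<lambda>\<zeta>. u \<zeta> + v \<zeta>) \<in> L2_circle"
proof -
  have [measurable]: "u \<in> borel_measurable borel" "v \<in> borel_measurable borel"
    using assms by (auto simp: L2_circle_def)
  have "integrable circle (\<lambda>\<zeta>. (norm (u \<zeta> + v \<zeta>))\<^sup>2)"
  proof (rule Bochner_Integration.integrable_bound)
    show "integrable circle (\<lambda>\<zeta>. 2 * (norm (u \<zeta>))\<^sup>2 + 2 * (norm (v \<zeta>))\<^sup>2)"
      using assms by (simp add: L2_circle_def)
    show "AE \<zeta> in circle. norm ((norm (u \<zeta> + v \<zeta>))\<^sup>2) \<le> norm (2 * (norm (u \<zeta>))\<^sup>2 + 2 * (norm (v \<zeta>))\<^sup>2)"
      using norm_add_square_le by simp
  qed simp
  then show ?thesis by (simp add: L2_circle_def)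
qed

lemma L2_circle_scale: "u \<in> L2_circle \<Longrightarrow> (\<lambda>\<zeta>. c * u \<zeta>) \<in> L2_circle"
  by (rule L2_circle_dominated[where B = "norm c"])
    (auto simp: norm_mult L2_circle_def intro!: borel_measurable_times)

lemma L2_circle_cnj: "u \<in> L2_circle \<Longrightarrow> (\<lambda>\<zeta>. cnj (u \<zeta>)) \<in> L2_circle"
  by (rule L2_circle_dominated[where B = 1])
    (auto simp: L2_circle_def intro!: measurable_compose[OF _ cnj_borel])

lemma L2_circle_diff:
  "u \<in> L2_circle \<Longrightarrow> v \<in> L2_circle \<Longrightarrow> (\<lambda>\<zeta>. u \<zeta> - v \<zeta>) \<in> L2_circle"
  using L2_circle_add[of u "\<lambda>\<zeta>. (-1) * v \<zeta>"] L2_circle_scale[of v "-1"] by simp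

lemma L2_circle_mult_integrable:
  assumes "u \<in> L2_circle" "v \<in> L2_circle"
  shows "integrable circle (\<lambda>\<zeta>. u \<zeta> * v \<zeta>)"
proof (rule Bochner_Integration.integrable_bound)
  have [measurable]: "u \<in> borel_measurable borel" "v \<in> borel_measurable borel"
    using assms by (auto simp: L2_circle_def)
  show "integrable circle (\<lambda>\<zeta>. (norm (u \<zeta>))\<^sup>2 + (norm (v \<zeta>))\<^sup>2)"
    using assms by (simp add: L2_circle_def)
  show "AE \<zeta> in circle. norm (u \<zeta> * v \<zeta>) \<le> norm ((norm (u \<zeta>))\<^sup>2 + (norm (v \<zeta>))\<^sup>2)"
    using norm_mult_le_squares by simp
  show "(\<lambda>\<zeta>. u \<zeta> * v \<zeta>) \<in> borel_measurable circle" by measurable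
qed

lemma L2_circle_inner_integrable:
  "u \<in> L2_circle \<Longrightarrow> v \<in> L2_circle \<Longrightarrow> integrable circle (\<lambda>\<zeta>. u \<zeta> * cnj (v \<zeta>))"
  by (rule L2_circle_mult_integrable[OF _ L2_circle_cnj])

lemma L2_circle_const: "(\<lambda>\<zeta>. c) \<in> L2_circle"
  by (rule L2_circle_bounded[of _ "norm c"]) auto

lemma L2_circle_power: "(\<lambda>\<zeta>. \<zeta> ^ n) \<in> L2_circle"
  by (rule L2_circle_bounded[of _ 1]) (auto simp: norm_power)

lemma L2_circle_integrable: "u \<in> L2_circle \<Longrightarrow> integrable circle u"
  using L2_circle_mult_integrable[OF _ L2_circle_const[of 1]] by simp

lemma L2_circle_sum:
  "(\<And>i. i \<in> I \<Longrightarrow> u i \<in> L2_circle) \<Longrightarrow> (\<lambda>\<zeta>. \<Sum>i\<in>I. u i \<zeta>) \<in> L2_circle"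
  by (induction I rule: infinite_finite_induct) (auto intro: L2_circle_add L2_circle_const)

text \<open>Only indices \<open>n \<ge> 0\<close>; the coefficient of index \<open>-n\<close> is
  written as the integral against \<open>\<zeta> ^ n\<close>.\<close>

definition fourier :: "(complex \<Rightarrow> complex) \<Rightarrow> nat \<Rightarrow> complex" where
  "fourier u n = (LINT \<zeta>|circle. u \<zeta> * cnj \<zeta> ^ n)"

lemma integrable_mult_power_cnj:
  assumes "integrable circle u"
  shows "integrable circle (\<lambda>\<zeta>. u \<zeta> * cnj \<zeta> ^ n)"
proof (rule Bochner_Integration.integrable_bound[OF assms])
  show "(\<lambda>\<zeta>. u \<zeta> * cnj \<zeta> ^ n) \<in> borel_measurable circle"
    using borel_measurable_integrable[OF assms] by measurable
qed (auto intro!: AE_circleI simp: norm_mult norm_power)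

lemma fourier_add:
  "integrable circle u \<Longrightarrow> integrable circle v \<Longrightarrow>
    fourier (\<lambda>\<zeta>. u \<zeta> + v \<zeta>) n = fourier u n + fourier v n"
  by (simp add: fourier_def distrib_right integrable_mult_power_cnj)

lemma fourier_diff:
  "integrable circle u \<Longrightarrow> integrable circle v \<Longrightarrow>
    fourier (\<lambda>\<zeta>. u \<zeta> - v \<zeta>) n = fourier u n - fourier v n"
  by (simp add: fourier_def left_diff_distrib integrable_mult_power_cnj)

lemma fourier_scale: "fourier (\<lambda>\<zeta>. c * u \<zeta>) n = c * fourier u n"
  by (simp add: fourier_def mult.assoc)

text \<open>Geometric expansion of the kernel, integrated term by term under the bound
  \<open>norm z ^ n * norm (u \<zeta>)\<close>. It is stated for integrable \<open>u\<close> because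
  the Herglotz integrals below have data that are merely integrable.\<close>

lemma cauchy_transform:
  assumes u: "integrable circle u" and z: "norm z < 1"
  shows "(\<lambda>n. fourier u n * z ^ n) sums (LINT \<zeta>|circle. u \<zeta> / (1 - z * cnj \<zeta>))"
proof -
  have [measurable]: "u \<in> borel_measurable borel"
    using borel_measurable_integrable[OF u] by simp
  define F where "F = (\<lambda>n \<zeta>. u \<zeta> * cnj \<zeta> ^ n * z ^ n)"
  have i: "integrable circle (F n)" for n
    unfolding F_def by (intro integrable_mult_left integrable_mult_power_cnj u)
  have ni: "(LINT \<zeta>|circle. norm (F n \<zeta>)) = norm z ^ n * (LINT \<zeta>|circle. norm (u \<zeta>))" for n
  proof -
    have "(LINT \<zeta>|circle. norm (F n \<zeta>)) = (LINT \<zeta>|circle. norm z ^ n * norm (u \<zeta>))"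
      by (rule integral_circle_cong) (auto simp: F_def norm_mult norm_power)
    then show ?thesis by simp
  qed
  have s1: "AE \<zeta> in circle. summable (\<lambda>n. norm (F n \<zeta>))"
  proof (rule AE_circleI)
    fix \<zeta> :: complex assume "norm \<zeta> = 1"
    then show "summable (\<lambda>n. norm (F n \<zeta>))"
      using z by (simp add: F_def norm_mult norm_power summable_mult summable_geometric)
  qed
  have s2: "summable (\<lambda>n. LINT \<zeta>|circle. norm (F n \<zeta>))"
    unfolding ni using z by (intro summable_mult2 summable_geometric) simp
  have "(\<lambda>n. LINT \<zeta>|circle. F n \<zeta>) sums (LINT \<zeta>|circle. (\<Sum>n. F n \<zeta>))"
    by (rule sums_integral[OF i s1 s2])
  moreover have "(LINT \<zeta>|circle. (\<Sum>n. F n \<zeta>)) = (LINT \<zeta>|circle. u \<zeta> / (1 - z * cnj \<zeta>))"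
  proof (rule integral_circle_cong)
    show "(\<lambda>\<zeta>. \<Sum>n. F n \<zeta>) \<in> borel_measurable borel" unfolding F_def by measurable
    fix \<zeta> :: complex assume n: "norm \<zeta> = 1"
    have "(\<lambda>n. u \<zeta> * (z * cnj \<zeta>) ^ n) sums (u \<zeta> * (1 / (1 - z * cnj \<zeta>)))"
      by (intro sums_mult geometric_sums) (use z n in \<open>simp add: norm_mult\<close>)
    then show "(\<Sum>n. F n \<zeta>) = u \<zeta> / (1 - z * cnj \<zeta>)"
      by (intro sums_unique[symmetric]) (simp add: F_def power_mult_distrib mult_ac)
  qed measurable
  ultimately show ?thesis by (simp add: F_def fourier_def)
qed

text \<open>The squared distance of \<open>u\<close> to its Fourier polynomial \<open>p\<close> is
  nonnegative, and both \<open>\<langle>u, p\<rangle>\<close> and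
  \<open>\<langle>p, p\<rangle>\<close> equal the sum on the left.\<close>

lemma bessel:
  assumes u: "u \<in> L2_circle"
  shows "(\<Sum>n<N. (norm (fourier u n))\<^sup>2) \<le> (LINT \<zeta>|circle. (norm (u \<zeta>))\<^sup>2)"
proof -
  define p where "p = (\<lambda>\<zeta>::complex. \<Sum>n<N. fourier u n * \<zeta> ^ n)"
  have p: "p \<in> L2_circle"
    unfolding p_def by (intro L2_circle_sum L2_circle_scale L2_circle_power)
  have e: "u \<zeta> * cnj (p \<zeta>) = (\<Sum>n<N. cnj (fourier u n) * (u \<zeta> * cnj \<zeta> ^ n))" for \<zeta>
    by (simp add: p_def sum_distrib_left mult_ac)
  have up: "(LINT \<zeta>|circle. u \<zeta> * cnj (p \<zeta>)) = of_real (\<Sum>n<N. (norm (fourier u n))\<^sup>2)"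
    unfolding e using integrable_mult_power_cnj[OF L2_circle_integrable[OF u]]
    by (simp add: fourier_def[symmetric] mult.commute[of "cnj z" for z] complex_norm_square[symmetric] del: of_real_power)
  have e2: "p \<zeta> * cnj (p \<zeta>) = (\<Sum>n<N. \<Sum>m<N. cnj (fourier u n) * fourier u m * (\<zeta> ^ m * cnj \<zeta> ^ n))" for \<zeta>
    by (simp add: p_def sum_distrib_left sum_distrib_right mult_ac)
  have "integrable circle (\<lambda>\<zeta>. \<zeta> ^ m * cnj \<zeta> ^ n)" for m n
    using integrable_mult_power_cnj[OF L2_circle_integrable[OF L2_circle_power]] .
  then have pp: "(LINT \<zeta>|circle. p \<zeta> * cnj (p \<zeta>)) = of_real (\<Sum>n<N. (norm (fourier u n))\<^sup>2)"
    unfolding e2 by (simp add: integral_circle_powers mult.commute[of "cnj z" for z] complex_norm_square[symmetric] if_distrib del: of_real_power cong: if_cong)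
  have i: "integrable circle (\<lambda>\<zeta>. complex_of_real ((norm (u \<zeta>))\<^sup>2))"
    by (rule integrable_of_real) (use u in \<open>simp add: L2_circle_def\<close>)
  note i2 = L2_circle_inner_integrable[OF u p]
  note i3 = L2_circle_inner_integrable[OF p p]
  note i4 = integrable_cnj[OF i2]
  have "(norm (x - y))\<^sup>2 = Re (of_real ((norm x)\<^sup>2) - x * cnj y - cnj (x * cnj y) + y * cnj y)" for x y :: complex
    unfolding cmod_power2 by (simp add: power2_eq_square algebra_simps)
  then have "(LINT \<zeta>|circle. (norm (u \<zeta> - p \<zeta>))\<^sup>2) = (LINT \<zeta>|circle. Re (of_real ((norm (u \<zeta>))\<^sup>2) - u \<zeta> * cnj (p \<zeta>)
      - cnj (u \<zeta> * cnj (p \<zeta>)) + p \<zeta> * cnj (p \<zeta>)))"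
    by (simp only:)
  also have "\<dots> = Re (LINT \<zeta>|circle. of_real ((norm (u \<zeta>))\<^sup>2) - u \<zeta> * cnj (p \<zeta>)
      - cnj (u \<zeta> * cnj (p \<zeta>)) + p \<zeta> * cnj (p \<zeta>))"
    by (rule integral_Re) (intro Bochner_Integration.integrable_add Bochner_Integration.integrable_diff i i2 i3 i4)
  also have "(LINT \<zeta>|circle. of_real ((norm (u \<zeta>))\<^sup>2) - u \<zeta> * cnj (p \<zeta>)
      - cnj (u \<zeta> * cnj (p \<zeta>)) + p \<zeta> * cnj (p \<zeta>)) =
     (LINT \<zeta>|circle. complex_of_real ((norm (u \<zeta>))\<^sup>2)) - (LINT \<zeta>|circle. u \<zeta> * cnj (p \<zeta>))
      - cnj (LINT \<zeta>|circle. u \<zeta> * cnj (p \<zeta>)) + (LINT \<zeta>|circle. p \<zeta> * cnj (p \<zeta>))"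
    by (subst Bochner_Integration.integral_add[OF _ i3] Bochner_Integration.integral_diff[OF _ i4] Bochner_Integration.integral_diff[OF i i2],
      (intro Bochner_Integration.integrable_diff i i2 i4)?)+ (simp only: Bochner_Integration.integral_cnj)
  finally have "(LINT \<zeta>|circle. (norm (u \<zeta> - p \<zeta>))\<^sup>2) =
      (LINT \<zeta>|circle. (norm (u \<zeta>))\<^sup>2) - (\<Sum>n<N. (norm (fourier u n))\<^sup>2)"
    unfolding up pp integral_complex_of_real by simp
  moreover have "0 \<le> (LINT \<zeta>|circle. (norm (u \<zeta> - p \<zeta>))\<^sup>2)" by simp
  ultimately show ?thesis by simp
qed

lemma bessel_summable:
  assumes u: "u \<in> L2_circle"
  shows "summable (\<lambda>n. (norm (fourier u n))\<^sup>2)"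
    and "(\<Sum>n. (norm (fourier u n))\<^sup>2) \<le> (LINT \<zeta>|circle. (norm (u \<zeta>))\<^sup>2)"
proof -
  show s: "summable (\<lambda>n. (norm (fourier u n))\<^sup>2)"
    by (rule summableI_nonneg_bounded[OF _ bessel[OF u]]) simp
  show "(\<Sum>n. (norm (fourier u n))\<^sup>2) \<le> (LINT \<zeta>|circle. (norm (u \<zeta>))\<^sup>2)"
    by (rule suminf_le_const[OF s bessel[OF u]])
qed

section \<open>Power series and the Hardy space\<close>

lemma hol_disc_measurable: "f \<in> hol_disc \<Longrightarrow> f \<in> borel_measurable borel"
proof -
  assume f: "f \<in> hol_disc"
  have "(\<lambda>z. indicator disc z *\<^sub>R f z) \<in> borel_measurable borel"
    using f by (intro borel_measurable_continuous_on_indicator)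
      (auto simp: hol_disc_def intro: holomorphic_on_imp_continuous_on)
  moreover have "(\<lambda>z. indicator disc z *\<^sub>R f z) = f"
    using f by (auto simp: hol_disc_def indicator_def)
  ultimately show ?thesis by simp
qed

lemma hol_disc_eqI:
  "f \<in> hol_disc \<Longrightarrow> g \<in> hol_disc \<Longrightarrow> (\<And>z. z \<in> disc \<Longrightarrow> f z = g z) \<Longrightarrow> f = g"
proof (rule ext)
  fix z
  assume "f \<in> hol_disc" "g \<in> hol_disc" "\<And>z. z \<in> disc \<Longrightarrow> f z = g z"
  then show "f z = g z" by (cases "z \<in> disc") (auto simp: hol_disc_def)
qed

definition coef :: "(complex \<Rightarrow> complex) \<Rightarrow> nat \<Rightarrow> complex" where
  "coef f n = (deriv ^^ n) f 0 / fact n"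

lemma coef_sums: "f \<in> hol_disc \<Longrightarrow> norm z < 1 \<Longrightarrow> (\<lambda>n. coef f n * z ^ n) sums f z"
  using holomorphic_power_series[of f 0 1 z] by (simp add: hol_disc_def coef_def)

text \<open>The radius \<open>r\<close> may vary with the point of the circle; the maximal inequality below needs
  this.\<close>

lemma power_series_circle_integral_gen:
  fixes r :: "complex \<Rightarrow> real"
  assumes c: "\<And>z. norm z \<le> \<rho> \<Longrightarrow> (\<lambda>n. c n * z ^ n) sums f z"
    and sc: "summable (\<lambda>n. norm (c n) * \<rho> ^ n)"
    and f: "f \<in> borel_measurable borel"
    and r: "r \<in> borel_measurable borel" "\<And>\<zeta>. 0 \<le> r \<zeta>" "\<And>\<zeta>. r \<zeta> \<le> \<rho>"
    and v: "integrable circle v"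
  shows "(\<lambda>n. c n * (LINT \<zeta>|circle. (of_real (r \<zeta>) * \<zeta>) ^ n * v \<zeta>)) sums
    (LINT \<zeta>|circle. f (of_real (r \<zeta>) * \<zeta>) * v \<zeta>)"
    and "integrable circle (\<lambda>\<zeta>. f (of_real (r \<zeta>) * \<zeta>) * v \<zeta>)"
proof -
  have [measurable]: "v \<in> borel_measurable borel" "f \<in> borel_measurable borel" "r \<in> borel_measurable borel"
    using borel_measurable_integrable[OF v] f r by simp_all
  have \<rho>: "0 \<le> \<rho>" using r(2)[of 0] r(3)[of 0] by linarith
  have rp: "r \<zeta> ^ n \<le> \<rho> ^ n" for n \<zeta> using r by (intro power_mono) auto
  define F where "F = (\<lambda>n \<zeta>. c n * ((of_real (r \<zeta>) * \<zeta>) ^ n * v \<zeta>))"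
  have Fn: "norm (F n \<zeta>) \<le> norm (c n) * \<rho> ^ n * norm (v \<zeta>)" if "norm \<zeta> = 1" for n \<zeta>
  proof -
    have "r \<zeta> ^ n * norm (v \<zeta>) \<le> \<rho> ^ n * norm (v \<zeta>)" by (intro mult_right_mono rp) simp
    then have "norm (c n) * (r \<zeta> ^ n * norm (v \<zeta>)) \<le> norm (c n) * (\<rho> ^ n * norm (v \<zeta>))"
      by (intro mult_left_mono) auto
    then show ?thesis
      using that r(2)[of \<zeta>] by (simp add: F_def norm_mult norm_power mult.assoc)
  qed
  have i: "integrable circle (F n)" for n
  proof (rule Bochner_Integration.integrable_bound)
    show "integrable circle (\<lambda>\<zeta>. norm (c n) * \<rho> ^ n * norm (v \<zeta>))" using v by simp
    show "F n \<in> borel_measurable circle" unfolding F_def by measurable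
    show "AE \<zeta> in circle. norm (F n \<zeta>) \<le> norm (norm (c n) * \<rho> ^ n * norm (v \<zeta>))"
      using Fn \<rho> by (auto intro!: AE_circleI)
  qed
  have s1: "AE \<zeta> in circle. summable (\<lambda>n. norm (F n \<zeta>))"
  proof (rule AE_circleI)
    fix \<zeta> :: complex assume n: "norm \<zeta> = 1"
    show "summable (\<lambda>n. norm (F n \<zeta>))"
      by (rule summable_comparison_test'[OF summable_mult2[OF sc, of "norm (v \<zeta>)"]])
        (use Fn[OF n] in auto)
  qed
  have s2: "summable (\<lambda>n. LINT \<zeta>|circle. norm (F n \<zeta>))"
  proof (rule summable_comparison_test'[OF summable_mult2[OF sc, of "LINT \<zeta>|circle. norm (v \<zeta>)"]])
    fix n
    have "(LINT \<zeta>|circle. norm (F n \<zeta>)) \<le> (LINT \<zeta>|circle. norm (c n) * \<rho> ^ n * norm (v \<zeta>))"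
      by (rule integral_mono_AE) (use i v Fn in \<open>auto intro!: AE_circleI\<close>)
    then show "norm (LINT \<zeta>|circle. norm (F n \<zeta>)) \<le> norm (c n) * \<rho> ^ n * (LINT \<zeta>|circle. norm (v \<zeta>))"
      by simp
  qed
  have Fs: "(\<Sum>n. F n \<zeta>) = f (of_real (r \<zeta>) * \<zeta>) * v \<zeta>" if n: "norm \<zeta> = 1" for \<zeta>
  proof -
    have "norm (of_real (r \<zeta>) * \<zeta>) \<le> \<rho>"
      using n r(2,3)[of \<zeta>] by (simp add: norm_mult)
    from sums_mult2[OF c[OF this], of "v \<zeta>"] show ?thesis
      by (intro sums_unique[symmetric]) (simp add: F_def mult_ac)
  qed
  have "(\<lambda>n. LINT \<zeta>|circle. F n \<zeta>) sums (LINT \<zeta>|circle. (\<Sum>n. F n \<zeta>))"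
    by (rule sums_integral[OF i s1 s2])
  moreover have "(LINT \<zeta>|circle. (\<Sum>n. F n \<zeta>)) = (LINT \<zeta>|circle. f (of_real (r \<zeta>) * \<zeta>) * v \<zeta>)"
    by (rule integral_circle_cong) (use Fs in \<open>auto simp: F_def\<close>)
  ultimately show "(\<lambda>n. c n * (LINT \<zeta>|circle. (of_real (r \<zeta>) * \<zeta>) ^ n * v \<zeta>)) sums
    (LINT \<zeta>|circle. f (of_real (r \<zeta>) * \<zeta>) * v \<zeta>)"
    by (simp add: F_def)
  have "integrable circle (\<lambda>\<zeta>. \<Sum>n. F n \<zeta>)" by (rule integrable_suminf[OF i s1 s2])
  then show "integrable circle (\<lambda>\<zeta>. f (of_real (r \<zeta>) * \<zeta>) * v \<zeta>)"
    by (rule integrable_cong_AE_imp) (use Fs in \<open>auto intro!: AE_circleI\<close>)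
qed

lemma power_series_circle_integral:
  fixes r :: "complex \<Rightarrow> real"
  assumes c: "\<And>z. norm z < 1 \<Longrightarrow> (\<lambda>n. c n * z ^ n) sums f z"
    and f: "f \<in> borel_measurable borel"
    and r: "r \<in> borel_measurable borel" "\<And>\<zeta>. 0 \<le> r \<zeta>" "\<And>\<zeta>. r \<zeta> \<le> \<rho>" "\<rho> < 1"
    and v: "integrable circle v"
  shows "(\<lambda>n. c n * (LINT \<zeta>|circle. (of_real (r \<zeta>) * \<zeta>) ^ n * v \<zeta>)) sums
    (LINT \<zeta>|circle. f (of_real (r \<zeta>) * \<zeta>) * v \<zeta>)"
    and "integrable circle (\<lambda>\<zeta>. f (of_real (r \<zeta>) * \<zeta>) * v \<zeta>)"
proof -
  have \<rho>: "0 \<le> \<rho>" using r(2)[of 0] r(3)[of 0] by linarith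
  \<comment> \<open>Convergence at the intermediate radius \<open>\<sigma>\<close> gives absolute
    convergence at \<open>\<rho>\<close>, which the general version requires.\<close>
  define \<sigma> where "\<sigma> = (1 + \<rho>) / 2"
  have \<sigma>: "0 \<le> \<sigma>" "\<sigma> < 1" "\<rho> < \<sigma>" using \<rho> r(4) by (auto simp: \<sigma>_def)
  have "summable (\<lambda>n. c n * of_real \<sigma> ^ n)"
    using c[of "of_real \<sigma>"] \<sigma> by (auto dest: sums_summable)
  then have "summable (\<lambda>n. norm (c n * of_real \<rho> ^ n))"
    by (rule powser_insidea) (use \<sigma> \<rho> in simp)
  then have sc: "summable (\<lambda>n. norm (c n) * \<rho> ^ n)" using \<rho> by (simp add: norm_mult norm_power)
  have c': "\<And>z. norm z \<le> \<rho> \<Longrightarrow> (\<lambda>n. c n * z ^ n) sums f z" using c r(4) by force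
  show "(\<lambda>n. c n * (LINT \<zeta>|circle. (of_real (r \<zeta>) * \<zeta>) ^ n * v \<zeta>)) sums
    (LINT \<zeta>|circle. f (of_real (r \<zeta>) * \<zeta>) * v \<zeta>)"
    by (rule power_series_circle_integral_gen(1)[OF c' sc f r(1-3) v])
  show "integrable circle (\<lambda>\<zeta>. f (of_real (r \<zeta>) * \<zeta>) * v \<zeta>)"
    by (rule power_series_circle_integral_gen(2)[OF c' sc f r(1-3) v])
qed

lemma fourier_dilate:
  assumes c: "\<And>z. norm z < 1 \<Longrightarrow> (\<lambda>n. c n * z ^ n) sums f z"
    and f: "f \<in> borel_measurable borel" and r: "0 \<le> r" "r < 1"
  shows "fourier (\<lambda>\<zeta>. f (of_real r * \<zeta>)) n = c n * of_real r ^ n"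
proof -
  have "(\<lambda>m. c m * (LINT \<zeta>|circle. (of_real r * \<zeta>) ^ m * cnj \<zeta> ^ n)) sums
     (LINT \<zeta>|circle. f (of_real r * \<zeta>) * cnj \<zeta> ^ n)"
    by (rule power_series_circle_integral[OF c f, of "\<lambda>_. r" r])
      (use r in \<open>auto intro!: integrable_circle_bounded[where B = 1] simp: norm_power\<close>)
  moreover have "(LINT \<zeta>|circle. (of_real r * \<zeta>) ^ m * cnj \<zeta> ^ n) = of_real r ^ m * (if m = n then 1 else 0)" for m
    unfolding power_mult_distrib mult.assoc by (simp add: integral_circle_powers)
  moreover have "c m * (of_real r ^ m * (if m = n then 1 else 0)) = (if m = n then c m * of_real r ^ m else 0)" for m
    by simp
  ultimately have "(\<lambda>m. if m = n then c m * of_real r ^ m else 0) sums fourier (\<lambda>\<zeta>. f (of_real r * \<zeta>)) n"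
    unfolding fourier_def by simp
  with sums_single[of n "\<lambda>m. c m * of_real r ^ m"] show ?thesis
    by (rule sums_unique2[symmetric])
qed

text \<open>Both sequences are recovered as Fourier coefficients of the same dilate, here of radius
  1/2.\<close>

lemma coef_unique:
  assumes f: "f \<in> hol_disc" and c: "\<And>z. norm z < 1 \<Longrightarrow> (\<lambda>n. c n * z ^ n) sums f z"
  shows "coef f = c"
proof
  fix n
  note m = hol_disc_measurable[OF f]
  have "coef f n * of_real (1/2) ^ n = c n * of_real (1/2) ^ n"
    using fourier_dilate[OF coef_sums[OF f] m, of "1/2" n] fourier_dilate[OF c m, of "1/2" n] by simp
  then show "coef f n = c n" by simp
qed

lemma hol_disc_coef_eqI: "f \<in> hol_disc \<Longrightarrow> g \<in> hol_disc \<Longrightarrow> coef f = coef g \<Longrightarrow> f = g"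
  by (rule hol_disc_eqI) (simp_all, metis coef_sums sums_unique2)

lemma dilate_bounded:
  assumes f: "f \<in> hol_disc" and r: "0 \<le> r" "r < 1"
  obtains B where "\<And>\<zeta>. norm \<zeta> = 1 \<Longrightarrow> norm (f (of_real r * \<zeta>)) \<le> B"
proof -
  have "continuous_on (cball 0 r) f"
    by (rule continuous_on_subset[OF holomorphic_on_imp_continuous_on])
      (use f r in \<open>auto simp: hol_disc_def\<close>)
  then have "bounded (f ` cball 0 r)"
    by (intro compact_imp_bounded compact_continuous_image) auto
  then obtain B where B: "\<forall>z\<in>cball 0 r. norm (f z) \<le> B"
    by (auto simp: bounded_iff)
  have "norm (f (of_real r * \<zeta>)) \<le> B" if "norm \<zeta> = 1" for \<zeta>
    by (rule B[rule_format]) (use r that in \<open>auto simp: norm_mult\<close>)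
  then show thesis by (rule that)
qed

lemma L2_circle_dilate:
  assumes f: "f \<in> hol_disc" and r: "0 \<le> r" "r < 1"
  shows "(\<lambda>\<zeta>. f (of_real r * \<zeta>)) \<in> L2_circle"
proof -
  obtain B where "\<And>\<zeta>. norm \<zeta> = 1 \<Longrightarrow> norm (f (of_real r * \<zeta>)) \<le> B"
    using dilate_bounded[OF f r] by blast
  then show ?thesis
    using hol_disc_measurable[OF f] by (intro L2_circle_bounded) auto
qed

lemma dilate_inner:
  assumes f: "f \<in> hol_disc" and g: "g \<in> hol_disc" and r: "0 \<le> r" "r < 1"
  shows "(\<lambda>n. coef f n * cnj (coef g n) * of_real (r\<^sup>2) ^ n) sums
    (LINT \<zeta>|circle. f (of_real r * \<zeta>) * cnj (g (of_real r * \<zeta>)))"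
proof -
  note m = hol_disc_measurable[OF f] hol_disc_measurable[OF g]
  have "(\<lambda>n. coef f n * (LINT \<zeta>|circle. (of_real r * \<zeta>) ^ n * cnj (g (of_real r * \<zeta>)))) sums
    (LINT \<zeta>|circle. f (of_real r * \<zeta>) * cnj (g (of_real r * \<zeta>)))"
    by (rule power_series_circle_integral[OF coef_sums[OF f] m(1), of "\<lambda>_. r" r])
      (use r L2_circle_integrable[OF L2_circle_dilate[OF g r]] in auto)
  moreover have "(LINT \<zeta>|circle. (of_real r * \<zeta>) ^ n * cnj (g (of_real r * \<zeta>))) = cnj (coef g n) * of_real (r\<^sup>2) ^ n" for n
  proof -
    have "(LINT \<zeta>|circle. (of_real r * \<zeta>) ^ n * cnj (g (of_real r * \<zeta>))) =
        (LINT \<zeta>|circle. of_real r ^ n * cnj (g (of_real r * \<zeta>) * cnj \<zeta> ^ n))"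
      by (intro Bochner_Integration.integral_cong refl) (simp add: power_mult_distrib)
    also have "\<dots> = of_real r ^ n * cnj (fourier (\<lambda>\<zeta>. g (of_real r * \<zeta>)) n)"
      unfolding fourier_def by (simp only: integral_mult_right_zero Bochner_Integration.integral_cnj)
    also have "\<dots> = cnj (coef g n) * of_real (r\<^sup>2) ^ n"
      by (subst fourier_dilate[OF coef_sums[OF g] m(2) r], assumption)
        (simp add: power_mult_distrib power2_eq_square mult_ac)
    finally show ?thesis .
  qed
  ultimately show ?thesis by (simp add: mult_ac)
qed

lemma dilate_norm:
  assumes f: "f \<in> hol_disc" and r: "0 \<le> r" "r < 1"
  shows "(\<lambda>n. (norm (coef f n))\<^sup>2 * (r\<^sup>2) ^ n) sums (LINT \<zeta>|circle. (norm (f (of_real r * \<zeta>)))\<^sup>2)"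
proof -
  have "(\<lambda>n. Re (coef f n * cnj (coef f n) * of_real (r\<^sup>2) ^ n)) sums
    Re (LINT \<zeta>|circle. f (of_real r * \<zeta>) * cnj (f (of_real r * \<zeta>)))"
    by (rule sums_Re[OF dilate_inner[OF f f r]])
  moreover have "Re (coef f n * cnj (coef f n) * of_real (r\<^sup>2) ^ n) = (norm (coef f n))\<^sup>2 * (r\<^sup>2) ^ n" for n
    unfolding complex_norm_square[symmetric] of_real_power[symmetric] of_real_mult[symmetric] by simp
  ultimately show ?thesis
    unfolding complex_norm_square[symmetric] integral_complex_of_real by simp
qed

lemma dilate_norm_le:
  assumes f: "f \<in> hol_disc" "summable (\<lambda>n. (norm (coef f n))\<^sup>2)" and r: "0 \<le> r" "r < 1"
  shows "(LINT \<zeta>|circle. (norm (f (of_real r * \<zeta>)))\<^sup>2) \<le> (\<Sum>n. (norm (coef f n))\<^sup>2)"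
proof (rule sums_le[OF _ dilate_norm[OF f(1) r] summable_sums[OF f(2)]])
  have "(r\<^sup>2) ^ n \<le> 1" for n using r by (intro power_le_one) (auto simp: power_le_one)
  then show "\<And>n. (norm (coef f n))\<^sup>2 * (r\<^sup>2) ^ n \<le> (norm (coef f n))\<^sup>2"
    by (simp add: mult_left_le)
qed

section \<open>The Hardy space as a space of square-summable coefficient sequences\<close>

lemma square_summable_imp_inner:
  fixes x y :: "nat \<Rightarrow> complex"
  assumes "summable (\<lambda>n. (norm (x n))\<^sup>2)" "summable (\<lambda>n. (norm (y n))\<^sup>2)"
  shows "summable (\<lambda>n. norm (x n * y n))"
proof (rule summable_comparison_test'[OF summable_add[OF assms]])
  fix n
  show "norm (norm (x n * y n)) \<le> (norm (x n))\<^sup>2 + (norm (y n))\<^sup>2"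
    using norm_mult_le_squares by simp
qed

lemma H2I:
  assumes "f \<in> hol_disc"
    and "\<And>r. 0 \<le> r \<Longrightarrow> r < 1 \<Longrightarrow> (LINT \<zeta>|circle. (norm (f (of_real r * \<zeta>)))\<^sup>2) \<le> B"
  shows "f \<in> H2"
proof -
  have "bdd_above ((\<lambda>r::real. LINT \<zeta>|circle. (norm (f (of_real r * \<zeta>)))\<^sup>2) ` {0..<1})"
    by (rule bdd_aboveI2[where M = B]) (use assms in auto)
  with assms(1) show ?thesis by (simp add: H2_def)
qed

text \<open>By \<open>dilate_norm\<close> the mean at radius \<open>r\<close> is the coefficient sum
  with weights \<open>(r\<^sup>2) ^ n\<close>. Letting \<open>r\<close> tend to 1 in finite partial
  sums bounds them all; conversely the weights are at most 1.\<close>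

lemma H2_iff_coef: "f \<in> H2 \<longleftrightarrow> f \<in> hol_disc \<and> summable (\<lambda>n. (norm (coef f n))\<^sup>2)"
proof (intro iffI conjI)
  assume H2: "f \<in> H2"
  then show f: "f \<in> hol_disc" by (simp add: H2_def)
  from H2 obtain B where B: "\<And>r. 0 \<le> r \<Longrightarrow> r < 1 \<Longrightarrow> (LINT \<zeta>|circle. (norm (f (of_real r * \<zeta>)))\<^sup>2) \<le> B"
    unfolding H2_def bdd_above_def by fastforce
  have fin: "(\<Sum>n<N. (norm (coef f n))\<^sup>2 * (r\<^sup>2) ^ n) \<le> B" if r: "0 \<le> r" "r < 1" for N r
    using sum_le_suminf[of "\<lambda>n. (norm (coef f n))\<^sup>2 * (r\<^sup>2) ^ n" "{..<N}"] dilate_norm[OF f r] B[OF r]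
    by (simp add: sums_iff)
  have "(\<Sum>n<N. (norm (coef f n))\<^sup>2) \<le> B" for N
  proof (rule tendsto_upperbound)
    show "((\<lambda>r. \<Sum>n<N. (norm (coef f n))\<^sup>2 * (r\<^sup>2) ^ n) \<longlongrightarrow> (\<Sum>n<N. (norm (coef f n))\<^sup>2)) (at_left 1)"
      by (auto intro!: tendsto_eq_intros)
    show "\<forall>\<^sub>F r in at_left 1. (\<Sum>n<N. (norm (coef f n))\<^sup>2 * (r\<^sup>2) ^ n) \<le> B"
      using eventually_at_left_real[of 0 1] by (rule eventually_mono) (auto intro: fin)
  qed simp
  then show "summable (\<lambda>n. (norm (coef f n))\<^sup>2)"
    by (intro summableI_nonneg_bounded[of _ B]) auto
next
  assume a: "f \<in> hol_disc \<and> summable (\<lambda>n. (norm (coef f n))\<^sup>2)"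
  with a show "f \<in> H2"
    using dilate_norm_le by (intro H2I[where B = "\<Sum>n. (norm (coef f n))\<^sup>2"]) auto
qed

lemma H2_hol: "f \<in> H2 \<Longrightarrow> f \<in> hol_disc"
  and H2_summable: "f \<in> H2 \<Longrightarrow> summable (\<lambda>n. (norm (coef f n))\<^sup>2)"
  by (auto simp: H2_iff_coef)

text \<open>Inverse of \<open>coef\<close> on square-summable sequences; the value 0 off the disc
  keeps the result in \<open>hol_disc\<close>.\<close>

definition of_coef :: "(nat \<Rightarrow> complex) \<Rightarrow> complex \<Rightarrow> complex" where
  "of_coef c z = (if z \<in> disc then \<Sum>n. c n * z ^ n else 0)"

lemma square_summable_power_series:
  assumes "summable (\<lambda>n. (norm (c n :: complex))\<^sup>2)" "norm z < 1"
  shows "summable (\<lambda>n. c n * z ^ n)"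
proof -
  have "(norm z)\<^sup>2 < 1" using assms(2) by (simp add: power_less_one_iff abs_square_less_1)
  then have "summable (\<lambda>n. (norm (z ^ n))\<^sup>2)"
    unfolding norm_power power_mult[symmetric] mult.commute[of _ 2] unfolding power_mult
    by (intro summable_geometric) simp
  from square_summable_imp_inner[OF assms(1) this] show ?thesis
    by (rule summable_norm_cancel)
qed

lemma of_coef_H2:
  assumes c: "summable (\<lambda>n. (norm (c n))\<^sup>2)"
  shows "of_coef c \<in> H2" and "coef (of_coef c) = c"
proof -
  have s: "(\<lambda>n. c n * z ^ n) sums of_coef c z" if "norm z < 1" for z
    using square_summable_power_series[OF c that] that by (simp add: of_coef_def summable_sums)
  have h: "of_coef c \<in> hol_disc"
    using power_series_holomorphic[of 0 1 c "of_coef c"] s by (auto simp: hol_disc_def of_coef_def)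
  show e: "coef (of_coef c) = c"
    by (rule coef_unique[OF h s])
  show "of_coef c \<in> H2" unfolding H2_iff_coef e using h c by simp
qed

lemma coef_add:
  assumes "f \<in> hol_disc" "g \<in> hol_disc"
  shows "(\<lambda>z. f z + g z) \<in> hol_disc" and "coef (\<lambda>z. f z + g z) = (\<lambda>n. coef f n + coef g n)"
proof -
  show h: "(\<lambda>z. f z + g z) \<in> hol_disc" using assms by (auto simp: hol_disc_def intro: holomorphic_intros)
  show "coef (\<lambda>z. f z + g z) = (\<lambda>n. coef f n + coef g n)"
    by (rule coef_unique[OF h]) (use sums_add[OF coef_sums coef_sums, OF assms(1) _ assms(2)] in \<open>simp add: distrib_right\<close>)
qed

lemma coef_scale:
  assumes "f \<in> hol_disc"
  shows "(\<lambda>z. a * f z) \<in> hol_disc" and "coef (\<lambda>z. a * f z) = (\<lambda>n. a * coef f n)"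
proof -
  show h: "(\<lambda>z. a * f z) \<in> hol_disc" using assms by (auto simp: hol_disc_def intro: holomorphic_intros)
  show "coef (\<lambda>z. a * f z) = (\<lambda>n. a * coef f n)"
    by (rule coef_unique[OF h]) (use sums_mult[OF coef_sums[OF assms]] in \<open>simp add: mult.assoc\<close>)
qed

lemma coef_diff:
  assumes "f \<in> hol_disc" "g \<in> hol_disc"
  shows "(\<lambda>z. f z - g z) \<in> hol_disc" and "coef (\<lambda>z. f z - g z) = (\<lambda>n. coef f n - coef g n)"
  using coef_add[OF assms(1) coef_scale(1)[OF assms(2), of "-1"]] coef_scale(2)[OF assms(2), of "-1"]
  by simp_all

lemma square_summable_add:
  fixes x y :: "nat \<Rightarrow> complex"
  assumes "summable (\<lambda>n. (norm (x n))\<^sup>2)" "summable (\<lambda>n. (norm (y n))\<^sup>2)"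
  shows "summable (\<lambda>n. (norm (x n + y n))\<^sup>2)"
proof (rule summable_comparison_test'[OF summable_mult[OF summable_add[OF assms], of 2]])
  fix n
  show "norm ((norm (x n + y n))\<^sup>2) \<le> 2 * ((norm (x n))\<^sup>2 + (norm (y n))\<^sup>2)"
    using norm_add_square_le[of "x n" "y n"] by simp
qed

lemma H2_add: "f \<in> H2 \<Longrightarrow> g \<in> H2 \<Longrightarrow> (\<lambda>z. f z + g z) \<in> H2"
  by (auto simp: H2_iff_coef coef_add intro: square_summable_add)

lemma H2_scale: "f \<in> H2 \<Longrightarrow> (\<lambda>z. a * f z) \<in> H2"
  by (auto simp: H2_iff_coef coef_scale norm_mult power_mult_distrib intro: summable_mult)

lemma H2_diff: "f \<in> H2 \<Longrightarrow> g \<in> H2 \<Longrightarrow> (\<lambda>z. f z - g z) \<in> H2"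
  using H2_add[OF _ H2_scale[of g "-1"], of f] by simp

text \<open>Argued with the integral means, on which a pointwise bound of the multiplier acts
  directly; on coefficients the product is a convolution.\<close>

lemma Hinf_mult_H2:
  assumes p: "p \<in> Hinf" and f: "f \<in> H2"
  shows "(\<lambda>z. p z * f z) \<in> H2"
proof -
  have ph: "p \<in> hol_disc" using p by (simp add: Hinf_def)
  have h: "(\<lambda>z. p z * f z) \<in> hol_disc"
    using ph H2_hol[OF f] by (auto simp: hol_disc_def intro: holomorphic_intros)
  obtain B where B: "\<forall>z\<in>disc. norm (p z) \<le> B"
    using p by (auto simp: Hinf_def bounded_iff)
  from f obtain C where C: "\<And>r. 0 \<le> r \<Longrightarrow> r < 1 \<Longrightarrow> (LINT \<zeta>|circle. (norm (f (of_real r * \<zeta>)))\<^sup>2) \<le> C"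
    unfolding H2_def bdd_above_def by fastforce
  have "(LINT \<zeta>|circle. (norm (p (of_real r * \<zeta>) * f (of_real r * \<zeta>)))\<^sup>2) \<le> B\<^sup>2 * C"
    if r: "0 \<le> r" "r < 1" for r :: real
  proof -
    have "(LINT \<zeta>|circle. (norm (p (of_real r * \<zeta>) * f (of_real r * \<zeta>)))\<^sup>2) \<le>
        (LINT \<zeta>|circle. B\<^sup>2 * (norm (f (of_real r * \<zeta>)))\<^sup>2)"
    proof (rule integral_mono_AE)
      show "integrable circle (\<lambda>\<zeta>. (norm (p (of_real r * \<zeta>) * f (of_real r * \<zeta>)))\<^sup>2)"
        "integrable circle (\<lambda>\<zeta>. B\<^sup>2 * (norm (f (of_real r * \<zeta>)))\<^sup>2)"
        using L2_circle_dilate[OF h r] L2_circle_dilate[OF H2_hol[OF f] r] by (auto simp: L2_circle_def)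
      show "AE \<zeta> in circle. (norm (p (of_real r * \<zeta>) * f (of_real r * \<zeta>)))\<^sup>2 \<le> B\<^sup>2 * (norm (f (of_real r * \<zeta>)))\<^sup>2"
      proof (rule AE_circleI)
        fix \<zeta> :: complex assume "norm \<zeta> = 1"
        then have "norm (p (of_real r * \<zeta>)) \<le> B" using r by (intro B[rule_format]) (simp add: norm_mult)
        then show "(norm (p (of_real r * \<zeta>) * f (of_real r * \<zeta>)))\<^sup>2 \<le> B\<^sup>2 * (norm (f (of_real r * \<zeta>)))\<^sup>2"
          by (auto simp: norm_mult power_mult_distrib intro!: mult_right_mono power_mono)
      qed
    qed
    also have "\<dots> \<le> B\<^sup>2 * C" using C[OF r] by (simp add: mult_left_mono)
    finally show ?thesis .
  qed
  then show ?thesis by (rule H2I[OF h])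
qed

section \<open>The radial maximal inequality\<close>

lemma Re_mult_of_real: "Re (z * of_real x) = Re z * x"
  by simp

lemma Re_cauchy_kernel: "Re (1 / (1 - z)) = (1 - Re z) / (norm (1 - z))\<^sup>2"
  by (simp add: Re_divide cmod_power2)

text \<open>The map \<open>1 / (1 - z)\<close> sends the disc into the half plane to the right of
  1/2. This is positivity of the Poisson kernel.\<close>

lemma Re_cauchy_kernel_ge:
  assumes "norm z < 1"
  shows "1 / 2 \<le> Re (1 / (1 - z))"
proof -
  have "(norm z)\<^sup>2 < 1" using assms by (simp add: abs_square_less_1)
  then have "(norm (1 - z))\<^sup>2 \<le> 2 * (1 - Re z)"
    unfolding cmod_power2 by (simp add: power2_eq_square algebra_simps)
  moreover have "0 < (norm (1 - z))\<^sup>2" using assms by auto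
  ultimately show ?thesis
    unfolding Re_cauchy_kernel by (simp add: field_simps)
qed

text \<open>The points \<open>r z\<close> and \<open>r s z\<close> are at most \<open>1 - s\<close>
  apart, which is at most the distance from \<open>r s z\<close> to 1. So replacing one denominator
  by the other costs a factor 2, hence 4 after squaring, and the numerators cost another 2.\<close>

lemma Re_cauchy_kernel_le:
  fixes r s :: real
  assumes r: "0 \<le> r" "r \<le> s" "s < 1" and z: "norm z = 1"
  shows "Re (1 / (1 - of_real (r * s) * z)) \<le> 8 * Re (1 / (1 - of_real r * z))"
proof -
  have x: "\<bar>Re z\<bar> \<le> 1" using abs_Re_le_cmod[of z] z by simp
  have rs: "r * s \<le> r" "r * s < 1" "0 \<le> r * s" "r < 1"
    using r mult_left_mono[of s 1 r] by auto
  have n: "norm (of_real (r * s) * z) < 1" "norm (of_real r * z) < 1"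
    using rs z r by (auto simp: norm_mult)
  have num: "1 - r * s * Re z \<le> 2 * (1 - r * Re z)"
  proof -
    have "r * (1 - s) * Re z \<le> r * (1 - s) * 1" using x r by (intro mult_left_mono) auto
    also have "\<dots> \<le> 1 * (1 - s)" using r mult_right_mono[of r 1 "1 - s"] by simp
    also have "\<dots> \<le> 1 - r" using r by simp
    also have "\<dots> \<le> 1 - r * Re z" using mult_left_mono[of "Re z" 1 r] x r by simp
    finally show ?thesis by (simp add: algebra_simps)
  qed
  have "1 - s \<le> 1 - r * s" using r mult_right_mono[of r 1 s] by simp
  also have "\<dots> \<le> norm (1 - of_real (r * s) * z)"
    using norm_triangle_ineq2[of 1 "of_real (r * s) * z"] z rs by (simp add: norm_mult)
  finally have d1: "1 - s \<le> norm (1 - of_real (r * s) * z)" .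
  have "norm (1 - of_real r * z) \<le> norm (1 - of_real (r * s) * z) + norm (of_real (r * (1 - s)) * z)"
    using norm_triangle_ineq4[of "1 - of_real (r * s) * z" "of_real (r * (1 - s)) * z"]
    by (simp add: algebra_simps)
  also have "norm (of_real (r * (1 - s)) * z) = r * (1 - s)"
    unfolding norm_mult norm_of_real z using r by simp
  also have "r * (1 - s) \<le> 1 * (1 - s)" using r mult_right_mono[of r 1 "1 - s"] by simp
  finally have d: "norm (1 - of_real r * z) \<le> 2 * norm (1 - of_real (r * s) * z)"
    using d1 by simp
  have p: "0 < norm (1 - of_real r * z)" "0 < norm (1 - of_real (r * s) * z)"
    using n by auto
  have np: "0 \<le> 1 - r * Re z" using mult_mono[of r 1 "Re z" 1] mult_nonneg_nonpos[of r "Re z"] x r by (cases "0 \<le> Re z") auto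
  have "Re (1 / (1 - of_real (r * s) * z)) = (1 - r * s * Re z) / (norm (1 - of_real (r * s) * z))\<^sup>2"
    using Re_cauchy_kernel[of "of_real (r * s) * z"] by simp
  also have "\<dots> \<le> 2 * (1 - r * Re z) / (norm (1 - of_real (r * s) * z))\<^sup>2"
    using num by (intro divide_right_mono) auto
  also have "\<dots> \<le> 2 * (1 - r * Re z) / (norm (1 - of_real r * z) / 2)\<^sup>2"
    using d p np by (intro divide_left_mono power_mono mult_pos_pos zero_less_power) auto
  also have "\<dots> = 8 * ((1 - r * Re z) / (norm (1 - of_real r * z))\<^sup>2)"
    by (simp add: power_divide)
  also have "\<dots> = 8 * Re (1 / (1 - of_real r * z))"
    using Re_cauchy_kernel[of "of_real r * z"] by simp
  finally show ?thesis .
qed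

text \<open>Ordering the radii gives one of the summands, and the other is nonnegative. The sum
  decouples the two radii, which will depend on different integration variables.\<close>

lemma Re_cauchy_kernel_product_le:
  fixes r s :: real
  assumes r: "0 \<le> r" "r < 1" "0 \<le> s" "s < 1" and z: "norm z = 1"
  shows "Re (1 / (1 - of_real (r * s) * z)) \<le>
    8 * (Re (1 / (1 - of_real r * z)) + Re (1 / (1 - of_real s * z)))"
proof -
  have "0 \<le> Re (1 / (1 - of_real t * z))" if "0 \<le> t" "t < 1" for t :: real
    using Re_cauchy_kernel_ge[of "of_real t * z"] that z by (simp add: norm_mult)
  note this[of r] this[of s]
  then show ?thesis
    using Re_cauchy_kernel_le[of r s z] Re_cauchy_kernel_le[of s r z] r z
    by (cases "r \<le> s") (auto simp: mult.commute)
qed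

text \<open>The \<open>T T\<^sup>*\<close> estimate: \<open>t\<close> are the coefficients of \<open>T\<^sup>* u\<close> for the linearized radial
  maximal operator \<open>T h = (\<lambda>\<zeta>. h (r \<zeta> * \<zeta>))\<close>. The kernel of \<open>T T\<^sup>*\<close> is
  \<open>1 / (1 - r(\<zeta>) r(\<eta>) cnj \<zeta> \<eta>)\<close>, whose real part is at most eight times the sum of the
  kernels with only one of the two radii; those two terms are \<open>\<langle>u, T\<^sup>* u\<rangle>\<close> and its conjugate.\<close>

lemma linearized_maximal_dual:
  fixes r u :: "complex \<Rightarrow> real"
  assumes r: "r \<in> borel_measurable borel" "\<And>\<zeta>. 0 \<le> r \<zeta>" "\<And>\<zeta>. r \<zeta> \<le> \<rho>" "\<rho> < 1"
    and u: "(\<lambda>\<zeta>. of_real (u \<zeta>)) \<in> L2_circle" "u \<in> borel_measurable borel"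
      "\<And>\<zeta>. norm \<zeta> = 1 \<Longrightarrow> 0 \<le> u \<zeta>"
  defines "t \<equiv> \<lambda>n. LINT \<zeta>|circle. (of_real (r \<zeta>) * \<zeta>) ^ n * complex_of_real (u \<zeta>)"
  shows "summable (\<lambda>n. (norm (t n))\<^sup>2)"
    and "(\<Sum>n. (norm (t n))\<^sup>2) \<le> 256 * (LINT \<zeta>|circle. (u \<zeta>)\<^sup>2)"
proof -
  have \<rho>: "0 \<le> \<rho>" using r(2)[of 0] r(3)[of 0] by linarith
  have [measurable]: "u \<in> borel_measurable borel" "r \<in> borel_measurable borel" using u r by auto
  have ui: "integrable circle (\<lambda>\<zeta>. complex_of_real (u \<zeta>))" by (rule L2_circle_integrable[OF u(1)])
  have uir: "integrable circle u" using integrable_Re[OF ui] by simp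
  define C where "C = (LINT \<zeta>|circle. norm (u \<zeta>))"
  \<comment> \<open>The geometric decay depends on \<open>\<rho>\<close> and is used only for
    convergence: it makes the sum over \<open>t\<close> finite, so that half of it can be absorbed
    at the end. The constant 256 is free of \<open>\<rho>\<close>.\<close>
  have tb: "norm (t n) \<le> C * \<rho> ^ n" for n
  proof -
    have "norm (t n) \<le> (LINT \<zeta>|circle. norm ((of_real (r \<zeta>) * \<zeta>) ^ n * complex_of_real (u \<zeta>)))"
      unfolding t_def by (rule integral_norm_bound)
    also have "\<dots> \<le> (LINT \<zeta>|circle. \<rho> ^ n * norm (u \<zeta>))"
    proof (rule integral_mono_AE)
      have e: "norm ((of_real (r \<zeta>) * \<zeta>) ^ n * complex_of_real (u \<zeta>)) \<le> \<rho> ^ n * norm (u \<zeta>)" if "norm \<zeta> = 1" for \<zeta>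
        unfolding norm_mult norm_power using that r by (auto intro!: mult_right_mono power_mono)
      then show "AE \<zeta> in circle. norm ((of_real (r \<zeta>) * \<zeta>) ^ n * complex_of_real (u \<zeta>)) \<le> \<rho> ^ n * norm (u \<zeta>)"
        by (rule AE_circleI)
      show i: "integrable circle (\<lambda>\<zeta>. \<rho> ^ n * norm (u \<zeta>))" using uir by simp
      show "integrable circle (\<lambda>\<zeta>. norm ((of_real (r \<zeta>) * \<zeta>) ^ n * complex_of_real (u \<zeta>)))"
        by (rule Bochner_Integration.integrable_bound[OF i]) (use e \<rho> in \<open>auto intro!: AE_circleI\<close>)
    qed
    finally show ?thesis by (simp add: C_def mult.commute)
  qed
  have C: "0 \<le> C" by (simp add: C_def)
  \<comment> \<open>The coefficients for the constant radius 1, which Bessel's inequality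
    controls.\<close>
  define d where "d n = (LINT \<zeta>|circle. \<zeta> ^ n * complex_of_real (u \<zeta>))" for n
  have d: "d n = cnj (fourier (\<lambda>\<zeta>. of_real (u \<zeta>)) n)" for n
    unfolding d_def fourier_def Bochner_Integration.integral_cnj[symmetric] by (simp add: mult.commute)
  have ds: "summable (\<lambda>n. (norm (d n))\<^sup>2)"
    and dle: "(\<Sum>n. (norm (d n))\<^sup>2) \<le> (LINT \<zeta>|circle. (u \<zeta>)\<^sup>2)"
    using bessel_summable[OF u(1)] by (simp_all add: d)
  have st: "summable (\<lambda>n. norm (t n))"
    by (rule summable_comparison_test'[where g = "\<lambda>n. C * \<rho> ^ n"])
      (use tb \<rho> r(4) in \<open>auto intro!: summable_mult summable_geometric\<close>)
  show st2: "summable (\<lambda>n. (norm (t n))\<^sup>2)"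
  proof (rule summable_comparison_test'[OF summable_mult[OF st, of C]])
    fix n
    have "norm (t n) \<le> C"
      using tb[of n] mult_left_mono[OF power_le_one[of \<rho> n] C] \<rho> r(4) by simp
    then have "norm (t n) * norm (t n) \<le> C * norm (t n)" by (intro mult_right_mono) auto
    then show "norm ((norm (t n))\<^sup>2) \<le> C * norm (t n)"
      by (simp add: power2_eq_square)
  qed
  \<comment> \<open>Because \<open>t\<close> is absolutely summable, the series for \<open>T\<close>
    converges on the closed disc; the one for \<open>D\<close> is used only inside the open
    disc.\<close>
  define T where "T z = (\<Sum>n. cnj (t n) * z ^ n)" for z
  define D where "D z = (\<Sum>n. cnj (d n) * z ^ n)" for z
  have [measurable]: "T \<in> borel_measurable borel" "D \<in> borel_measurable borel"
    unfolding T_def D_def by measurable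
  have Ts: "(\<lambda>n. cnj (t n) * z ^ n) sums T z" if z: "norm z \<le> 1" for z
    unfolding T_def
  proof (intro summable_sums summable_norm_cancel[of "\<lambda>n. cnj (t n) * z ^ n"] summable_comparison_test'[OF st])
    fix n show "norm (norm (cnj (t n) * z ^ n)) \<le> norm (t n)"
      using power_le_one[of "norm z" n] z by (simp add: norm_mult norm_power mult_left_le)
  qed
  have Ds: "(\<lambda>n. cnj (d n) * z ^ n) sums D z" if z: "norm z < 1" for z
    unfolding D_def using ds by (intro summable_sums square_summable_power_series z) simp
  \<comment> \<open>One expansion for both series: it is used with radius function \<open>r\<close>
    and \<open>norm w \<le> 1\<close>, and with radius 1 and \<open>norm w < 1\<close>.\<close>
  have kernel: "(\<lambda>n. w ^ n * (LINT \<eta>|circle. (of_real (s \<eta>) * \<eta>) ^ n * complex_of_real (u \<eta>))) sums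
        (LINT \<eta>|circle. 1 / (1 - w * (of_real (s \<eta>) * \<eta>)) * complex_of_real (u \<eta>))"
      "integrable circle (\<lambda>\<eta>. 1 / (1 - w * (of_real (s \<eta>) * \<eta>)) * complex_of_real (u \<eta>))"
    if "norm w * \<sigma> < 1" "s \<in> borel_measurable borel" "\<And>\<zeta>. 0 \<le> s \<zeta>" "\<And>\<zeta>. s \<zeta> \<le> \<sigma>" for w and s :: "complex \<Rightarrow> real" and \<sigma>
  proof -
    have \<sigma>: "0 \<le> \<sigma>" using that(3)[of 0] that(4)[of 0] by linarith
    have 1: "(\<lambda>n. w ^ n * z ^ n) sums (1 / (1 - w * z))" if "norm z \<le> \<sigma>" for z
    proof -
      have "norm (w * z) \<le> norm w * \<sigma>" unfolding norm_mult using that by (intro mult_left_mono) auto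
      then have "norm (w * z) < 1" using \<open>norm w * \<sigma> < 1\<close> by simp
      from geometric_sums[OF this] show ?thesis by (simp add: power_mult_distrib)
    qed
    have 2: "summable (\<lambda>n. norm (w ^ n) * \<sigma> ^ n)"
      unfolding norm_power power_mult_distrib[symmetric] using that(1) \<sigma>
      by (intro summable_geometric) simp
    show "(\<lambda>n. w ^ n * (LINT \<eta>|circle. (of_real (s \<eta>) * \<eta>) ^ n * complex_of_real (u \<eta>))) sums
        (LINT \<eta>|circle. 1 / (1 - w * (of_real (s \<eta>) * \<eta>)) * complex_of_real (u \<eta>))"
      "integrable circle (\<lambda>\<eta>. 1 / (1 - w * (of_real (s \<eta>) * \<eta>)) * complex_of_real (u \<eta>))"
      by (rule power_series_circle_integral_gen[OF 1 2 _ that(2-4) ui]; measurable)+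
  qed
  have ReT: "Re (T z) = (LINT \<eta>|circle. Re (1 / (1 - cnj z * (of_real (r \<eta>) * \<eta>))) * u \<eta>)"
     "integrable circle (\<lambda>\<eta>. Re (1 / (1 - cnj z * (of_real (r \<eta>) * \<eta>))) * u \<eta>)" if z: "norm z \<le> 1" for z
  proof -
    have w: "norm (cnj z) * \<rho> < 1" using z r(4) \<rho> mult_right_mono[of "norm z" 1 \<rho>] by simp
    note k = kernel[OF w r(1-3)]
    have "(\<lambda>n. cnj (cnj z ^ n * t n)) sums cnj (LINT \<eta>|circle. 1 / (1 - cnj z * (of_real (r \<eta>) * \<eta>)) * complex_of_real (u \<eta>))"
      using k(1) unfolding t_def by (simp only: sums_cnj)
    then have "T z = cnj (LINT \<eta>|circle. 1 / (1 - cnj z * (of_real (r \<eta>) * \<eta>)) * complex_of_real (u \<eta>))"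
      using Ts[OF z] by (intro sums_unique2[of "\<lambda>n. cnj (t n) * z ^ n"]) (auto simp: mult.commute)
    then have "Re (T z) = Re (LINT \<eta>|circle. 1 / (1 - cnj z * (of_real (r \<eta>) * \<eta>)) * complex_of_real (u \<eta>))"
      by simp
    also have "\<dots> = (LINT \<eta>|circle. Re (1 / (1 - cnj z * (of_real (r \<eta>) * \<eta>)) * complex_of_real (u \<eta>)))"
      by (rule integral_Re[symmetric, OF k(2)])
    finally show "Re (T z) = (LINT \<eta>|circle. Re (1 / (1 - cnj z * (of_real (r \<eta>) * \<eta>))) * u \<eta>)"
      unfolding Re_mult_of_real .
    show "integrable circle (\<lambda>\<eta>. Re (1 / (1 - cnj z * (of_real (r \<eta>) * \<eta>))) * u \<eta>)"
      using integrable_Re[OF k(2)] unfolding Re_mult_of_real .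
  qed
  have ReD: "Re (D z) = (LINT \<eta>|circle. Re (1 / (1 - cnj z * \<eta>)) * u \<eta>)"
     "integrable circle (\<lambda>\<eta>. Re (1 / (1 - cnj z * \<eta>)) * u \<eta>)" if z: "norm z < 1" for z
  proof -
    have w: "norm (cnj z) * 1 < 1" using z by simp
    note k = kernel[OF w, of "\<lambda>_. 1", simplified]
    have "(\<lambda>n. cnj (cnj z ^ n * d n)) sums cnj (LINT \<eta>|circle. 1 / (1 - cnj z * \<eta>) * complex_of_real (u \<eta>))"
      using k(1) unfolding d_def by (simp only: sums_cnj) simp
    then have "D z = cnj (LINT \<eta>|circle. 1 / (1 - cnj z * \<eta>) * complex_of_real (u \<eta>))"
      using Ds[OF z] by (intro sums_unique2[of "\<lambda>n. cnj (d n) * z ^ n"]) (auto simp: mult.commute)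
    then have "Re (D z) = Re (LINT \<eta>|circle. 1 / (1 - cnj z * \<eta>) * complex_of_real (u \<eta>))"
      by simp
    also have "\<dots> = (LINT \<eta>|circle. Re (1 / (1 - cnj z * \<eta>) * complex_of_real (u \<eta>)))"
      by (rule integral_Re[symmetric]) (use k(2) in simp)
    finally show "Re (D z) = (LINT \<eta>|circle. Re (1 / (1 - cnj z * \<eta>)) * u \<eta>)"
      unfolding Re_mult_of_real .
    have "integrable circle (\<lambda>\<eta>. 1 / (1 - cnj z * \<eta>) * complex_of_real (u \<eta>))" using k(2) by simp
    from integrable_Re[OF this]
    show "integrable circle (\<lambda>\<eta>. Re (1 / (1 - cnj z * \<eta>)) * u \<eta>)"
      unfolding Re_mult_of_real .
  qed
  \<comment> \<open>After the kernel inequality is integrated against \<open>u\<close>, the summand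
    with the radius of the outer variable is \<open>D\<close> at the dilated point, and the summand
    with the radius of the inner variable is \<open>T\<close> on the circle itself.\<close>
  have inner: "Re (T (of_real (r \<zeta>) * \<zeta>)) \<le> 8 * (Re (D (of_real (r \<zeta>) * \<zeta>)) + Re (T \<zeta>))"
    if n: "norm \<zeta> = 1" for \<zeta>
  proof -
    have r1: "r \<zeta> < 1" "norm (of_real (r \<zeta>) * \<zeta>) < 1" "norm (of_real (r \<zeta>) * \<zeta>) \<le> 1" "norm \<zeta> \<le> 1"
      using n r(2,3)[of \<zeta>] r(4) by (auto simp: norm_mult)
    have "Re (T (of_real (r \<zeta>) * \<zeta>)) =
        (LINT \<eta>|circle. Re (1 / (1 - cnj (of_real (r \<zeta>) * \<zeta>) * (of_real (r \<eta>) * \<eta>))) * u \<eta>)"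
      by (rule ReT(1)[OF r1(3)])
    also have "\<dots> \<le> (LINT \<eta>|circle. 8 * (Re (1 / (1 - cnj (of_real (r \<zeta>) * \<zeta>) * \<eta>)) * u \<eta> +
         Re (1 / (1 - cnj \<zeta> * (of_real (r \<eta>) * \<eta>))) * u \<eta>))"
    proof (rule integral_mono_AE)
      show "AE \<eta> in circle. Re (1 / (1 - cnj (of_real (r \<zeta>) * \<zeta>) * (of_real (r \<eta>) * \<eta>))) * u \<eta> \<le>
         8 * (Re (1 / (1 - cnj (of_real (r \<zeta>) * \<zeta>) * \<eta>)) * u \<eta> + Re (1 / (1 - cnj \<zeta> * (of_real (r \<eta>) * \<eta>))) * u \<eta>)"
      proof (rule AE_circleI)
        fix \<eta> :: complex assume "norm \<eta> = 1"
        have "r \<eta> < 1" using r(3)[of \<eta>] r(4) by simp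
        then have "Re (1 / (1 - of_real (r \<zeta> * r \<eta>) * (cnj \<zeta> * \<eta>))) \<le>
          8 * (Re (1 / (1 - of_real (r \<zeta>) * (cnj \<zeta> * \<eta>))) + Re (1 / (1 - of_real (r \<eta>) * (cnj \<zeta> * \<eta>))))"
          using r(2) r1 n \<open>norm \<eta> = 1\<close> by (intro Re_cauchy_kernel_product_le) (auto simp: norm_mult)
        from mult_right_mono[OF this u(3)[OF \<open>norm \<eta> = 1\<close>]]
        show "Re (1 / (1 - cnj (of_real (r \<zeta>) * \<zeta>) * (of_real (r \<eta>) * \<eta>))) * u \<eta> \<le>
         8 * (Re (1 / (1 - cnj (of_real (r \<zeta>) * \<zeta>) * \<eta>)) * u \<eta> + Re (1 / (1 - cnj \<zeta> * (of_real (r \<eta>) * \<eta>))) * u \<eta>)"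
          by (simp add: mult_ac distrib_left distrib_right)
      qed
    qed (use ReT(2)[OF r1(3)] ReD(2)[OF r1(2)] ReT(2)[OF r1(4)] in auto)
    also have "\<dots> = 8 * (Re (D (of_real (r \<zeta>) * \<zeta>)) + Re (T \<zeta>))"
      using ReD[OF r1(2)] ReT[OF r1(4)] by simp
    finally show ?thesis .
  qed
  \<comment> \<open>Integrating once more against \<open>u\<close> yields the squared norm of
    \<open>t\<close> and the two pairings of \<open>t\<close> with \<open>d\<close>.\<close>
  have outer1: "(\<lambda>n. cnj (t n) * t n) sums (LINT \<zeta>|circle. T (of_real (r \<zeta>) * \<zeta>) * of_real (u \<zeta>))"
    "integrable circle (\<lambda>\<zeta>. T (of_real (r \<zeta>) * \<zeta>) * of_real (u \<zeta>))"
    using power_series_circle_integral[OF Ts _ r ui] by (auto simp: t_def)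
  have outer2: "(\<lambda>n. cnj (d n) * t n) sums (LINT \<zeta>|circle. D (of_real (r \<zeta>) * \<zeta>) * of_real (u \<zeta>))"
    "integrable circle (\<lambda>\<zeta>. D (of_real (r \<zeta>) * \<zeta>) * of_real (u \<zeta>))"
    using power_series_circle_integral[OF Ds _ r ui] by (auto simp: t_def)
  have outer3: "(\<lambda>n. cnj (t n) * d n) sums (LINT \<zeta>|circle. T \<zeta> * of_real (u \<zeta>))"
    "integrable circle (\<lambda>\<zeta>. T \<zeta> * of_real (u \<zeta>))"
    using power_series_circle_integral_gen[OF Ts _ _ _ _ _ ui, of 1 "\<lambda>_. 1"] st by (auto simp: d_def)
  have i1: "integrable circle (\<lambda>\<zeta>. Re (T (of_real (r \<zeta>) * \<zeta>)) * u \<zeta>)"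
    "integrable circle (\<lambda>\<zeta>. Re (D (of_real (r \<zeta>) * \<zeta>)) * u \<zeta>)"
    "integrable circle (\<lambda>\<zeta>. Re (T \<zeta>) * u \<zeta>)"
    using integrable_Re[OF outer1(2)] integrable_Re[OF outer2(2)] integrable_Re[OF outer3(2)] by simp_all
  have s1: "(\<lambda>n. (norm (t n))\<^sup>2) sums (LINT \<zeta>|circle. Re (T (of_real (r \<zeta>) * \<zeta>)) * u \<zeta>)"
    using sums_Re[OF outer1(1)] integral_Re[OF outer1(2)]
    by (simp add: mult.commute[of "cnj z" for z] complex_norm_square[symmetric] del: of_real_power)
  have s2: "(\<lambda>n. Re (cnj (d n) * t n)) sums (LINT \<zeta>|circle. Re (D (of_real (r \<zeta>) * \<zeta>)) * u \<zeta>)"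
    using sums_Re[OF outer2(1)] integral_Re[OF outer2(2)] by simp
  have s3: "(\<lambda>n. Re (cnj (t n) * d n)) sums (LINT \<zeta>|circle. Re (T \<zeta>) * u \<zeta>)"
    using sums_Re[OF outer3(1)] integral_Re[OF outer3(2)] by simp
  have "(\<Sum>n. (norm (t n))\<^sup>2) = (LINT \<zeta>|circle. Re (T (of_real (r \<zeta>) * \<zeta>)) * u \<zeta>)"
    using s1 by (simp add: sums_iff)
  also have "\<dots> \<le> (LINT \<zeta>|circle. 8 * (Re (D (of_real (r \<zeta>) * \<zeta>)) * u \<zeta> + Re (T \<zeta>) * u \<zeta>))"
  proof (rule integral_mono_AE)
    show "AE \<zeta> in circle. Re (T (of_real (r \<zeta>) * \<zeta>)) * u \<zeta> \<le> 8 * (Re (D (of_real (r \<zeta>) * \<zeta>)) * u \<zeta> + Re (T \<zeta>) * u \<zeta>)"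
    proof (rule AE_circleI)
      fix \<zeta> :: complex assume n: "norm \<zeta> = 1"
      from mult_right_mono[OF inner[OF n] u(3)[OF n]]
      show "Re (T (of_real (r \<zeta>) * \<zeta>)) * u \<zeta> \<le> 8 * (Re (D (of_real (r \<zeta>) * \<zeta>)) * u \<zeta> + Re (T \<zeta>) * u \<zeta>)"
        by (simp add: algebra_simps)
    qed
  qed (use i1 in auto)
  also have "\<dots> = (\<Sum>n. 8 * (Re (cnj (d n) * t n) + Re (cnj (t n) * d n)))"
    using i1 sums_unique[OF sums_mult[OF sums_add[OF s2 s3], of 8]] by simp
  \<comment> \<open>From \<open>(norm (t n) - 16 * norm (d n))\<^sup>2 \<ge> 0\<close>. Half of the
    sum over \<open>t\<close> is absorbed on the left, which doubles 128 to 256.\<close>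
  also have "\<dots> \<le> (\<Sum>n. (1/2) * (norm (t n))\<^sup>2 + 128 * (norm (d n))\<^sup>2)"
  proof (rule suminf_le)
    fix n
    have aux: "8 * (x + y) \<le> q" if "x \<le> p" "y \<le> p" "16 * p \<le> q" for x y p q :: real
    proof -
      have "8 * (x + y) \<le> 8 * (p + p)" using that(1,2) by (intro mult_left_mono add_mono) auto
      with that(3) show ?thesis by simp
    qed
    have "Re (cnj (d n) * t n) \<le> norm (d n) * norm (t n)" "Re (cnj (t n) * d n) \<le> norm (d n) * norm (t n)"
      using complex_Re_le_cmod[of "cnj (d n) * t n"] complex_Re_le_cmod[of "cnj (t n) * d n"]
      by (auto simp: norm_mult mult.commute)
    moreover have "0 \<le> (norm (t n) - 16 * norm (d n))\<^sup>2" by simp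
    then have "16 * (norm (d n) * norm (t n)) \<le> (1/2) * (norm (t n))\<^sup>2 + 128 * (norm (d n))\<^sup>2"
      unfolding power2_diff by (simp add: power2_eq_square algebra_simps)
    ultimately show "8 * (Re (cnj (d n) * t n) + Re (cnj (t n) * d n)) \<le> (1/2) * (norm (t n))\<^sup>2 + 128 * (norm (d n))\<^sup>2"
      by (rule aux)
  next
    show "summable (\<lambda>n. 8 * (Re (cnj (d n) * t n) + Re (cnj (t n) * d n)))"
      using sums_mult[OF sums_add[OF s2 s3], of 8] by (simp add: sums_iff)
    show "summable (\<lambda>n. (1/2) * (norm (t n))\<^sup>2 + 128 * (norm (d n))\<^sup>2)"
      by (intro summable_add summable_mult st2 ds)
  qed
  also have "\<dots> = (1/2) * (\<Sum>n. (norm (t n))\<^sup>2) + 128 * (\<Sum>n. (norm (d n))\<^sup>2)"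
    using st2 ds by (simp add: suminf_add[symmetric] suminf_mult summable_mult summable_divide suminf_divide)
  finally show "(\<Sum>n. (norm (t n))\<^sup>2) \<le> 256 * (LINT \<zeta>|circle. (u \<zeta>)\<^sup>2)"
    using dle by simp
qed

text \<open>Selects the maximizing radius measurably, which linearizes the maximal operator.
  Measurability of the selected value is carried along because the next comparison in the induction
  uses it.\<close>

lemma measurable_argmax:
  fixes u :: "real \<Rightarrow> complex \<Rightarrow> real"
  assumes "finite F" "F \<noteq> {}" "\<And>s. s \<in> F \<Longrightarrow> u s \<in> borel_measurable borel"
  shows "\<exists>r\<in>borel_measurable borel. (\<lambda>\<zeta>. u (r \<zeta>) \<zeta>) \<in> borel_measurable borel \<and>
    (\<forall>\<zeta>. r \<zeta> \<in> F \<and> (\<forall>s\<in>F. u s \<zeta> \<le> u (r \<zeta>) \<zeta>))"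
  using assms
proof (induction F rule: finite_ne_induct)
  case (singleton x)
  then show ?case by (intro bexI[of _ "\<lambda>_. x"]) auto
next
  case (insert x F)
  then obtain r where [measurable]: "r \<in> borel_measurable borel" "(\<lambda>\<zeta>. u (r \<zeta>) \<zeta>) \<in> borel_measurable borel"
    and r: "\<And>\<zeta>. r \<zeta> \<in> F" "\<And>\<zeta> s. s \<in> F \<Longrightarrow> u s \<zeta> \<le> u (r \<zeta>) \<zeta>"
    by auto
  have [measurable]: "u x \<in> borel_measurable borel" using insert by auto
  define r' where "r' \<zeta> = (if u (r \<zeta>) \<zeta> \<le> u x \<zeta> then x else r \<zeta>)" for \<zeta>
  have "(\<lambda>\<zeta>. u (r' \<zeta>) \<zeta>) = (\<lambda>\<zeta>. if u (r \<zeta>) \<zeta> \<le> u x \<zeta> then u x \<zeta> else u (r \<zeta>) \<zeta>)"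
    by (auto simp: r'_def)
  then have "(\<lambda>\<zeta>. u (r' \<zeta>) \<zeta>) \<in> borel_measurable borel" by simp
  moreover have "r' \<in> borel_measurable borel" unfolding r'_def by measurable
  moreover have "r' \<zeta> \<in> insert x F" for \<zeta> using r(1) by (auto simp: r'_def)
  moreover have "u s \<zeta> \<le> u (r' \<zeta>) \<zeta>" if "s \<in> insert x F" for s \<zeta>
    using that r(2)[of s \<zeta>] by (auto simp: r'_def)
  ultimately show ?case by (intro bexI[of _ r']) auto
qed

lemma L2_circle_cauchy_kernel:
  assumes "norm z < 1"
  shows "(\<lambda>\<eta>. 1 / (1 - z * cnj \<eta>)) \<in> L2_circle"
proof (rule L2_circle_bounded)
  fix \<eta> :: complex assume n: "norm \<eta> = 1"
  have "1 - norm z \<le> norm (1 - z * cnj \<eta>)"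
    using norm_triangle_ineq2[of 1 "z * cnj \<eta>"] n by (simp add: norm_mult)
  then show "norm (1 / (1 - z * cnj \<eta>)) \<le> 1 / (1 - norm z)"
    using assms by (simp add: norm_divide frac_le)
qed measurable

text \<open>These are the Fourier coefficients of nonpositive index, to which an analytic function
  contributes only its constant term.\<close>

lemma dilate_mean:
  assumes f: "f \<in> hol_disc" and R: "0 \<le> R" "R < 1"
  shows "(LINT \<eta>|circle. f (of_real R * \<eta>) * \<eta> ^ n) = (if n = 0 then coef f 0 else 0)"
proof (rule sums_unique2)
  show "(\<lambda>m. coef f m * (LINT \<zeta>|circle. (of_real R * \<zeta>) ^ m * \<zeta> ^ n)) sums (LINT \<eta>|circle. f (of_real R * \<eta>) * \<eta> ^ n)"
    by (rule power_series_circle_integral[OF coef_sums[OF f] hol_disc_measurable[OF f], of "\<lambda>_. R" R])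
      (use R L2_circle_integrable[OF L2_circle_power] in auto)
  have "(LINT \<zeta>|circle. (of_real R * \<zeta>) ^ m * \<zeta> ^ n) = of_real R ^ m * (if m + n = 0 then 1 else 0)" for m
    unfolding power_mult_distrib mult.assoc power_add[symmetric] by (simp add: integral_circle_power)
  then have "coef f m * (LINT \<zeta>|circle. (of_real R * \<zeta>) ^ m * \<zeta> ^ n) =
    (if m = 0 then (if n = 0 then coef f m else 0) else 0)" for m by auto
  then show "(\<lambda>m. coef f m * (LINT \<zeta>|circle. (of_real R * \<zeta>) ^ m * \<zeta> ^ n)) sums (if n = 0 then coef f 0 else 0)"
    using sums_single[of 0 "\<lambda>m. if n = 0 then coef f m else 0"] by simp
qed

text \<open>The Poisson kernel \<open>2 Re (1 / (1 - z cnj \<eta>)) - 1\<close> is positive.\<close>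

lemma poisson_majorant:
  assumes f: "f \<in> hol_disc" and R: "0 \<le> R" "R < 1" and z: "norm z < 1"
  shows "norm (f (of_real R * z)) \<le>
    2 * Re (LINT \<eta>|circle. of_real (norm (f (of_real R * \<eta>))) / (1 - z * cnj \<eta>))"
proof -
  note m [measurable] = hol_disc_measurable[OF f]
  define \<phi> where "\<phi> \<eta> = f (of_real R * \<eta>)" for \<eta>
  have \<phi>: "\<phi> \<in> L2_circle" unfolding \<phi>_def by (rule L2_circle_dilate[OF f R])
  have [measurable]: "\<phi> \<in> borel_measurable borel" by (rule L2_circle_measurable[OF \<phi>])
  define k where "k \<eta> = 1 / (1 - z * cnj \<eta>)" for \<eta>
  have k: "k \<in> L2_circle" unfolding k_def by (rule L2_circle_cauchy_kernel[OF z])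
  have Rz: "norm (of_real R * z) < 1"
    using R z mult_strict_mono'[of R 1 "norm z" 1] by (simp add: norm_mult)
  have e1: "(LINT \<eta>|circle. \<phi> \<eta> * k \<eta>) = f (of_real R * z)"
  proof (rule sums_unique2)
    show "(\<lambda>n. fourier \<phi> n * z ^ n) sums (LINT \<eta>|circle. \<phi> \<eta> * k \<eta>)"
      using cauchy_transform[OF L2_circle_integrable[OF \<phi>] z] by (simp add: k_def)
    have "fourier \<phi> n = coef f n * of_real R ^ n" for n
      unfolding \<phi>_def using coef_sums[OF f] R by (intro fourier_dilate) auto
    then show "(\<lambda>n. fourier \<phi> n * z ^ n) sums f (of_real R * z)"
      using coef_sums[OF f Rz] by (simp add: power_mult_distrib mult.assoc)
  qed
  have mean: "(LINT \<eta>|circle. \<phi> \<eta> * \<eta> ^ n) = (if n = 0 then coef f 0 else 0)" for n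
    unfolding \<phi>_def by (rule dilate_mean[OF f R])
  \<comment> \<open>The conjugate kernel sees only the nonpositive frequencies of
    \<open>\<phi>\<close>, so the constant term alone survives.\<close>
  have e2: "(LINT \<eta>|circle. \<phi> \<eta> * cnj (k \<eta>)) = coef f 0"
  proof -
    have "(\<lambda>n. fourier (\<lambda>\<eta>. cnj (\<phi> \<eta>)) n * z ^ n) sums (LINT \<eta>|circle. cnj (\<phi> \<eta>) * k \<eta>)"
      using cauchy_transform[OF L2_circle_integrable[OF L2_circle_cnj[OF \<phi>]] z] by (simp add: k_def)
    moreover have "fourier (\<lambda>\<eta>. cnj (\<phi> \<eta>)) n = (if n = 0 then cnj (coef f 0) else 0)" for n
    proof -
      have "fourier (\<lambda>\<eta>. cnj (\<phi> \<eta>)) n = cnj (LINT \<eta>|circle. \<phi> \<eta> * \<eta> ^ n)"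
        unfolding fourier_def Bochner_Integration.integral_cnj[symmetric] by simp
      then show ?thesis unfolding mean by simp
    qed
    then have "fourier (\<lambda>\<eta>. cnj (\<phi> \<eta>)) n * z ^ n = (if n = 0 then cnj (coef f n) else 0)" for n
      by simp
    ultimately have "(\<lambda>n. if n = 0 then cnj (coef f n) else 0) sums (LINT \<eta>|circle. cnj (\<phi> \<eta>) * k \<eta>)"
      by simp
    then have "(LINT \<eta>|circle. cnj (\<phi> \<eta>) * k \<eta>) = cnj (coef f 0)"
      using sums_single[of 0 "\<lambda>n. cnj (coef f n)"] by (rule sums_unique2)
    then have "cnj (LINT \<eta>|circle. cnj (\<phi> \<eta>) * k \<eta>) = coef f 0" by simp
    then show ?thesis unfolding Bochner_Integration.integral_cnj[symmetric] by simp
  qed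
  have e3: "(LINT \<eta>|circle. \<phi> \<eta>) = coef f 0" using mean[of 0] by simp
  note i = L2_circle_mult_integrable[OF \<phi> k] L2_circle_mult_integrable[OF \<phi> L2_circle_cnj[OF k]]
    L2_circle_integrable[OF \<phi>]
  have P: "\<phi> \<eta> * k \<eta> + \<phi> \<eta> * cnj (k \<eta>) - \<phi> \<eta> = \<phi> \<eta> * of_real (2 * Re (k \<eta>) - 1)" for \<eta>
    by (simp add: complex_eq_iff algebra_simps)
  have "f (of_real R * z) = (LINT \<eta>|circle. \<phi> \<eta> * k \<eta>) + (LINT \<eta>|circle. \<phi> \<eta> * cnj (k \<eta>)) - (LINT \<eta>|circle. \<phi> \<eta>)"
    by (simp add: e1 e2 e3)
  also have "\<dots> = (LINT \<eta>|circle. \<phi> \<eta> * of_real (2 * Re (k \<eta>) - 1))"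
    using i by (subst P[symmetric]) simp
  finally have "norm (f (of_real R * z)) \<le> (LINT \<eta>|circle. norm (\<phi> \<eta> * of_real (2 * Re (k \<eta>) - 1)))"
    by (simp only: integral_norm_bound)
  also have "\<dots> = (LINT \<eta>|circle. 2 * Re (of_real (norm (\<phi> \<eta>)) * k \<eta>) - norm (\<phi> \<eta>))"
  proof (rule integral_circle_cong)
    show "(\<lambda>\<eta>. 2 * Re (of_real (norm (\<phi> \<eta>)) * k \<eta>) - norm (\<phi> \<eta>)) \<in> borel_measurable borel"
      using L2_circle_measurable[OF k] by simp
    show "(\<lambda>\<eta>. norm (\<phi> \<eta> * of_real (2 * Re (k \<eta>) - 1))) \<in> borel_measurable borel"
      using L2_circle_measurable[OF k] by simp
    fix \<eta> :: complex assume "norm \<eta> = 1"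
    then have "1 / 2 \<le> Re (k \<eta>)"
      unfolding k_def using z by (intro Re_cauchy_kernel_ge) (simp add: norm_mult)
    then show "norm (\<phi> \<eta> * of_real (2 * Re (k \<eta>) - 1)) = 2 * Re (of_real (norm (\<phi> \<eta>)) * k \<eta>) - norm (\<phi> \<eta>)"
      unfolding norm_mult norm_of_real by (simp add: algebra_simps)
  qed
  also have "\<dots> = 2 * Re (LINT \<eta>|circle. of_real (norm (\<phi> \<eta>)) * k \<eta>) - (LINT \<eta>|circle. norm (\<phi> \<eta>))"
  proof -
    have "(\<lambda>\<eta>. complex_of_real (norm (\<phi> \<eta>))) \<in> L2_circle"
      by (rule L2_circle_dominated[OF \<phi>, of _ 1]) auto
    then have j: "integrable circle (\<lambda>\<eta>. of_real (norm (\<phi> \<eta>)) * k \<eta>)"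
      by (rule L2_circle_mult_integrable[OF _ k])
    have j2: "integrable circle (\<lambda>\<eta>. 2 * Re (of_real (norm (\<phi> \<eta>)) * k \<eta>))"
      using integrable_Re[OF j] by (rule integrable_mult_right)
    have "(LINT \<eta>|circle. 2 * Re (of_real (norm (\<phi> \<eta>)) * k \<eta>)) = 2 * Re (LINT \<eta>|circle. of_real (norm (\<phi> \<eta>)) * k \<eta>)"
      using integral_Re[OF j] by (simp only: integral_mult_right_zero)
    with Bochner_Integration.integral_diff[OF j2 integrable_norm[OF i(3)]] show ?thesis by simp
  qed
  \<comment> \<open>Dropping the mean of \<open>norm \<phi>\<close> leaves the real part of an
    analytic Cauchy integral, so that power series can be used for the majorant.\<close>
  also have "\<dots> \<le> 2 * Re (LINT \<eta>|circle. of_real (norm (\<phi> \<eta>)) * k \<eta>)" by simp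
  finally show ?thesis by (simp add: \<phi>_def k_def)
qed

text \<open>Duality: \<open>g\<close> is the real part of an analytic function \<open>h\<close> at
  the maximizing radius, so the integral of \<open>g\<^sup>2\<close> pairs the coefficients of
  \<open>h\<close> with the dual coefficients \<open>t\<close> of \<open>g\<close>, and these are
  bounded by the integral of \<open>g\<^sup>2\<close> again. The resulting constant is independent
  of \<open>F\<close>.\<close>

lemma finite_radial_maximal:
  assumes f: "f \<in> H2" and F: "finite F" "F \<subseteq> {0..<1}"
  obtains g :: "complex \<Rightarrow> real" where "g \<in> borel_measurable borel"
    "\<And>\<zeta> s. norm \<zeta> = 1 \<Longrightarrow> s \<in> F \<Longrightarrow> norm (f (of_real s * \<zeta>)) \<le> 2 * g \<zeta>"
    "integrable circle (\<lambda>\<zeta>. (g \<zeta>)\<^sup>2)" "(LINT \<zeta>|circle. (g \<zeta>)\<^sup>2) \<le> 256 * (\<Sum>n. (norm (coef f n))\<^sup>2)"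
proof (cases "F = {}")
  case True
  show thesis
    by (rule that[of "\<lambda>_. 0"]) (use True f in \<open>auto intro!: suminf_nonneg simp: H2_iff_coef\<close>)
next
  case False
  note fh = H2_hol[OF f]
  note m [measurable] = hol_disc_measurable[OF fh]
  have "Max F \<in> F" using F False by (intro Max_in)
  then have Max1: "Max F < 1" "0 \<le> Max F" using F by auto
  \<comment> \<open>On the circle of radius \<open>R\<close> the function is bounded, and the
    rescaled radii \<open>s / R\<close> with \<open>s \<in> F\<close> stay below 1.\<close>
  then obtain R where R: "Max F < R" "R < 1" using dense by blast
  have R0: "0 \<le> R" "R < 1" "0 < R" using Max1 R by auto
  define \<psi> where "\<psi> \<eta> = complex_of_real (norm (f (of_real R * \<eta>)))" for \<eta>
  have \<phi>: "(\<lambda>\<eta>. f (of_real R * \<eta>)) \<in> L2_circle" by (rule L2_circle_dilate[OF fh R0(1,2)])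
  have \<psi>: "\<psi> \<in> L2_circle"
    unfolding \<psi>_def by (rule L2_circle_dominated[OF \<phi>, of _ 1]) auto
  note \<psi>i = L2_circle_integrable[OF \<psi>]
  define h where "h z = (\<Sum>n. fourier \<psi> n * z ^ n)" for z
  have [measurable]: "h \<in> borel_measurable borel" unfolding h_def by measurable
  have hs: "(\<lambda>n. fourier \<psi> n * z ^ n) sums h z" and hi: "h z = (LINT \<eta>|circle. \<psi> \<eta> / (1 - z * cnj \<eta>))"
    if "norm z < 1" for z
    using cauchy_transform[OF \<psi>i that] by (auto simp: h_def sums_iff)
  define \<rho> where "\<rho> = Max F / R"
  have \<rho>: "0 \<le> \<rho>" "\<rho> < 1" using Max1 R R0 by (auto simp: \<rho>_def)
  obtain r where rm: "r \<in> borel_measurable borel" and gm [measurable]: "(\<lambda>\<zeta>. Re (h (of_real (r \<zeta> / R) * \<zeta>))) \<in> borel_measurable borel"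
    and r: "\<And>\<zeta>. r \<zeta> \<in> F" "\<And>\<zeta> s. s \<in> F \<Longrightarrow> Re (h (of_real (s / R) * \<zeta>)) \<le> Re (h (of_real (r \<zeta> / R) * \<zeta>))"
    using measurable_argmax[OF F(1) False, of "\<lambda>s \<zeta>. Re (h (of_real (s / R) * \<zeta>))"] by auto
  define q where "q \<zeta> = r \<zeta> / R" for \<zeta>
  have qm: "q \<in> borel_measurable borel" unfolding q_def using rm by simp
  have q: "0 \<le> q \<zeta>" "q \<zeta> \<le> \<rho>" for \<zeta>
    using r(1)[of \<zeta>] F R0 Max_ge[OF F(1) r(1)[of \<zeta>]]
    by (auto simp: q_def \<rho>_def intro!: divide_right_mono divide_nonneg_nonneg)
  define g where "g \<zeta> = Re (h (of_real (q \<zeta>) * \<zeta>))" for \<zeta>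
  have g [measurable]: "g \<in> borel_measurable borel" unfolding g_def q_def by (rule gm)
  have major: "norm (f (of_real s * \<zeta>)) \<le> 2 * g \<zeta>" if n: "norm \<zeta> = 1" and s: "s \<in> F" for \<zeta> s
  proof -
    have s0: "0 \<le> s" "s \<le> Max F" using F s Max_ge[OF F(1) s] by auto
    then have "norm (of_real (s / R) * \<zeta>) < 1"
      using R R0 n by (simp add: norm_mult norm_divide)
    from poisson_majorant[OF fh R0(1,2) this]
    have "norm (f (of_real R * (of_real (s / R) * \<zeta>))) \<le> 2 * Re (h (of_real (s / R) * \<zeta>))"
      unfolding hi[OF \<open>norm (of_real (s / R) * \<zeta>) < 1\<close>] \<psi>_def .
    also have "\<dots> \<le> 2 * g \<zeta>" using r(2)[OF s, of \<zeta>] by (simp add: g_def q_def)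
    also have "of_real R * (of_real (s / R) * \<zeta>) = of_real s * \<zeta>" using R0 by simp
    finally show ?thesis .
  qed
  have g0: "0 \<le> g \<zeta>" if "norm \<zeta> = 1" for \<zeta>
    using order_trans[OF norm_ge_zero major[OF that r(1)[of \<zeta>]]] by simp
  \<comment> \<open>This bound deteriorates as \<open>\<rho>\<close> approaches 1; it serves only to
    make the integral of \<open>g\<^sup>2\<close> finite, hence absorbable.\<close>
  have gL: "(\<lambda>\<zeta>. complex_of_real (g \<zeta>)) \<in> L2_circle"
  proof (rule L2_circle_bounded)
    fix \<zeta> :: complex assume n: "norm \<zeta> = 1"
    define z where "z = of_real (q \<zeta>) * \<zeta>"
    have z: "norm z \<le> \<rho>" using q[of \<zeta>] n by (simp add: z_def norm_mult)
    then have z1: "norm z < 1" using \<rho> by simp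
    have "norm (complex_of_real (g \<zeta>)) \<le> norm (h z)"
      using abs_Re_le_cmod[of "h z"] by (simp add: g_def z_def)
    also have "\<dots> \<le> (LINT \<eta>|circle. norm (\<psi> \<eta> / (1 - z * cnj \<eta>)))"
      unfolding hi[OF z1] by (rule integral_norm_bound)
    also have "\<dots> \<le> (LINT \<eta>|circle. norm (\<psi> \<eta>) * (1 / (1 - \<rho>)))"
    proof (rule integral_mono_AE)
      show "integrable circle (\<lambda>\<eta>. norm (\<psi> \<eta> / (1 - z * cnj \<eta>)))"
        using L2_circle_mult_integrable[OF \<psi> L2_circle_cauchy_kernel[OF z1]] by simp
      show "integrable circle (\<lambda>\<eta>. norm (\<psi> \<eta>) * (1 / (1 - \<rho>)))" using \<psi>i by simp
      show "AE \<eta> in circle. norm (\<psi> \<eta> / (1 - z * cnj \<eta>)) \<le> norm (\<psi> \<eta>) * (1 / (1 - \<rho>))"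
      proof (rule AE_circleI)
        fix \<eta> :: complex assume "norm \<eta> = 1"
        then have "1 - \<rho> \<le> norm (1 - z * cnj \<eta>)"
          using norm_triangle_ineq2[of 1 "z * cnj \<eta>"] z by (simp add: norm_mult)
        then have "norm (\<psi> \<eta>) / norm (1 - z * cnj \<eta>) \<le> norm (\<psi> \<eta>) / (1 - \<rho>)"
          using \<rho> by (intro frac_le) auto
        then show "norm (\<psi> \<eta> / (1 - z * cnj \<eta>)) \<le> norm (\<psi> \<eta>) * (1 / (1 - \<rho>))"
          by (simp add: norm_divide)
      qed
    qed
    finally show "norm (complex_of_real (g \<zeta>)) \<le> (LINT \<eta>|circle. norm (\<psi> \<eta>) * (1 / (1 - \<rho>)))" .
  qed measurable
  have gi: "integrable circle (\<lambda>\<zeta>. (g \<zeta>)\<^sup>2)" using gL by (simp add: L2_circle_def)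
  define t where "t n = (LINT \<zeta>|circle. (of_real (q \<zeta>) * \<zeta>) ^ n * complex_of_real (g \<zeta>))" for n
  have t: "summable (\<lambda>n. (norm (t n))\<^sup>2)" "(\<Sum>n. (norm (t n))\<^sup>2) \<le> 256 * (LINT \<zeta>|circle. (g \<zeta>)\<^sup>2)"
    unfolding t_def using linearized_maximal_dual[OF qm q \<rho>(2) gL g g0] by auto
  have hg: "(\<lambda>n. fourier \<psi> n * t n) sums (LINT \<zeta>|circle. h (of_real (q \<zeta>) * \<zeta>) * of_real (g \<zeta>))"
     "integrable circle (\<lambda>\<zeta>. h (of_real (q \<zeta>) * \<zeta>) * of_real (g \<zeta>))"
    unfolding t_def
    using power_series_circle_integral[OF hs _ qm q \<rho>(2) L2_circle_integrable[OF gL]] by auto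
  have "(LINT \<zeta>|circle. (g \<zeta>)\<^sup>2) = (LINT \<zeta>|circle. Re (h (of_real (q \<zeta>) * \<zeta>) * of_real (g \<zeta>)))"
    unfolding Re_mult_of_real by (simp add: g_def power2_eq_square)
  also have "\<dots> = (\<Sum>n. Re (fourier \<psi> n * t n))"
    unfolding integral_Re[OF hg(2)] using sums_Re[OF hg(1)] by (simp add: sums_iff)
  \<comment> \<open>The weights come from \<open>(256 * x - y)\<^sup>2 \<ge> 0\<close>. Multiplied
    by the dual constant 256, the weight 1/512 becomes 1/2; absorbing that half doubles 128 to
    256.\<close>
  also have "\<dots> \<le> (\<Sum>n. 128 * (norm (fourier \<psi> n))\<^sup>2 + (1/512) * (norm (t n))\<^sup>2)"
  proof (rule suminf_le)
    fix n
    have "Re (fourier \<psi> n * t n) \<le> norm (fourier \<psi> n) * norm (t n)"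
      using complex_Re_le_cmod[of "fourier \<psi> n * t n"] by (simp add: norm_mult)
    moreover have "0 \<le> (256 * norm (fourier \<psi> n) - norm (t n))\<^sup>2" by simp
    then have "norm (fourier \<psi> n) * norm (t n) \<le> 128 * (norm (fourier \<psi> n))\<^sup>2 + (1/512) * (norm (t n))\<^sup>2"
      unfolding power2_diff by (simp add: power2_eq_square algebra_simps)
    ultimately show "Re (fourier \<psi> n * t n) \<le> 128 * (norm (fourier \<psi> n))\<^sup>2 + (1/512) * (norm (t n))\<^sup>2"
      by (rule order_trans)
  next
    show "summable (\<lambda>n. Re (fourier \<psi> n * t n))" using sums_Re[OF hg(1)] by (simp add: sums_iff)
    show "summable (\<lambda>n. 128 * (norm (fourier \<psi> n))\<^sup>2 + (1/512) * (norm (t n))\<^sup>2)"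
      by (intro summable_add summable_mult t bessel_summable[OF \<psi>])
  qed
  also have "\<dots> = 128 * (\<Sum>n. (norm (fourier \<psi> n))\<^sup>2) + (1/512) * (\<Sum>n. (norm (t n))\<^sup>2)"
    using t(1) bessel_summable(1)[OF \<psi>]
    by (simp add: suminf_add[symmetric] suminf_mult summable_mult summable_divide suminf_divide)
  also have "\<dots> \<le> 128 * (\<Sum>n. (norm (coef f n))\<^sup>2) + (1/512) * (256 * (LINT \<zeta>|circle. (g \<zeta>)\<^sup>2))"
  proof (intro add_mono mult_left_mono t)
    have "(\<Sum>n. (norm (fourier \<psi> n))\<^sup>2) \<le> (LINT \<zeta>|circle. (norm (f (of_real R * \<zeta>)))\<^sup>2)"
      using bessel_summable(2)[OF \<psi>] by (simp add: \<psi>_def)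
    also have "\<dots> \<le> (\<Sum>n. (norm (coef f n))\<^sup>2)"
      by (rule dilate_norm_le[OF fh H2_summable[OF f] R0(1,2)])
    finally show "(\<Sum>n. (norm (fourier \<psi> n))\<^sup>2) \<le> (\<Sum>n. (norm (coef f n))\<^sup>2)" .
  qed auto
  finally have "(LINT \<zeta>|circle. (g \<zeta>)\<^sup>2) \<le> 256 * (\<Sum>n. (norm (coef f n))\<^sup>2)" by simp
  from that[OF g major gi this] show thesis by blast
qed

section \<open>Radial limits\<close>

text \<open>A countable set of radii keeps suprema and Cauchy conditions measurable, and continuity
  along each radius makes it sufficient.\<close>

definition rat_radius :: "nat \<Rightarrow> real" where
  "rat_radius = from_nat_into {r \<in> \<rat>. 0 \<le> r \<and> r < 1}"

lemma range_rat_radius: "range rat_radius = {r \<in> \<rat>. 0 \<le> r \<and> r < 1}"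
proof -
  have "countable {r \<in> \<rat>. 0 \<le> r \<and> r < (1::real)}"
    by (rule countable_subset[OF _ countable_rat]) auto
  moreover have "(0::real) \<in> {r \<in> \<rat>. 0 \<le> r \<and> r < 1}" by simp
  ultimately show ?thesis
    unfolding rat_radius_def by (intro range_from_nat_into) auto
qed

lemma rat_radius: "0 \<le> rat_radius n" "rat_radius n < 1"
  using range_rat_radius by auto

text \<open>Extended values are used because finiteness holds only almost everywhere and is itself a
  consequence of the maximal inequality.\<close>

definition rmax :: "(complex \<Rightarrow> complex) \<Rightarrow> complex \<Rightarrow> ennreal" where
  "rmax f \<zeta> = (SUP n. ennreal ((norm (f (of_real (rat_radius n) * \<zeta>)))\<^sup>2))"

lemma rmax_measurable: "f \<in> hol_disc \<Longrightarrow> rmax f \<in> borel_measurable borel"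
proof -
  assume "f \<in> hol_disc"
  then have [measurable]: "f \<in> borel_measurable borel" by (rule hol_disc_measurable)
  show ?thesis unfolding rmax_def by measurable
qed

lemma rmax_upper: "ennreal ((norm (f (of_real (rat_radius n) * \<zeta>)))\<^sup>2) \<le> rmax f \<zeta>"
  unfolding rmax_def by (rule SUP_upper) simp

text \<open>Monotone convergence from the maxima over finitely many radii, whose bound is uniform;
  1024 is 256 times the square of the factor 2 in front of \<open>g\<close>.\<close>

lemma nn_integral_rmax_le:
  assumes f: "f \<in> H2"
  shows "(\<integral>\<^sup>+\<zeta>. rmax f \<zeta> \<partial>circle) \<le> ennreal (1024 * (\<Sum>n. (norm (coef f n))\<^sup>2))"
proof -
  have [measurable]: "f \<in> borel_measurable borel" by (rule hol_disc_measurable[OF H2_hol[OF f]])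
  define M where "M N \<zeta> = (SUP n\<in>{..N}. ennreal ((norm (f (of_real (rat_radius n) * \<zeta>)))\<^sup>2))" for N :: nat and \<zeta>
  have inc: "incseq M"
    unfolding M_def by (intro monoI le_funI SUP_subset_mono) auto
  have [measurable]: "M N \<in> borel_measurable borel" for N unfolding M_def by measurable
  have "rmax f \<zeta> = (SUP N. M N \<zeta>)" for \<zeta>
  proof (rule antisym)
    show "rmax f \<zeta> \<le> (SUP N. M N \<zeta>)"
      unfolding rmax_def M_def by (intro SUP_mono) (auto intro!: SUP_upper)
    show "(SUP N. M N \<zeta>) \<le> rmax f \<zeta>"
      unfolding M_def by (intro SUP_least rmax_upper)
  qed
  then have "(\<integral>\<^sup>+\<zeta>. rmax f \<zeta> \<partial>circle) = (\<integral>\<^sup>+\<zeta>. (SUP N. M N \<zeta>) \<partial>circle)" by simp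
  also have "\<dots> = (SUP N. \<integral>\<^sup>+\<zeta>. M N \<zeta> \<partial>circle)"
    by (rule nn_integral_monotone_convergence_SUP[OF inc]) simp
  also have "\<dots> \<le> ennreal (1024 * (\<Sum>n. (norm (coef f n))\<^sup>2))"
  proof (rule SUP_least)
    fix N
    have fin: "finite (rat_radius ` {..N})" and sub: "rat_radius ` {..N} \<subseteq> {0..<1}"
      by (auto simp: rat_radius)
    obtain g :: "complex \<Rightarrow> real" where g: "g \<in> borel_measurable borel"
      "\<And>\<zeta> s. norm \<zeta> = 1 \<Longrightarrow> s \<in> rat_radius ` {..N} \<Longrightarrow> norm (f (of_real s * \<zeta>)) \<le> 2 * g \<zeta>"
      "integrable circle (\<lambda>\<zeta>. (g \<zeta>)\<^sup>2)" "(LINT \<zeta>|circle. (g \<zeta>)\<^sup>2) \<le> 256 * (\<Sum>n. (norm (coef f n))\<^sup>2)"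
      using finite_radial_maximal[OF f fin sub] by blast
    have "(\<integral>\<^sup>+\<zeta>. M N \<zeta> \<partial>circle) \<le> (\<integral>\<^sup>+\<zeta>. ennreal (4 * (g \<zeta>)\<^sup>2) \<partial>circle)"
    proof (intro nn_integral_mono_AE AE_circleI)
      fix \<zeta> :: complex assume n: "norm \<zeta> = 1"
      show "M N \<zeta> \<le> ennreal (4 * (g \<zeta>)\<^sup>2)"
        unfolding M_def
      proof (intro SUP_least ennreal_leI)
        fix k assume "k \<in> {..N}"
        then have "norm (f (of_real (rat_radius k) * \<zeta>)) \<le> 2 * g \<zeta>" by (intro g(2)[OF n]) auto
        then have "(norm (f (of_real (rat_radius k) * \<zeta>)))\<^sup>2 \<le> (2 * g \<zeta>)\<^sup>2" by (intro power_mono) auto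
        then show "(norm (f (of_real (rat_radius k) * \<zeta>)))\<^sup>2 \<le> 4 * (g \<zeta>)\<^sup>2" by (simp add: power_mult_distrib)
      qed
    qed
    also have "\<dots> = ennreal (LINT \<zeta>|circle. 4 * (g \<zeta>)\<^sup>2)"
      using g(3) by (intro nn_integral_eq_integral) auto
    also have "\<dots> \<le> ennreal (1024 * (\<Sum>n. (norm (coef f n))\<^sup>2))"
      using g(4) by (intro ennreal_leI) simp
    finally show "(\<integral>\<^sup>+\<zeta>. M N \<zeta> \<partial>circle) \<le> ennreal (1024 * (\<Sum>n. (norm (coef f n))\<^sup>2))" .
  qed
  finally show ?thesis .
qed

text \<open>The Cauchy criterion for the radial limit, with all quantifiers over natural numbers so
  that the set of points is Borel.\<close>

definition radial_cauchy :: "(complex \<Rightarrow> complex) \<Rightarrow> complex \<Rightarrow> bool" where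
  "radial_cauchy f \<zeta> \<longleftrightarrow> (\<forall>k::nat. \<exists>m::nat. \<forall>i j. 1 - 1 / real (Suc m) < rat_radius i \<longrightarrow> 1 - 1 / real (Suc m) < rat_radius j \<longrightarrow>
    norm (f (of_real (rat_radius i) * \<zeta>) - f (of_real (rat_radius j) * \<zeta>)) \<le> 1 / real (Suc k))"

lemma radial_cauchy_measurable:
  assumes "f \<in> borel_measurable borel"
  shows "{\<zeta>. radial_cauchy f \<zeta>} \<in> sets borel"
proof -
  have [measurable]: "f \<in> borel_measurable borel" by fact
  have "Measurable.pred borel (\<lambda>\<zeta>. radial_cauchy f \<zeta>)" unfolding radial_cauchy_def by measurable
  then show ?thesis by simp
qed

lemma continuous_on_radius:
  assumes f: "f \<in> hol_disc" and \<zeta>: "norm \<zeta> \<le> 1"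
  shows "continuous_on {0..<1} (\<lambda>r::real. f (of_real r * \<zeta>))"
proof -
  have "continuous_on disc f" using f by (auto simp: hol_disc_def intro: holomorphic_on_imp_continuous_on)
  then show ?thesis
  proof (rule continuous_on_compose2)
    show "(\<lambda>r::real. of_real r * \<zeta>) ` {0..<1} \<subseteq> disc"
    proof clarsimp
      fix r :: real assume "0 \<le> r" "r < 1"
      then have "r * norm \<zeta> \<le> r * 1" using \<zeta> by (intro mult_left_mono) auto
      then show "norm (of_real r * \<zeta>) < 1" using \<open>0 \<le> r\<close> \<open>r < 1\<close> by (simp add: norm_mult)
    qed
  qed (auto intro!: continuous_intros)
qed

text \<open>By continuity each radius near 1 can be replaced by a rational one at small cost, so the
  criterion extends to all radii; completeness of the plane then supplies the limit.\<close>

lemma radial_cauchy_iff: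
  assumes f: "f \<in> hol_disc" and \<zeta>: "norm \<zeta> \<le> 1"
  shows "radial_cauchy f \<zeta> \<longleftrightarrow> (\<exists>l. ((\<lambda>r::real. f (of_real r * \<zeta>)) \<longlongrightarrow> l) (at_left 1))"
proof
  define x where "x r = f (of_real r * \<zeta>)" for r :: real
  have cont: "continuous_on {0..<1} x" unfolding x_def by (rule continuous_on_radius[OF f \<zeta>])
  assume C: "radial_cauchy f \<zeta>"
  have C': "\<exists>m::nat. \<forall>r s. 1 - 1 / real (Suc m) < r \<longrightarrow> r < 1 \<longrightarrow> 1 - 1 / real (Suc m) < s \<longrightarrow> s < 1 \<longrightarrow>
    norm (x r - x s) \<le> e" if e: "0 < e" for e :: real
  proof -
    obtain k where k: "1 / real (Suc k) < e / 3" using nat_approx_posE[of "e / 3"] e by auto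
    obtain m where m: "\<And>i j. 1 - 1 / real (Suc m) < rat_radius i \<Longrightarrow> 1 - 1 / real (Suc m) < rat_radius j \<Longrightarrow>
       norm (x (rat_radius i) - x (rat_radius j)) \<le> 1 / real (Suc k)"
      using C unfolding radial_cauchy_def x_def by blast
    have near: "\<exists>i. 1 - 1 / real (Suc m) < rat_radius i \<and> norm (x r - x (rat_radius i)) < e / 3"
      if r: "1 - 1 / real (Suc m) < r" "r < 1" for r
    proof -
      have "0 \<le> 1 - 1 / real (Suc m)" by simp
      then have "0 \<le> r" using r(1) by linarith
      then have r0: "r \<in> {0..<1}" using r by auto
      from cont[unfolded continuous_on_iff, rule_format, OF r0, of "e / 3"] e
      obtain d where d: "d > 0" "\<And>s. s \<in> {0..<1} \<Longrightarrow> dist s r < d \<Longrightarrow> dist (x s) (x r) < e / 3" by auto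
      obtain s where s: "s \<in> \<rat>" "r < s" "s < min 1 (r + d)"
        using Rats_dense_in_real[of r "min 1 (r + d)"] r d by auto
      then have "s \<in> range rat_radius"
        unfolding range_rat_radius using \<open>0 \<le> r\<close> by simp
      then obtain i where i: "s = rat_radius i" by (rule rangeE)
      have "dist (x s) (x r) < e / 3" using s r0 by (intro d) (auto simp: dist_real_def)
      then show ?thesis using i s r by (intro exI[of _ i]) (auto simp: dist_norm norm_minus_commute)
    qed
    have "norm (x r - x s) \<le> e" if r: "1 - 1 / real (Suc m) < r" "r < 1" "1 - 1 / real (Suc m) < s" "s < 1" for r s
    proof -
      obtain i where i: "1 - 1 / real (Suc m) < rat_radius i" "norm (x r - x (rat_radius i)) < e / 3" using near[OF r(1,2)] by blast
      obtain j where j: "1 - 1 / real (Suc m) < rat_radius j" "norm (x s - x (rat_radius j)) < e / 3" using near[OF r(3,4)] by blast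
      have "x r - x s = (x r - x (rat_radius i)) + (x (rat_radius i) - x (rat_radius j)) - (x s - x (rat_radius j))" by simp
      also have "norm \<dots> \<le> norm (x r - x (rat_radius i)) + norm (x (rat_radius i) - x (rat_radius j)) + norm (x s - x (rat_radius j))"
        by (intro order_trans[OF norm_triangle_ineq4] add_mono norm_triangle_ineq order_refl)
      finally show ?thesis using m[OF i(1) j(1)] i(2) j(2) k by linarith
    qed
    then show ?thesis by blast
  qed
  \<comment> \<open>The shift to \<open>Suc (Suc n)\<close> puts the radius strictly beyond
    \<open>1 - 1 / real (Suc m)\<close> as soon as \<open>n \<ge> m\<close>.\<close>
  define y where "y n = x (1 - 1 / real (Suc (Suc n)))" for n
  have "Cauchy y"
  proof (rule metric_CauchyI)
    fix e :: real assume e: "0 < e"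
    obtain m where m: "\<And>r s. 1 - 1 / real (Suc m) < r \<Longrightarrow> r < 1 \<Longrightarrow> 1 - 1 / real (Suc m) < s \<Longrightarrow> s < 1 \<Longrightarrow> norm (x r - x s) \<le> e / 2"
      using C'[of "e / 2"] e by auto
    have "1 - 1 / real (Suc m) < 1 - 1 / real (Suc (Suc n))" if "n \<ge> m" for n
      using that by (simp add: frac_less2)
    then show "\<exists>M. \<forall>p\<ge>M. \<forall>n\<ge>M. dist (y p) (y n) < e"
      using m e by (intro exI[of _ m]) (auto simp: y_def dist_norm intro!: le_less_trans[OF m])
  qed
  then obtain l where l: "y \<longlonglongrightarrow> l" by (auto simp: Cauchy_convergent_iff convergent_def)
  have "(x \<longlongrightarrow> l) (at_left 1)"
  proof (rule tendstoI)
    fix e :: real assume e: "0 < e"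
    obtain m where m: "\<And>r s. 1 - 1 / real (Suc m) < r \<Longrightarrow> r < 1 \<Longrightarrow> 1 - 1 / real (Suc m) < s \<Longrightarrow> s < 1 \<Longrightarrow> norm (x r - x s) \<le> e / 2"
      using C'[of "e / 2"] e by auto
    have "dist (x r) l < e" if r: "1 - 1 / real (Suc m) < r" "r < 1" for r
    proof -
      have "norm (x r - l) \<le> e / 2"
      proof (rule LIMSEQ_le_const2)
        show "(\<lambda>n. norm (x r - y n)) \<longlonglongrightarrow> norm (x r - l)" by (intro tendsto_intros l)
        have "norm (x r - y n) \<le> e / 2" if "n \<ge> m" for n
          unfolding y_def using that r by (intro m) (auto simp: frac_less2)
        then show "\<exists>N. \<forall>n\<ge>N. norm (x r - y n) \<le> e / 2" by blast
      qed
      then show ?thesis using e by (simp add: dist_norm)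
    qed
    moreover have "\<forall>\<^sub>F r in at_left 1. r \<in> {1 - 1 / real (Suc m)<..<1}"
      by (rule eventually_at_left_real) simp
    ultimately show "\<forall>\<^sub>F r in at_left 1. dist (x r) l < e"
      by (auto elim: eventually_mono)
  qed
  then show "\<exists>l. ((\<lambda>r::real. f (of_real r * \<zeta>)) \<longlongrightarrow> l) (at_left 1)" unfolding x_def by (rule exI)
next
  assume "\<exists>l. ((\<lambda>r::real. f (of_real r * \<zeta>)) \<longlongrightarrow> l) (at_left 1)"
  then obtain l where l: "((\<lambda>r::real. f (of_real r * \<zeta>)) \<longlongrightarrow> l) (at_left 1)" by blast
  show "radial_cauchy f \<zeta>"
    unfolding radial_cauchy_def
  proof
    fix k :: nat
    have "\<forall>\<^sub>F r in at_left 1. dist (f (of_real r * \<zeta>)) l < 1 / real (2 * Suc k)"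
      using l by (rule tendstoD) simp
    then obtain b where b: "b < 1" "\<And>r. b < r \<Longrightarrow> r < 1 \<Longrightarrow> dist (f (of_real r * \<zeta>)) l < 1 / real (2 * Suc k)"
      unfolding eventually_at_left_field by auto
    obtain m where m: "1 / real (Suc m) < 1 - b" using nat_approx_posE[of "1 - b"] b by auto
    have "norm (f (of_real (rat_radius i) * \<zeta>) - f (of_real (rat_radius j) * \<zeta>)) \<le> 1 / real (Suc k)"
      if "1 - 1 / real (Suc m) < rat_radius i" "1 - 1 / real (Suc m) < rat_radius j" for i j
    proof -
      have "dist (f (of_real (rat_radius i) * \<zeta>)) l < 1 / real (2 * Suc k)"
         "dist (f (of_real (rat_radius j) * \<zeta>)) l < 1 / real (2 * Suc k)"
        using that m by (intro b rat_radius; linarith)+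
      then have "dist (f (of_real (rat_radius i) * \<zeta>)) (f (of_real (rat_radius j) * \<zeta>)) < 1 / real (2 * Suc k) + 1 / real (2 * Suc k)"
        by (rule dist_triangle_less_add[OF _ _]) 
      then show ?thesis by (simp add: dist_norm field_simps)
    qed
    then show "\<exists>m. \<forall>i j. 1 - 1 / real (Suc m) < rat_radius i \<longrightarrow> 1 - 1 / real (Suc m) < rat_radius j \<longrightarrow>
      norm (f (of_real (rat_radius i) * \<zeta>) - f (of_real (rat_radius j) * \<zeta>)) \<le> 1 / real (Suc k)"
      by blast
  qed
qed

text \<open>Measurability concerns the whole plane, so every point needs a value: beyond the closed
  disc \<open>f\<close> is 0 near the end of the radius, at points of convergence one sequence of
  radii computes the limit, and at all other points \<open>bdry\<close> is one fixed
  constant.\<close>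

lemma bdry_measurable:
  assumes f: "f \<in> hol_disc"
  shows "bdry f \<in> borel_measurable borel"
proof -
  note [measurable] = hol_disc_measurable[OF f]
  define y where "y \<zeta> n = f (of_real (1 - 1 / real (Suc (Suc n))) * \<zeta>)" for \<zeta> n
  \<comment> \<open>The value of \<open>Lim\<close> where no limit exists: the predicate under the
    description is then constantly false, so the value does not depend on
    \<open>\<zeta>\<close>.\<close>
  define K :: complex where "K = (THE l. False)"
  have seq: "(\<lambda>n. 1 - 1 / real (Suc (Suc n))) \<longlonglongrightarrow> 1"
    using tendsto_diff[OF tendsto_const LIMSEQ_Suc[OF LIMSEQ_inverse_real_of_nat], of 1]
    by (simp add: inverse_eq_divide)
  have seq': "filterlim (\<lambda>n. 1 - 1 / real (Suc (Suc n))) (at_left 1) sequentially"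
    unfolding filterlim_at using seq by (auto intro!: always_eventually)
  have "bdry f \<zeta> = (if 1 < norm \<zeta> then 0 else if radial_cauchy f \<zeta> then lim (y \<zeta>) else K)" for \<zeta>
  proof (cases "1 < norm \<zeta>")
    case True
    have "((\<lambda>r::real. norm (of_real r * \<zeta>)) \<longlongrightarrow> norm (of_real 1 * \<zeta>)) (at_left 1)"
      by (intro tendsto_intros)
    then have "\<forall>\<^sub>F r in at_left 1. 1 < norm (of_real r * \<zeta>)"
      using True by (intro order_tendstoD(1)) auto
    then have "\<forall>\<^sub>F r in at_left 1. f (of_real r * \<zeta>) = 0"
      by (rule eventually_mono) (use f in \<open>auto simp: hol_disc_def\<close>)
    then have "((\<lambda>r::real. f (of_real r * \<zeta>)) \<longlongrightarrow> 0) (at_left 1)"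
      by (rule tendsto_eventually)
    then show ?thesis using True by (simp add: bdry_def tendsto_Lim)
  next
    case False
    then have n: "norm \<zeta> \<le> 1" by simp
    show ?thesis
    proof (cases "radial_cauchy f \<zeta>")
      case True
      then obtain l where l: "((\<lambda>r::real. f (of_real r * \<zeta>)) \<longlongrightarrow> l) (at_left 1)"
        using radial_cauchy_iff[OF f n] by blast
      then have "y \<zeta> \<longlonglongrightarrow> l" unfolding y_def using filterlim_compose[OF l seq'] by simp
      then have "lim (y \<zeta>) = l" by (rule limI)
      moreover have "bdry f \<zeta> = l" using l by (simp add: bdry_def tendsto_Lim)
      ultimately show ?thesis using True False by simp
    next
      case nc: False
      then have "\<not> ((\<lambda>r::real. f (of_real r * \<zeta>)) \<longlongrightarrow> l) (at_left 1)" for l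
        using radial_cauchy_iff[OF f n] by blast
      then have "bdry f \<zeta> = K" unfolding bdry_def Topological_Spaces.Lim_def K_def by simp
      then show ?thesis using False nc by simp
    qed
  qed
  moreover have "(\<lambda>\<zeta>. if 1 < norm \<zeta> then 0 else if radial_cauchy f \<zeta> then lim (y \<zeta>) else K) \<in> borel_measurable borel"
  proof -
    have [measurable]: "Measurable.pred borel (radial_cauchy f)"
      using radial_cauchy_measurable[OF hol_disc_measurable[OF f]] by (simp add: pred_def)
    have [measurable]: "(\<lambda>\<zeta>. lim (y \<zeta>)) \<in> borel_measurable borel"
      unfolding y_def by (rule borel_measurable_lim_metric) measurable
    show ?thesis by measurable
  qed
  ultimately show ?thesis by presburger
qed

text \<open>Taylor polynomials are continuous up to the circle, so the oscillation of
  \<open>f\<close> near the end of a radius is governed by the maximal function of the tail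
  \<open>T N\<close>. Its integral tends to 0 with the tail, hence the infimum over \<open>N\<close>
  vanishes almost everywhere.\<close>

lemma AE_radial_limit:
  assumes f: "f \<in> H2"
  shows "AE \<zeta> in circle. ((\<lambda>r::real. f (of_real r * \<zeta>)) \<longlongrightarrow> bdry f \<zeta>) (at_left 1)"
proof -
  note fh = H2_hol[OF f]
  define c where "c N n = (if n < N then 0 else coef f n)" for N n :: nat
  have cs: "summable (\<lambda>n. (norm (c N n))\<^sup>2)" for N
    by (rule summable_comparison_test'[OF H2_summable[OF f]]) (simp add: c_def)
  define T where "T N = of_coef (c N)" for N
  have T: "T N \<in> H2" "coef (T N) = c N" for N
    unfolding T_def using of_coef_H2[OF cs] by auto
  have split: "f z = (\<Sum>n<N. coef f n * z ^ n) + T N z" if "norm z < 1" for z N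
  proof -
    have "(\<lambda>n. (if n < N then coef f n * z ^ n else 0) + c N n * z ^ n) sums ((\<Sum>n<N. coef f n * z ^ n) + T N z)"
      using sums_add[OF sums_If_finite_set[of "{..<N}" "\<lambda>n. coef f n * z ^ n"] coef_sums[OF H2_hol[OF T(1)] that]]
      by (simp add: T(2))
    moreover have "(if n < N then coef f n * z ^ n else 0) + c N n * z ^ n = coef f n * z ^ n" for n
      by (simp add: c_def)
    ultimately show ?thesis using coef_sums[OF fh that] sums_unique2 by fastforce
  qed
  have lim: "(\<lambda>N. 1024 * (\<Sum>n. (norm (c N n))\<^sup>2)) \<longlonglongrightarrow> 0"
  proof -
    have "(\<Sum>n. (norm (c N n))\<^sup>2) = (\<Sum>n. (norm (coef f n))\<^sup>2) - (\<Sum>n<N. (norm (coef f n))\<^sup>2)" for N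
    proof -
      have "(\<Sum>n. (norm (c N n))\<^sup>2) = (\<Sum>n. (norm (c N (n + N)))\<^sup>2) + (\<Sum>n<N. (norm (c N n))\<^sup>2)"
        by (rule suminf_split_initial_segment[OF cs])
      also have "\<dots> = (\<Sum>n. (norm (coef f (n + N)))\<^sup>2)" by (simp add: c_def)
      also have "\<dots> = (\<Sum>n. (norm (coef f n))\<^sup>2) - (\<Sum>n<N. (norm (coef f n))\<^sup>2)"
        using suminf_split_initial_segment[OF H2_summable[OF f], of N] by simp
      finally show ?thesis .
    qed
    moreover have "(\<lambda>N. (\<Sum>n. (norm (coef f n))\<^sup>2) - (\<Sum>n<N. (norm (coef f n))\<^sup>2)) \<longlonglongrightarrow>
        (\<Sum>n. (norm (coef f n))\<^sup>2) - (\<Sum>n. (norm (coef f n))\<^sup>2)"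
      by (intro tendsto_intros summable_LIMSEQ H2_summable[OF f])
    ultimately have "(\<lambda>N. \<Sum>n. (norm (c N n))\<^sup>2) \<longlonglongrightarrow> 0" by simp
    then show ?thesis by (rule tendsto_mult_right_zero)
  qed
  have [measurable]: "rmax (T N) \<in> borel_measurable borel" for N
    by (rule rmax_measurable[OF H2_hol[OF T(1)]])
  have "(\<integral>\<^sup>+\<zeta>. (INF N. rmax (T N) \<zeta>) \<partial>circle) \<le> ennreal (1024 * (\<Sum>n. (norm (c N n))\<^sup>2))" for N
  proof -
    have "(\<integral>\<^sup>+\<zeta>. (INF N. rmax (T N) \<zeta>) \<partial>circle) \<le> (\<integral>\<^sup>+\<zeta>. rmax (T N) \<zeta> \<partial>circle)"
      by (intro nn_integral_mono INF_lower) simp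
    also have "\<dots> \<le> ennreal (1024 * (\<Sum>n. (norm (c N n))\<^sup>2))"
      using nn_integral_rmax_le[OF T(1)[of N]] by (simp only: T(2))
    finally show ?thesis .
  qed
  then have "(\<integral>\<^sup>+\<zeta>. (INF N. rmax (T N) \<zeta>) \<partial>circle) \<le> ennreal 0"
    using tendsto_ennrealI[OF lim] by (intro LIMSEQ_le_const) auto
  then have "(\<integral>\<^sup>+\<zeta>. (INF N. rmax (T N) \<zeta>) \<partial>circle) = 0" by simp
  then have "AE \<zeta> in circle. (INF N. rmax (T N) \<zeta>) = 0"
    by (subst (asm) nn_integral_0_iff_AE) auto
  then show ?thesis
    using AE_circle_norm
  proof eventually_elim
    case (elim \<zeta>)
    have "radial_cauchy f \<zeta>"
      unfolding radial_cauchy_def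
    proof
      fix k :: nat
      \<comment> \<open>Four errors of size \<open>e\<close>: two from the polynomial part and one
        from each of the two tails.\<close>
      define e where "e = 1 / (4 * real (Suc k))"
      have e: "0 < e" by (simp add: e_def)
      have "(INF N. rmax (T N) \<zeta>) < ennreal (e\<^sup>2)" using elim(1) e by simp
      then obtain N where N: "rmax (T N) \<zeta> < ennreal (e\<^sup>2)" by (auto simp: INF_less_iff)
      have tb: "norm (T N (of_real (rat_radius i) * \<zeta>)) \<le> e" for i
      proof -
        have "ennreal ((norm (T N (of_real (rat_radius i) * \<zeta>)))\<^sup>2) < ennreal (e\<^sup>2)"
          using rmax_upper[of "T N" i \<zeta>] N by (rule le_less_trans)
        then have "(norm (T N (of_real (rat_radius i) * \<zeta>)))\<^sup>2 < e\<^sup>2" by (simp add: ennreal_less_iff)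
        then show ?thesis using e by (meson less_imp_le power_less_imp_less_base)
      qed
      define S where "S z = (\<Sum>n<N. coef f n * z ^ n)" for z
      have "((\<lambda>r::real. S (of_real r * \<zeta>)) \<longlongrightarrow> S (of_real 1 * \<zeta>)) (at_left 1)"
        unfolding S_def by (intro tendsto_intros)
      then have "\<forall>\<^sub>F r in at_left (1::real). dist (S (of_real r * \<zeta>)) (S (of_real 1 * \<zeta>)) < e"
        using e by (rule tendstoD)
      then obtain b where b: "b < 1" "\<And>r. b < r \<Longrightarrow> r < 1 \<Longrightarrow> dist (S (of_real r * \<zeta>)) (S (of_real 1 * \<zeta>)) < e"
        unfolding eventually_at_left_field by auto
      obtain m where m: "1 / real (Suc m) < 1 - b" using nat_approx_posE[of "1 - b"] b by auto
      have "norm (f (of_real (rat_radius i) * \<zeta>) - f (of_real (rat_radius j) * \<zeta>)) \<le> 1 / real (Suc k)"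
        if "1 - 1 / real (Suc m) < rat_radius i" "1 - 1 / real (Suc m) < rat_radius j" for i j
      proof -
        have d: "dist (S (of_real (rat_radius i) * \<zeta>)) (S (of_real 1 * \<zeta>)) < e"
           "dist (S (of_real (rat_radius j) * \<zeta>)) (S (of_real 1 * \<zeta>)) < e"
          using that m by (intro b rat_radius; linarith)+
        have d2: "norm (S (of_real (rat_radius i) * \<zeta>) - S (of_real (rat_radius j) * \<zeta>)) < e + e"
          using dist_triangle_less_add[OF d] by (simp add: dist_norm)
        have fs: "f (of_real (rat_radius i) * \<zeta>) = S (of_real (rat_radius i) * \<zeta>) + T N (of_real (rat_radius i) * \<zeta>)" for i
          unfolding S_def using elim(2) rat_radius[of i] by (intro split) (simp add: norm_mult)
        have "f (of_real (rat_radius i) * \<zeta>) - f (of_real (rat_radius j) * \<zeta>) =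
          (S (of_real (rat_radius i) * \<zeta>) - S (of_real (rat_radius j) * \<zeta>)) + T N (of_real (rat_radius i) * \<zeta>) - T N (of_real (rat_radius j) * \<zeta>)"
          unfolding fs by simp
        also have "norm \<dots> \<le> norm (S (of_real (rat_radius i) * \<zeta>) - S (of_real (rat_radius j) * \<zeta>)) + norm (T N (of_real (rat_radius i) * \<zeta>)) + norm (T N (of_real (rat_radius j) * \<zeta>))"
          by (intro order_trans[OF norm_triangle_ineq4] add_mono norm_triangle_ineq order_refl)
        also have "\<dots> \<le> (e + e) + e + e" using d2 tb[of i] tb[of j] by linarith
        also have "\<dots> = 1 / real (Suc k)" by (simp add: e_def field_simps)
        finally show ?thesis .
      qed
      then show "\<exists>m. \<forall>i j. 1 - 1 / real (Suc m) < rat_radius i \<longrightarrow> 1 - 1 / real (Suc m) < rat_radius j \<longrightarrow>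
        norm (f (of_real (rat_radius i) * \<zeta>) - f (of_real (rat_radius j) * \<zeta>)) \<le> 1 / real (Suc k)"
        by blast
    qed
    then obtain l where l: "((\<lambda>r::real. f (of_real r * \<zeta>)) \<longlongrightarrow> l) (at_left 1)"
      using radial_cauchy_iff[OF fh, of \<zeta>] elim(2) by auto
    then have "bdry f \<zeta> = l" by (simp add: bdry_def tendsto_Lim)
    with l show ?case by simp
  qed
qed

section \<open>Boundary functions in mean square and Parseval's formula\<close>

definition radius_seq :: "nat \<Rightarrow> real" where
  "radius_seq n = 1 - 1 / real (Suc (Suc n))"

lemma radius_seq: "0 \<le> radius_seq n" "radius_seq n < 1" "radius_seq \<longlonglongrightarrow> 1"
    "filterlim radius_seq (at_left 1) sequentially" "\<exists>i. radius_seq n = rat_radius i"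
proof -
  show r: "0 \<le> radius_seq n" "radius_seq n < 1" for n by (auto simp: radius_seq_def)
  show l: "radius_seq \<longlonglongrightarrow> 1"
    unfolding radius_seq_def
    using tendsto_diff[OF tendsto_const LIMSEQ_Suc[OF LIMSEQ_inverse_real_of_nat], of 1]
    by (simp add: inverse_eq_divide)
  show "filterlim radius_seq (at_left 1) sequentially"
    unfolding filterlim_at using l r by (auto intro!: always_eventually simp: less_imp_neq)
  have "radius_seq n \<in> \<rat>" unfolding radius_seq_def by (intro Rats_diff Rats_divide) auto
  then have "radius_seq n \<in> range rat_radius" unfolding range_rat_radius using r by simp
  then show "\<exists>i. radius_seq n = rat_radius i" by auto
qed

lemma AE_bdry_seq:
  assumes "f \<in> H2"
  shows "AE \<zeta> in circle. (\<lambda>n. f (of_real (radius_seq n) * \<zeta>)) \<longlonglongrightarrow> bdry f \<zeta>"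
  using AE_radial_limit[OF assms] by eventually_elim (rule filterlim_compose[OF _ radius_seq(4)])

text \<open>The radii of the sequence are rational, so \<open>rmax\<close> bounds all these dilates
  at once. This is the integrable majorant for passing to the boundary by dominated
  convergence.\<close>

lemma rmax_dominates:
  assumes f: "f \<in> H2"
  shows "integrable circle (\<lambda>\<zeta>. enn2real (rmax f \<zeta>))"
    and "AE \<zeta> in circle. \<forall>n. (norm (f (of_real (radius_seq n) * \<zeta>)))\<^sup>2 \<le> enn2real (rmax f \<zeta>)"
proof -
  have [measurable]: "rmax f \<in> borel_measurable borel" by (rule rmax_measurable[OF H2_hol[OF f]])
  have fin: "(\<integral>\<^sup>+\<zeta>. rmax f \<zeta> \<partial>circle) < \<infinity>"
    using nn_integral_rmax_le[OF f] by (rule le_less_trans) simp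
  show "integrable circle (\<lambda>\<zeta>. enn2real (rmax f \<zeta>))"
  proof (rule integrableI_bounded)
    have "(\<integral>\<^sup>+\<zeta>. ennreal (norm (enn2real (rmax f \<zeta>))) \<partial>circle) \<le> (\<integral>\<^sup>+\<zeta>. rmax f \<zeta> \<partial>circle)"
      by (intro nn_integral_mono) (simp add: ennreal_enn2real_if)
    with fin show "(\<integral>\<^sup>+\<zeta>. ennreal (norm (enn2real (rmax f \<zeta>))) \<partial>circle) < \<infinity>" by simp
  qed simp
  have "AE \<zeta> in circle. rmax f \<zeta> \<noteq> \<infinity>"
    by (rule nn_integral_PInf_AE) (use fin in auto)
  then show "AE \<zeta> in circle. \<forall>n. (norm (f (of_real (radius_seq n) * \<zeta>)))\<^sup>2 \<le> enn2real (rmax f \<zeta>)"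
  proof eventually_elim
    case (elim \<zeta>)
    show ?case
    proof
      fix n
      obtain i where i: "radius_seq n = rat_radius i" using radius_seq(5) by blast
      have "ennreal ((norm (f (of_real (radius_seq n) * \<zeta>)))\<^sup>2) \<le> ennreal (enn2real (rmax f \<zeta>))"
        using rmax_upper[of f i \<zeta>] elim by (simp add: i ennreal_enn2real_if)
      then show "(norm (f (of_real (radius_seq n) * \<zeta>)))\<^sup>2 \<le> enn2real (rmax f \<zeta>)"
        by (simp add: ennreal_le_iff)
    qed
  qed
qed

lemma bdry_L2:
  assumes f: "f \<in> H2"
  shows "bdry f \<in> L2_circle"
proof -
  have [measurable]: "bdry f \<in> borel_measurable borel" by (rule bdry_measurable[OF H2_hol[OF f]])
  have "integrable circle (\<lambda>\<zeta>. (norm (bdry f \<zeta>))\<^sup>2)"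
  proof (rule Bochner_Integration.integrable_bound[OF rmax_dominates(1)[OF f]])
    show "AE \<zeta> in circle. norm ((norm (bdry f \<zeta>))\<^sup>2) \<le> norm (enn2real (rmax f \<zeta>))"
      using rmax_dominates(2)[OF f] AE_bdry_seq[OF f]
    proof eventually_elim
      case (elim \<zeta>)
      have "(\<lambda>n. (norm (f (of_real (radius_seq n) * \<zeta>)))\<^sup>2) \<longlonglongrightarrow> (norm (bdry f \<zeta>))\<^sup>2"
        by (intro tendsto_intros elim(2))
      then have "(norm (bdry f \<zeta>))\<^sup>2 \<le> enn2real (rmax f \<zeta>)"
        by (rule LIMSEQ_le_const2) (use elim(1) in auto)
      then show ?case by simp
    qed
  qed simp
  then show ?thesis by (simp add: L2_circle_def)
qed

lemma bdry_weak_limit: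
  assumes f: "f \<in> H2" and v: "v \<in> L2_circle"
  shows "(\<lambda>n. LINT \<zeta>|circle. f (of_real (radius_seq n) * \<zeta>) * v \<zeta>) \<longlonglongrightarrow> (LINT \<zeta>|circle. bdry f \<zeta> * v \<zeta>)"
proof (rule integral_dominated_convergence)
  have [measurable]: "f \<in> borel_measurable borel" "bdry f \<in> borel_measurable borel" "v \<in> borel_measurable borel"
    using bdry_measurable hol_disc_measurable H2_hol[OF f] L2_circle_measurable[OF v] by auto
  show "(\<lambda>\<zeta>. bdry f \<zeta> * v \<zeta>) \<in> borel_measurable circle" by measurable
  show "(\<lambda>\<zeta>. f (of_real (radius_seq n) * \<zeta>) * v \<zeta>) \<in> borel_measurable circle" for n by measurable
  show "integrable circle (\<lambda>\<zeta>. enn2real (rmax f \<zeta>) + (norm (v \<zeta>))\<^sup>2)"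
    using rmax_dominates(1)[OF f] v by (simp add: L2_circle_def)
  show "AE \<zeta> in circle. (\<lambda>n. f (of_real (radius_seq n) * \<zeta>) * v \<zeta>) \<longlonglongrightarrow> bdry f \<zeta> * v \<zeta>"
    using AE_bdry_seq[OF f] by eventually_elim (intro tendsto_intros)
  fix n
  show "AE \<zeta> in circle. norm (f (of_real (radius_seq n) * \<zeta>) * v \<zeta>) \<le> enn2real (rmax f \<zeta>) + (norm (v \<zeta>))\<^sup>2"
    using rmax_dominates(2)[OF f]
  proof eventually_elim
    case (elim \<zeta>)
    then show ?case using norm_mult_le_squares[of "f (of_real (radius_seq n) * \<zeta>)" "v \<zeta>"] by (auto dest: spec[of _ n])
  qed
qed

lemma fourier_bdry:
  assumes f: "f \<in> H2"
  shows "fourier (bdry f) n = coef f n"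
proof (rule LIMSEQ_unique)
  show "(\<lambda>k. fourier (\<lambda>\<zeta>. f (of_real (radius_seq k) * \<zeta>)) n) \<longlonglongrightarrow> fourier (bdry f) n"
    unfolding fourier_def by (rule bdry_weak_limit[OF f])
      (use L2_circle_cnj[OF L2_circle_power[of n]] in simp)
  have "fourier (\<lambda>\<zeta>. f (of_real (radius_seq k) * \<zeta>)) n = coef f n * of_real (radius_seq k) ^ n" for k
    using coef_sums[OF H2_hol[OF f]] hol_disc_measurable[OF H2_hol[OF f]] radius_seq by (intro fourier_dilate) auto
  moreover have "(\<lambda>k. coef f n * of_real (radius_seq k) ^ n) \<longlonglongrightarrow> coef f n * of_real 1 ^ n"
    by (intro tendsto_intros radius_seq)
  ultimately show "(\<lambda>k. fourier (\<lambda>\<zeta>. f (of_real (radius_seq k) * \<zeta>)) n) \<longlonglongrightarrow> coef f n" by simp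
qed

lemma bdry_mean:
  assumes f: "f \<in> H2"
  shows "(LINT \<zeta>|circle. bdry f \<zeta> * \<zeta> ^ n) = (if n = 0 then coef f 0 else 0)"
proof (rule LIMSEQ_unique)
  show "(\<lambda>k. LINT \<zeta>|circle. f (of_real (radius_seq k) * \<zeta>) * \<zeta> ^ n) \<longlonglongrightarrow> (LINT \<zeta>|circle. bdry f \<zeta> * \<zeta> ^ n)"
    by (rule bdry_weak_limit[OF f L2_circle_power])
  show "(\<lambda>k. LINT \<zeta>|circle. f (of_real (radius_seq k) * \<zeta>) * \<zeta> ^ n) \<longlonglongrightarrow> (if n = 0 then coef f 0 else 0)"
    unfolding dilate_mean[OF H2_hol[OF f] radius_seq(1,2)] by (rule tendsto_const)
qed

text \<open>Only \<open>f\<close> is dilated. As the radius tends to 1, the integrals converge by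
  \<open>bdry_weak_limit\<close> and the series by Tannery's theorem, with the absolutely summable
  products as majorant.\<close>

lemma L2_inner_bdry:
  assumes u: "u \<in> L2_circle" and f: "f \<in> H2"
  shows "(\<lambda>n. fourier u n * cnj (coef f n)) sums L2_inner u (bdry f)"
proof -
  note fh = H2_hol[OF f]
  have a: "(\<lambda>n. coef f n * cnj (fourier u n) * of_real r ^ n) sums (LINT \<zeta>|circle. f (of_real r * \<zeta>) * cnj (u \<zeta>))"
    if r: "0 \<le> r" "r < 1" for r
  proof -
    have "(\<lambda>n. coef f n * (LINT \<zeta>|circle. (of_real r * \<zeta>) ^ n * cnj (u \<zeta>))) sums (LINT \<zeta>|circle. f (of_real r * \<zeta>) * cnj (u \<zeta>))"
      by (rule power_series_circle_integral[OF coef_sums[OF fh] hol_disc_measurable[OF fh], of "\<lambda>_. r" r])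
        (use r L2_circle_integrable[OF L2_circle_cnj[OF u]] in auto)
    moreover have "(LINT \<zeta>|circle. (of_real r * \<zeta>) ^ n * cnj (u \<zeta>)) = cnj (fourier u n) * of_real r ^ n" for n
      unfolding fourier_def Bochner_Integration.integral_cnj[symmetric] power_mult_distrib mult.assoc
      by (simp add: mult.commute)
    ultimately show ?thesis by (simp add: mult.assoc)
  qed
  have s: "summable (\<lambda>n. norm (coef f n * cnj (fourier u n)))"
    by (rule square_summable_imp_inner) (use H2_summable[OF f] bessel_summable(1)[OF u] in auto)
  have "(\<lambda>k. \<Sum>n. coef f n * cnj (fourier u n) * of_real (radius_seq k) ^ n) \<longlonglongrightarrow> (\<Sum>n. coef f n * cnj (fourier u n))"
  proof (rule conjunct2[OF conjunct2[OF tannerys_theorem[OF _ _ s]]])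
    fix n
    have "(\<lambda>k. coef f n * cnj (fourier u n) * of_real (radius_seq k) ^ n) \<longlonglongrightarrow> coef f n * cnj (fourier u n) * of_real 1 ^ n"
      by (intro tendsto_intros radius_seq)
    then show "(\<lambda>k. coef f n * cnj (fourier u n) * of_real (radius_seq k) ^ n) \<longlonglongrightarrow> coef f n * cnj (fourier u n)"
      by simp
  next
    have "norm (coef f n * cnj (fourier u n) * of_real (radius_seq k) ^ n) \<le> norm (coef f n * cnj (fourier u n))" for n k
      using power_le_one[of "radius_seq k" n] radius_seq(1,2)[of k]
      by (simp add: norm_mult norm_power mult_left_le)
    then show "\<forall>\<^sub>F (n, k) in sequentially \<times>\<^sub>F sequentially.
        norm (coef f n * cnj (fourier u n) * of_real (radius_seq k) ^ n) \<le> norm (coef f n * cnj (fourier u n))"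
      by (intro always_eventually) auto
  qed simp
  then have "(\<lambda>k. LINT \<zeta>|circle. f (of_real (radius_seq k) * \<zeta>) * cnj (u \<zeta>)) \<longlonglongrightarrow> (\<Sum>n. coef f n * cnj (fourier u n))"
    using a[OF radius_seq(1,2)] by (simp add: sums_iff)
  with bdry_weak_limit[OF f L2_circle_cnj[OF u]]
  have "(LINT \<zeta>|circle. bdry f \<zeta> * cnj (u \<zeta>)) = (\<Sum>n. coef f n * cnj (fourier u n))"
    by (rule LIMSEQ_unique)
  then have "(\<lambda>n. coef f n * cnj (fourier u n)) sums (LINT \<zeta>|circle. bdry f \<zeta> * cnj (u \<zeta>))"
    using summable_norm_cancel[OF s] by (simp add: sums_iff)
  then have "(\<lambda>n. cnj (coef f n * cnj (fourier u n))) sums cnj (LINT \<zeta>|circle. bdry f \<zeta> * cnj (u \<zeta>))"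
    by (simp only: sums_cnj)
  then show ?thesis
    unfolding L2_inner_def Bochner_Integration.integral_cnj[symmetric] by (simp add: mult.commute)
qed

section \<open>Toeplitz operators and uniqueness of Fourier coefficients\<close>

lemma cauchy_formula_bdry:
  assumes f: "f \<in> H2" and z: "norm z < 1"
  shows "f z = (LINT \<zeta>|circle. bdry f \<zeta> / (1 - z * cnj \<zeta>))"
proof -
  have "(\<lambda>n. fourier (bdry f) n * z ^ n) sums (LINT \<zeta>|circle. bdry f \<zeta> / (1 - z * cnj \<zeta>))"
    by (rule cauchy_transform[OF L2_circle_integrable[OF bdry_L2[OF f]] z])
  then have "(\<lambda>n. coef f n * z ^ n) sums (LINT \<zeta>|circle. bdry f \<zeta> / (1 - z * cnj \<zeta>))"
    unfolding fourier_bdry[OF f] .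
  with coef_sums[OF H2_hol[OF f] z] show ?thesis by (rule sums_unique2)
qed

text \<open>By \<open>L2_inner_bdry\<close>, a function orthogonal to all of \<open>H2\<close> is
  one whose coefficients of index \<open>n \<ge> 0\<close> vanish. This settles both existence and
  uniqueness in the definite description.\<close>

lemma P_plus_eq:
  assumes u: "u \<in> L2_circle"
  shows "P_plus u = of_coef (fourier u)"
  unfolding P_plus_def
proof (rule the_equality)
  have fourier_minus: "fourier (\<lambda>\<zeta>. u \<zeta> - bdry F \<zeta>) n = fourier u n - coef F n" if "F \<in> H2" for F n
    using fourier_diff[OF L2_circle_integrable[OF u] L2_circle_integrable[OF bdry_L2[OF that]]]
    by (simp add: fourier_bdry[OF that])
  have F: "of_coef (fourier u) \<in> H2" "coef (of_coef (fourier u)) = fourier u"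
    using of_coef_H2[OF bessel_summable(1)[OF u]] by auto
  have "L2_inner (\<lambda>\<zeta>. u \<zeta> - bdry (of_coef (fourier u)) \<zeta>) (bdry G) = 0" if G: "G \<in> H2" for G
    using L2_inner_bdry[OF L2_circle_diff[OF u bdry_L2[OF F(1)]] G]
    by (simp add: fourier_minus[OF F(1)] F(2) sums_iff)
  with F show "of_coef (fourier u) \<in> H2 \<and>
      (\<forall>G\<in>H2. L2_inner (\<lambda>\<zeta>. u \<zeta> - bdry (of_coef (fourier u)) \<zeta>) (bdry G) = 0)" by blast
  fix F' assume F': "F' \<in> H2 \<and> (\<forall>G\<in>H2. L2_inner (\<lambda>\<zeta>. u \<zeta> - bdry F' \<zeta>) (bdry G) = 0)"
  show "F' = of_coef (fourier u)"
  proof (rule hol_disc_coef_eqI)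
    show "coef F' = coef (of_coef (fourier u))"
    proof
      fix n
      \<comment> \<open>Coefficients of the monomial \<open>z ^ n\<close>, the test function that
        isolates a single coefficient.\<close>
      define e :: "nat \<Rightarrow> complex" where "e m = (if m = n then 1 else 0)" for m
      have es: "summable (\<lambda>m. (norm (e m))\<^sup>2)"
        by (rule summable_finite[of "{n}"]) (auto simp: e_def)
      note G = of_coef_H2[OF es]
      have "(\<lambda>m. fourier (\<lambda>\<zeta>. u \<zeta> - bdry F' \<zeta>) m * cnj (e m)) sums L2_inner (\<lambda>\<zeta>. u \<zeta> - bdry F' \<zeta>) (bdry (of_coef e))"
        using L2_inner_bdry[OF L2_circle_diff[OF u bdry_L2] G(1)] F' by (simp only: G(2))
      moreover have "fourier (\<lambda>\<zeta>. u \<zeta> - bdry F' \<zeta>) m * cnj (e m) =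
          (if m = n then fourier (\<lambda>\<zeta>. u \<zeta> - bdry F' \<zeta>) m else 0)" for m by (simp add: e_def)
      ultimately have "(\<lambda>m. if m = n then fourier (\<lambda>\<zeta>. u \<zeta> - bdry F' \<zeta>) m else 0) sums 0"
        using F' G(1) by simp
      then have "fourier (\<lambda>\<zeta>. u \<zeta> - bdry F' \<zeta>) n = 0"
        using sums_single[of n "fourier (\<lambda>\<zeta>. u \<zeta> - bdry F' \<zeta>)"] sums_unique2 by blast
      then show "coef F' n = coef (of_coef (fourier u)) n"
        using fourier_minus F' by (simp add: F(2))
    qed
  qed (use F F' H2_hol in auto)
qed

section \<open>Algebra of boundary values and coefficients of Toeplitz operators\<close>

lemma radial_tendsto_imp_bdry:
  assumes "((\<lambda>r::real. f (of_real r * \<zeta>)) \<longlongrightarrow> l) (at_left 1)"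
  shows "bdry f \<zeta> = l"
  using assms by (simp add: bdry_def tendsto_Lim)

lemma bdry_mult:
  assumes "f \<in> H2" "g \<in> H2"
  shows "AE \<zeta> in circle. bdry (\<lambda>z. f z * g z) \<zeta> = bdry f \<zeta> * bdry g \<zeta>"
  using AE_radial_limit[OF assms(1)] AE_radial_limit[OF assms(2)]
  by eventually_elim (intro radial_tendsto_imp_bdry tendsto_mult)

lemma bdry_add:
  assumes "f \<in> H2" "g \<in> H2"
  shows "AE \<zeta> in circle. bdry (\<lambda>z. f z + g z) \<zeta> = bdry f \<zeta> + bdry g \<zeta>"
  using AE_radial_limit[OF assms(1)] AE_radial_limit[OF assms(2)]
  by eventually_elim (intro radial_tendsto_imp_bdry tendsto_add)

lemma bdry_scale:
  assumes "f \<in> H2"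
  shows "AE \<zeta> in circle. bdry (\<lambda>z. c * f z) \<zeta> = c * bdry f \<zeta>"
  using AE_radial_limit[OF assms]
  by eventually_elim (intro radial_tendsto_imp_bdry tendsto_mult tendsto_const)

lemma Hinf_H2:
  assumes p: "p \<in> Hinf"
  shows "p \<in> H2"
proof -
  have h: "p \<in> hol_disc" using p by (simp add: Hinf_def)
  obtain B where B: "\<forall>z\<in>disc. norm (p z) \<le> B" using p by (auto simp: Hinf_def bounded_iff)
  show ?thesis
  proof (rule H2I[OF h])
    fix r :: real assume r: "0 \<le> r" "r < 1"
    have "(LINT \<zeta>|circle. (norm (p (of_real r * \<zeta>)))\<^sup>2) \<le> (LINT \<zeta>|circle. B\<^sup>2)"
    proof (rule integral_mono_AE)
      show "integrable circle (\<lambda>\<zeta>. (norm (p (of_real r * \<zeta>)))\<^sup>2)"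
        using L2_circle_dilate[OF h r] by (simp add: L2_circle_def)
      show "AE \<zeta> in circle. (norm (p (of_real r * \<zeta>)))\<^sup>2 \<le> B\<^sup>2"
        using r by (intro AE_circleI power_mono B[rule_format]) (auto simp: norm_mult)
    qed simp
    then show "(LINT \<zeta>|circle. (norm (p (of_real r * \<zeta>)))\<^sup>2) \<le> B\<^sup>2" by simp
  qed
qed

lemma AE_bdry_le:
  assumes p: "p \<in> H2" and B: "\<And>z. z \<in> disc \<Longrightarrow> norm (p z) \<le> B"
  shows "AE \<zeta> in circle. norm (bdry p \<zeta>) \<le> B"
  using AE_bdry_seq[OF p] AE_circle_norm
proof eventually_elim
  case (elim \<zeta>)
  have "(\<lambda>n. norm (p (of_real (radius_seq n) * \<zeta>))) \<longlonglongrightarrow> norm (bdry p \<zeta>)"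
    by (intro tendsto_norm elim)
  moreover have "norm (p (of_real (radius_seq n) * \<zeta>)) \<le> B" for n
    using radius_seq(1,2)[of n] elim(2) by (intro B) (simp add: norm_mult)
  ultimately show ?case by (intro LIMSEQ_le_const2) auto
qed

lemma bdry_Hinf_bounded:
  assumes p: "p \<in> Hinf"
  obtains B where "AE \<zeta> in circle. norm (bdry p \<zeta>) \<le> B"
proof -
  obtain B where "\<forall>z\<in>disc. norm (p z) \<le> B" using p by (auto simp: Hinf_def bounded_iff)
  then show thesis using AE_bdry_le[OF Hinf_H2[OF p]] that by blast
qed

lemma L2_circle_cnj_bdry_mult:
  assumes p: "p \<in> Hinf" and u: "u \<in> L2_circle"
  shows "(\<lambda>\<zeta>. cnj (bdry p \<zeta>) * u \<zeta>) \<in> L2_circle"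
proof -
  obtain B where B: "AE \<zeta> in circle. norm (bdry p \<zeta>) \<le> B" by (rule bdry_Hinf_bounded[OF p])
  have [measurable]: "bdry p \<in> borel_measurable borel" "u \<in> borel_measurable borel"
    using bdry_measurable p u by (auto simp: Hinf_def L2_circle_def)
  show ?thesis
  proof (rule L2_circle_dominated[OF u])
    show "AE \<zeta> in circle. norm (cnj (bdry p \<zeta>) * u \<zeta>) \<le> B * norm (u \<zeta>)"
      using B by eventually_elim (simp add: norm_mult mult_right_mono)
  qed measurable
qed

text \<open>Taylor coefficients of the Toeplitz operator with symbol \<open>cnj (bdry p)\<close>,
  taken directly as integrals so that the definite description in \<open>P_plus\<close> is
  bypassed.\<close>

definition toeplitz_coef :: "(complex \<Rightarrow> complex) \<Rightarrow> (complex \<Rightarrow> complex) \<Rightarrow> nat \<Rightarrow> complex" where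
  "toeplitz_coef p f = fourier (\<lambda>\<zeta>. cnj (bdry p \<zeta>) * bdry f \<zeta>)"

lemma toeplitz_cnj_eq_iff:
  assumes "p \<in> Hinf" "f \<in> H2" "q \<in> Hinf" "h \<in> H2"
  shows "toeplitz (\<lambda>\<zeta>. cnj (bdry p \<zeta>)) f = toeplitz (\<lambda>\<zeta>. cnj (bdry q \<zeta>)) h \<longleftrightarrow>
    toeplitz_coef p f = toeplitz_coef q h"
proof -
  have t: "toeplitz (\<lambda>\<zeta>. cnj (bdry p \<zeta>)) f = of_coef (toeplitz_coef p f)"
    "coef (of_coef (toeplitz_coef p f)) = toeplitz_coef p f" if "p \<in> Hinf" "f \<in> H2" for p f
    unfolding toeplitz_def toeplitz_coef_def using that
    by (auto intro!: P_plus_eq of_coef_H2(2) bessel_summable L2_circle_cnj_bdry_mult bdry_L2)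
  show ?thesis
    unfolding t(1)[OF assms(1,2)] t(1)[OF assms(3,4)] using t(2)[OF assms(1,2)] t(2)[OF assms(3,4)] by metis
qed

lemma szego_Hinf:
  assumes w: "w \<in> disc"
  shows "szego w \<in> Hinf"
proof -
  have nz: "1 - norm w \<le> norm (1 - cnj w * z)" if "z \<in> disc" for z
  proof -
    have "norm (cnj w * z) \<le> norm w * 1" unfolding norm_mult using that by (intro mult_mono) auto
    then show ?thesis using norm_triangle_ineq2[of 1 "cnj w * z"] by simp
  qed
  have p: "0 < 1 - norm w" using w by simp
  have "(\<lambda>z. 1 / (1 - cnj w * z)) holomorphic_on disc"
    using nz p by (intro holomorphic_intros) fastforce
  then have "szego w holomorphic_on disc"
    by (rule holomorphic_transform) (simp add: szego_def)
  moreover have "norm (szego w z) \<le> 1 / (1 - norm w)" if "z \<in> disc" for z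
    using nz[OF that] p that by (simp add: szego_def norm_divide frac_le)
  ultimately show ?thesis
    unfolding Hinf_def hol_disc_def bounded_iff by (auto simp: szego_def[of w _] intro!: exI[of _ "1 / (1 - norm w)"])
qed

lemma bdry_szego:
  assumes w: "w \<in> disc"
  shows "AE \<zeta> in circle. bdry (szego w) \<zeta> = 1 / (1 - cnj w * \<zeta>)"
proof (rule AE_circleI)
  fix \<zeta> :: complex assume n: "norm \<zeta> = 1"
  have "norm (cnj w * \<zeta>) < 1" using w n by (simp add: norm_mult)
  then have nz: "1 - cnj w * \<zeta> \<noteq> 0" by auto
  have "((\<lambda>r::real. 1 / (1 - cnj w * (of_real r * \<zeta>))) \<longlongrightarrow> 1 / (1 - cnj w * (of_real 1 * \<zeta>))) (at_left 1)"
    using nz by (intro tendsto_intros) auto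
  moreover have "\<forall>\<^sub>F r in at_left 1. szego w (of_real r * \<zeta>) = 1 / (1 - cnj w * (of_real r * \<zeta>))"
    using eventually_at_left_real[of 0 1] n
    by (auto elim!: eventually_mono simp: szego_def norm_mult)
  ultimately have "((\<lambda>r::real. szego w (of_real r * \<zeta>)) \<longlongrightarrow> 1 / (1 - cnj w * (of_real 1 * \<zeta>))) (at_left 1)"
    using tendsto_cong by fastforce
  then show "bdry (szego w) \<zeta> = 1 / (1 - cnj w * \<zeta>)" using radial_tendsto_imp_bdry by simp
qed

lemma H2_mult_power:
  assumes f: "f \<in> H2"
  shows "(\<lambda>z. z ^ n * f z) \<in> H2" and "AE \<zeta> in circle. bdry (\<lambda>z. z ^ n * f z) \<zeta> = \<zeta> ^ n * bdry f \<zeta>"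
proof -
  \<comment> \<open>The monomial is cut off outside the disc, as \<open>hol_disc\<close> demands;
    \<open>f\<close> vanishes there, so the product is unchanged.\<close>
  define m where "m z = (if z \<in> disc then z ^ n else 0 :: complex)" for z
  have "m holomorphic_on disc"
    by (rule holomorphic_transform[of "\<lambda>z. z ^ n"]) (auto simp: m_def intro: holomorphic_intros)
  moreover have "norm (m z) \<le> 1" for z by (auto simp: m_def norm_power power_le_one)
  moreover have "m z = 0" if "z \<notin> disc" for z using that by (simp add: m_def)
  ultimately have "m \<in> Hinf" unfolding Hinf_def hol_disc_def bounded_iff by blast
  from Hinf_mult_H2[OF this f] have "(\<lambda>z. m z * f z) \<in> H2" .
  also have "(\<lambda>z. m z * f z) = (\<lambda>z. z ^ n * f z)" using H2_hol[OF f] by (auto simp: m_def hol_disc_def)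
  finally show "(\<lambda>z. z ^ n * f z) \<in> H2" .
  show "AE \<zeta> in circle. bdry (\<lambda>z. z ^ n * f z) \<zeta> = \<zeta> ^ n * bdry f \<zeta>"
    using AE_radial_limit[OF f]
  proof eventually_elim
    case (elim \<zeta>)
    have "((\<lambda>r::real. (of_real r * \<zeta>) ^ n * f (of_real r * \<zeta>)) \<longlongrightarrow> (of_real 1 * \<zeta>) ^ n * bdry f \<zeta>) (at_left 1)"
      by (intro tendsto_intros elim)
    then show ?case by (intro radial_tendsto_imp_bdry) simp
  qed
qed

text \<open>Uniqueness of Fourier coefficients: the functions all of whose coefficients vanish are
  stable under multiplication by real polynomials, which are dense in the continuous functions.\<close>

definition null_coefficients :: "(complex \<Rightarrow> complex) set" where
  "null_coefficients = {u. integrable circle u \<and> (\<forall>n. fourier u n = 0) \<and> (\<forall>n. (LINT \<zeta>|circle. u \<zeta> * \<zeta> ^ n) = 0)}"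

lemma integrable_mult_power:
  assumes "integrable circle u"
  shows "integrable circle (\<lambda>\<zeta>. u \<zeta> * \<zeta> ^ n)"
proof (rule Bochner_Integration.integrable_bound[OF assms])
  show "(\<lambda>\<zeta>. u \<zeta> * \<zeta> ^ n) \<in> borel_measurable circle"
    using borel_measurable_integrable[OF assms] by measurable
qed (auto intro!: AE_circleI simp: norm_mult norm_power)

lemma null_coefficients_add:
  "u \<in> null_coefficients \<Longrightarrow> v \<in> null_coefficients \<Longrightarrow> (\<lambda>\<zeta>. u \<zeta> + v \<zeta>) \<in> null_coefficients"
  by (simp add: null_coefficients_def fourier_add distrib_right integrable_mult_power)

lemma null_coefficients_scale:
  "u \<in> null_coefficients \<Longrightarrow> (\<lambda>\<zeta>. c * u \<zeta>) \<in> null_coefficients"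
  by (simp add: null_coefficients_def fourier_scale mult.assoc)

text \<open>Each factor shifts the two-sided coefficient sequence by one place. The case
  \<open>n = 0\<close> is the index that passes from one of the two one-sided families to the
  other.\<close>

lemma null_coefficients_shift:
  assumes u: "u \<in> null_coefficients"
  shows "(\<lambda>\<zeta>. u \<zeta> * \<zeta>) \<in> null_coefficients" and "(\<lambda>\<zeta>. u \<zeta> * cnj \<zeta>) \<in> null_coefficients"
proof -
  have ui: "integrable circle u" and f: "fourier u n = 0" and p: "(LINT \<zeta>|circle. u \<zeta> * \<zeta> ^ n) = 0" for n
    using u by (auto simp: null_coefficients_def)
  have [measurable]: "u \<in> borel_measurable borel" using borel_measurable_integrable[OF ui] by simp
  have "fourier (\<lambda>\<zeta>. u \<zeta> * \<zeta>) n = 0" for n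
  proof (cases n)
    case 0 then show ?thesis using p[of 1] by (simp add: fourier_def)
  next
    case (Suc m)
    have "fourier (\<lambda>\<zeta>. u \<zeta> * \<zeta>) n = fourier u m"
      unfolding fourier_def Suc
      by (rule integral_circle_cong) (auto simp: mult.assoc circle_cancel mult.left_commute[of _ "cnj z" for z])
    then show ?thesis using f by simp
  qed
  moreover have "(LINT \<zeta>|circle. u \<zeta> * \<zeta> * \<zeta> ^ n) = 0" for n
    using p[of "Suc n"] by (simp add: mult.assoc)
  ultimately show "(\<lambda>\<zeta>. u \<zeta> * \<zeta>) \<in> null_coefficients"
    using integrable_mult_power[OF ui, of 1] by (simp add: null_coefficients_def)
  have "(LINT \<zeta>|circle. u \<zeta> * cnj \<zeta> * \<zeta> ^ n) = 0" for n
  proof (cases n)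
    case 0 then show ?thesis using f[of 1] by (simp add: fourier_def)
  next
    case (Suc m)
    have "(LINT \<zeta>|circle. u \<zeta> * cnj \<zeta> * \<zeta> ^ n) = (LINT \<zeta>|circle. u \<zeta> * \<zeta> ^ m)"
      unfolding Suc
    proof (rule integral_circle_cong)
      fix \<zeta> :: complex assume "norm \<zeta> = 1"
      then have "u \<zeta> * cnj \<zeta> * \<zeta> ^ Suc m = u \<zeta> * (cnj \<zeta> * \<zeta>) * \<zeta> ^ m" by (simp add: mult.assoc)
      then show "u \<zeta> * cnj \<zeta> * \<zeta> ^ Suc m = u \<zeta> * \<zeta> ^ m" by (simp only: circle_cancel[OF \<open>norm \<zeta> = 1\<close>] mult_1_right)
    qed measurable
    then show ?thesis using p by simp
  qed
  moreover have "fourier (\<lambda>\<zeta>. u \<zeta> * cnj \<zeta>) n = 0" for n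
    using f[of "Suc n"] by (simp add: fourier_def mult.assoc)
  ultimately show "(\<lambda>\<zeta>. u \<zeta> * cnj \<zeta>) \<in> null_coefficients"
    using integrable_mult_power_cnj[OF ui, of 1] by (simp add: null_coefficients_def)
qed

lemma null_coefficients_polynomial:
  assumes "real_polynomial_function p" "u \<in> null_coefficients"
  shows "(\<lambda>\<zeta>. u \<zeta> * of_real (p \<zeta>)) \<in> null_coefficients"
  using assms
proof (induction arbitrary: u rule: real_polynomial_function.induct)
  case (linear f)
  \<comment> \<open>A real-linear functional on the plane has the form
    \<open>\<alpha> * z + \<beta> * cnj z\<close>, so linear polynomials act through the two
    shifts.\<close>
  define \<alpha> where "\<alpha> = Complex (f 1 / 2) (- (f \<i> / 2))"
  define \<beta> where "\<beta> = Complex (f 1 / 2) (f \<i> / 2)"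
  have fz: "f z = Re z * f 1 + Im z * f \<i>" for z
  proof -
    have "z = Re z *\<^sub>R 1 + Im z *\<^sub>R \<i>" by (simp add: complex_eq_iff)
    then have "f z = f (Re z *\<^sub>R 1 + Im z *\<^sub>R \<i>)" by simp
    also have "\<dots> = Re z * f 1 + Im z * f \<i>"
      using linear(1) by (simp add: linear_add linear_scale bounded_linear.linear del: scaleR_conv_of_real)
    finally show ?thesis .
  qed
  have "of_real (f z) = \<alpha> * z + \<beta> * cnj z" for z
    unfolding fz[of z] by (rule complex_eqI) (simp_all add: \<alpha>_def \<beta>_def mult.commute)
  then have "(\<lambda>\<zeta>. u \<zeta> * of_real (f \<zeta>)) = (\<lambda>\<zeta>. \<alpha> * (u \<zeta> * \<zeta>) + \<beta> * (u \<zeta> * cnj \<zeta>))"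
    by (simp add: algebra_simps)
  then show ?case
    using linear(2) by (simp add: null_coefficients_add null_coefficients_scale null_coefficients_shift)
next
  case (const c)
  then show ?case using null_coefficients_scale[of u "of_real c"] by (simp add: mult.commute)
next
  case (add f g)
  then show ?case using null_coefficients_add[OF add.IH[OF add.prems]] by (simp add: distrib_left)
next
  case (mult f g)
  from mult.IH(2)[OF mult.IH(1)[OF mult.prems]] show ?case by (simp add: mult.assoc)
qed

text \<open>Stone-Weierstrass on the circle: replacing \<open>\<phi>\<close> by a polynomial within
  \<open>e\<close> changes the integral by at most \<open>e\<close> times the integral of
  \<open>norm (u \<zeta>)\<close>.\<close>

lemma null_coefficients_continuous:
  assumes u: "u \<in> null_coefficients" and \<phi>: "continuous_on UNIV (\<phi> :: complex \<Rightarrow> real)"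
  shows "(LINT \<zeta>|circle. u \<zeta> * of_real (\<phi> \<zeta>)) = 0"
proof -
  have ui: "integrable circle u" using u by (simp add: null_coefficients_def)
  have [measurable]: "u \<in> borel_measurable borel" using borel_measurable_integrable[OF ui] by simp
  have [measurable]: "\<phi> \<in> borel_measurable borel" by (rule borel_measurable_continuous_onI[OF \<phi>])
  define C where "C = (LINT \<zeta>|circle. norm (u \<zeta>))"
  have "norm (LINT \<zeta>|circle. u \<zeta> * of_real (\<phi> \<zeta>)) \<le> e * C" if e: "0 < e" for e
  proof -
    obtain p where p: "real_polynomial_function p" "\<And>x. x \<in> sphere (0::complex) 1 \<Longrightarrow> \<bar>\<phi> x - p x\<bar> < e"
      using Stone_Weierstrass_real_polynomial_function[of "sphere (0::complex) 1" \<phi> e] e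
        continuous_on_subset[OF \<phi>] by auto
    have [measurable]: "p \<in> borel_measurable borel"
      using continuous_real_polymonial_function[OF p(1)]
      by (intro borel_measurable_continuous_onI continuous_at_imp_continuous_on) auto
    have up: "(\<lambda>\<zeta>. u \<zeta> * of_real (p \<zeta>)) \<in> null_coefficients" by (rule null_coefficients_polynomial[OF p(1) u])
    then have i1: "integrable circle (\<lambda>\<zeta>. u \<zeta> * of_real (p \<zeta>))" and
      z: "(LINT \<zeta>|circle. u \<zeta> * of_real (p \<zeta>)) = 0"
      by (auto simp: null_coefficients_def dest: spec[of _ 0])
    have b: "norm (u \<zeta> * of_real (\<phi> \<zeta> - p \<zeta>)) \<le> norm (u \<zeta>) * e" if "norm \<zeta> = 1" for \<zeta>
      using p(2)[of \<zeta>] that by (auto simp: norm_mult less_imp_le simp flip: of_real_diff intro!: mult_left_mono)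
    have i2: "integrable circle (\<lambda>\<zeta>. u \<zeta> * of_real (\<phi> \<zeta> - p \<zeta>))"
    proof (rule Bochner_Integration.integrable_bound)
      show "integrable circle (\<lambda>\<zeta>. norm (u \<zeta>) * e)" using ui by simp
      show "AE \<zeta> in circle. norm (u \<zeta> * of_real (\<phi> \<zeta> - p \<zeta>)) \<le> norm (norm (u \<zeta>) * e)"
        using b e by (intro AE_circleI) auto
    qed measurable
    have "(LINT \<zeta>|circle. u \<zeta> * of_real (\<phi> \<zeta>)) = (LINT \<zeta>|circle. u \<zeta> * of_real (\<phi> \<zeta> - p \<zeta>) + u \<zeta> * of_real (p \<zeta>))"
      by (simp add: algebra_simps)
    also have "\<dots> = (LINT \<zeta>|circle. u \<zeta> * of_real (\<phi> \<zeta> - p \<zeta>))"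
      using Bochner_Integration.integral_add[OF i2 i1] z by simp
    finally have "norm (LINT \<zeta>|circle. u \<zeta> * of_real (\<phi> \<zeta>)) \<le> (LINT \<zeta>|circle. norm (u \<zeta> * of_real (\<phi> \<zeta> - p \<zeta>)))"
      by (simp only: integral_norm_bound)
    also have "\<dots> \<le> (LINT \<zeta>|circle. norm (u \<zeta>) * e)"
      by (rule integral_mono_AE) (use i2 ui b in \<open>auto intro!: AE_circleI\<close>)
    finally show ?thesis by (simp add: C_def mult.commute)
  qed
  then have "norm (LINT \<zeta>|circle. u \<zeta> * of_real (\<phi> \<zeta>)) \<le> 0"
    by (intro nonpos_if_le_epsilon_mult[of C]) (simp add: C_def)
  then show ?thesis by simp
qed

lemma null_coefficients_closed:
  assumes u: "u \<in> null_coefficients" and F: "closed F"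
  shows "(LINT \<zeta>:F|circle. u \<zeta>) = 0"
proof (cases "F = {}")
  case False
  have ui: "integrable circle u" using u by (simp add: null_coefficients_def)
  have [measurable]: "u \<in> borel_measurable borel" using borel_measurable_integrable[OF ui] by simp
  have [measurable]: "F \<in> sets borel" using F by simp
  \<comment> \<open>Continuous functions decreasing to the indicator of \<open>F\<close>; closedness
    makes the distance to \<open>F\<close> positive at every point outside.\<close>
  define \<phi> where "\<phi> n \<zeta> = max 0 (1 - real n * infdist \<zeta> F)" for n :: nat and \<zeta>
  have c: "continuous_on UNIV (\<phi> n)" for n unfolding \<phi>_def by (intro continuous_intros)
  have [measurable]: "\<phi> n \<in> borel_measurable borel" for n by (rule borel_measurable_continuous_onI[OF c])
  have \<phi>1: "\<bar>\<phi> n \<zeta>\<bar> \<le> 1" for n \<zeta> by (auto simp: \<phi>_def infdist_nonneg)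
  have lim: "(\<lambda>n. \<phi> n \<zeta>) \<longlonglongrightarrow> indicator F \<zeta>" for \<zeta>
  proof (cases "\<zeta> \<in> F")
    case True
    then show ?thesis by (simp add: \<phi>_def infdist_zero)
  next
    case nF: False
    then have p: "0 < infdist \<zeta> F" using F False in_closed_iff_infdist_zero[of F \<zeta>] infdist_nonneg[of \<zeta> F] by force
    obtain N :: nat where "1 / infdist \<zeta> F < real N" using reals_Archimedean2 by blast
    then have N: "1 < real N * infdist \<zeta> F" using p by (simp add: field_simps)
    have "\<phi> n \<zeta> = 0" if "n \<ge> N" for n
    proof -
      have "real N * infdist \<zeta> F \<le> real n * infdist \<zeta> F" using that p by (intro mult_right_mono) auto
      then show ?thesis using N by (simp add: \<phi>_def)
    qed
    then have "(\<lambda>n. \<phi> n \<zeta>) \<longlonglongrightarrow> 0" by (intro tendsto_eventually) (auto simp: eventually_sequentially)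
    then show ?thesis using nF by simp
  qed
  have "(\<lambda>n. LINT \<zeta>|circle. u \<zeta> * of_real (\<phi> n \<zeta>)) \<longlonglongrightarrow> (LINT \<zeta>|circle. indicator F \<zeta> *\<^sub>R u \<zeta>)"
  proof (rule integral_dominated_convergence[where w = "\<lambda>\<zeta>. norm (u \<zeta>)"])
    show "AE \<zeta> in circle. (\<lambda>n. u \<zeta> * of_real (\<phi> n \<zeta>)) \<longlonglongrightarrow> indicator F \<zeta> *\<^sub>R u \<zeta>"
    proof (rule AE_I2)
      fix \<zeta>
      have "(\<lambda>n. u \<zeta> * of_real (\<phi> n \<zeta>)) \<longlonglongrightarrow> u \<zeta> * of_real (indicator F \<zeta>)"
        by (intro tendsto_intros lim)
      then show "(\<lambda>n. u \<zeta> * of_real (\<phi> n \<zeta>)) \<longlonglongrightarrow> indicator F \<zeta> *\<^sub>R u \<zeta>"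
        by (simp add: scaleR_conv_of_real mult.commute)
    qed
    show "AE \<zeta> in circle. norm (u \<zeta> * of_real (\<phi> n \<zeta>)) \<le> norm (u \<zeta>)" for n
      using \<phi>1 by (intro AE_I2) (simp add: norm_mult mult_left_le)
  qed (use ui in auto)
  then show ?thesis
    unfolding set_lebesgue_integral_def null_coefficients_continuous[OF u c] by (simp add: LIMSEQ_const_iff)
qed (simp add: set_lebesgue_integral_def)

text \<open>Closed sets are an intersection-stable generator of the Borel sets, so vanishing
  integrals over closed sets extend to all Borel sets, where they determine the density.\<close>

lemma null_coefficients_AE:
  assumes u: "u \<in> null_coefficients"
  shows "AE \<zeta> in circle. u \<zeta> = 0"
proof -
  have ui: "integrable circle u" using u by (simp add: null_coefficients_def)
  have si: "set_integrable circle A u" if "A \<in> sets borel" for A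
    unfolding set_integrable_def by (rule integrable_mult_indicator) (use that ui in auto)
  have whole: "(LINT \<zeta>:UNIV|circle. u \<zeta>) = 0" by (rule null_coefficients_closed[OF u]) simp
  have "(LINT \<zeta>:A|circle. u \<zeta>) = 0" if "A \<in> sets borel" for A
  proof -
    have "Int_stable (Collect closed :: complex set set)" by (auto simp: Int_stable_def)
    moreover have "Collect closed \<subseteq> Pow (UNIV :: complex set)" by auto
    moreover have "A \<in> sigma_sets UNIV (Collect closed)"
      using that by (simp add: borel_eq_closed)
    ultimately show ?thesis
    proof (induction rule: sigma_sets_induct_disjoint)
      case (basic A) then show ?case using null_coefficients_closed[OF u] by simp
    next
      case empty show ?case by (simp add: set_lebesgue_integral_def)
    next
      case (compl A)
      then have A: "A \<in> sets borel" by (simp add: borel_eq_closed)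
      have "(LINT \<zeta>:A \<union> (UNIV - A)|circle. u \<zeta>) = (LINT \<zeta>:A|circle. u \<zeta>) + (LINT \<zeta>:UNIV - A|circle. u \<zeta>)"
        by (rule set_integral_Un) (use A si in auto)
      then show ?case using compl whole by simp
    next
      case (union A)
      then have A: "A i \<in> sets borel" for i by (auto simp: borel_eq_closed)
      have "(LINT \<zeta>:(\<Union>i. A i)|circle. u \<zeta>) = (\<Sum>i. (LINT \<zeta>:A i|circle. u \<zeta>))"
        by (rule lebesgue_integral_countable_add)
          (use A si union(1) in \<open>auto simp: disjoint_family_on_def\<close>)
      then show ?case using union(3) by simp
    qed
  qed
  then show ?thesis
    using circle.density_unique_banach[of u "\<lambda>_. 0"] ui by simp
qed

text \<open>Subtracting the boundary function of the analytic part leaves a function without any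
  coefficients: those of index \<open>n \<ge> 0\<close> cancel by construction, those of negative
  index are zero for both functions.\<close>

lemma L2_circle_eq_bdry:
  assumes u: "u \<in> L2_circle" and neg: "\<And>n. 0 < n \<Longrightarrow> (LINT \<zeta>|circle. u \<zeta> * \<zeta> ^ n) = 0"
  shows "AE \<zeta> in circle. u \<zeta> = bdry (of_coef (fourier u)) \<zeta>"
proof -
  define F where "F = of_coef (fourier u)"
  have F: "F \<in> H2" "coef F = fourier u" unfolding F_def using of_coef_H2[OF bessel_summable(1)[OF u]] by auto
  note i = L2_circle_integrable[OF u] L2_circle_integrable[OF bdry_L2[OF F(1)]]
  have "(LINT \<zeta>|circle. u \<zeta> * \<zeta> ^ n) = (LINT \<zeta>|circle. bdry F \<zeta> * \<zeta> ^ n)" for n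
    using neg[of n] bdry_mean[OF F(1), of n] F(2) by (cases "n = 0") (auto simp: fourier_def)
  then have "(\<lambda>\<zeta>. u \<zeta> - bdry F \<zeta>) \<in> null_coefficients"
    using i integrable_mult_power[OF i(1)] integrable_mult_power[OF i(2)]
    by (simp add: null_coefficients_def fourier_diff fourier_bdry[OF F(1)] F(2) left_diff_distrib)
  from null_coefficients_AE[OF this] show ?thesis by (simp add: F_def)
qed

section \<open>Outer functions\<close>

text \<open>The Schwarz integral. Its real part is the Poisson integral of \<open>v\<close>, and
  outer functions are unimodular multiples of its exponential.\<close>

definition herglotz :: "(complex \<Rightarrow> real) \<Rightarrow> complex \<Rightarrow> complex" where
  "herglotz v z = (LINT \<zeta>|circle. (\<zeta> + z) / (\<zeta> - z) * of_real (v \<zeta>))"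

text \<open>On the circle the Schwarz kernel is affine in the Cauchy kernel, which reduces the
  Herglotz integral to a Cauchy transform.\<close>

lemma herglotz_kernel:
  fixes \<zeta> z :: complex
  assumes "norm \<zeta> = 1" "norm z < 1"
  shows "(\<zeta> + z) / (\<zeta> - z) = 2 / (1 - z * cnj \<zeta>) - 1" and "1 - z * cnj \<zeta> \<noteq> 0" and "1 - norm z \<le> norm (1 - z * cnj \<zeta>)"
proof -
  show b: "1 - norm z \<le> norm (1 - z * cnj \<zeta>)"
    using norm_triangle_ineq2[of 1 "z * cnj \<zeta>"] assms by (simp add: norm_mult)
  then show nz: "1 - z * cnj \<zeta> \<noteq> 0" using assms by auto
  have "\<zeta> \<noteq> 0" using assms by auto
  have e1: "\<zeta> - z = \<zeta> * (1 - z * cnj \<zeta>)" "\<zeta> + z = \<zeta> * (1 + z * cnj \<zeta>)"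
    using circle_cancel[OF assms(1)] by (simp_all add: algebra_simps)
  have "(\<zeta> + z) / (\<zeta> - z) = (1 + z * cnj \<zeta>) / (1 - z * cnj \<zeta>)"
    unfolding e1 using \<open>\<zeta> \<noteq> 0\<close> by simp
  also have "\<dots> = 2 / (1 - z * cnj \<zeta>) - 1" using nz by (simp add: field_simps)
  finally show "(\<zeta> + z) / (\<zeta> - z) = 2 / (1 - z * cnj \<zeta>) - 1" .
qed

lemma integrable_mult_cauchy_kernel:
  fixes v :: "complex \<Rightarrow> complex"
  assumes v: "integrable circle v" and z: "norm z < 1"
  shows "integrable circle (\<lambda>\<zeta>. v \<zeta> / (1 - z * cnj \<zeta>))"
proof (rule Bochner_Integration.integrable_bound)
  have [measurable]: "v \<in> borel_measurable borel" using borel_measurable_integrable[OF v] by simp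
  show "integrable circle (\<lambda>\<zeta>. norm (v \<zeta>) * (1 / (1 - norm z)))" using v by simp
  show "(\<lambda>\<zeta>. v \<zeta> / (1 - z * cnj \<zeta>)) \<in> borel_measurable circle" by measurable
  show "AE \<zeta> in circle. norm (v \<zeta> / (1 - z * cnj \<zeta>)) \<le> norm (norm (v \<zeta>) * (1 / (1 - norm z)))"
  proof (rule AE_circleI)
    fix \<zeta> :: complex assume "norm \<zeta> = 1"
    from herglotz_kernel(3)[OF this z] z
    have "norm (v \<zeta>) / norm (1 - z * cnj \<zeta>) \<le> norm (v \<zeta>) / (1 - norm z)" by (intro frac_le) auto
    then show "norm (v \<zeta> / (1 - z * cnj \<zeta>)) \<le> norm (norm (v \<zeta>) * (1 / (1 - norm z)))"
      using z by (simp add: norm_divide)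
  qed
qed

lemma herglotz_eq:
  assumes v: "integrable circle v" and z: "norm z < 1"
  shows "herglotz v z = 2 * (LINT \<zeta>|circle. of_real (v \<zeta>) / (1 - z * cnj \<zeta>)) - (LINT \<zeta>|circle. of_real (v \<zeta>))"
    and "integrable circle (\<lambda>\<zeta>. (\<zeta> + z) / (\<zeta> - z) * of_real (v \<zeta>))"
proof -
  have vc: "integrable circle (\<lambda>\<zeta>. complex_of_real (v \<zeta>))" by (rule integrable_of_real[OF v])
  have [measurable]: "v \<in> borel_measurable borel" using borel_measurable_integrable[OF v] by simp
  note k = integrable_mult_cauchy_kernel[OF vc z]
  have e: "(\<zeta> + z) / (\<zeta> - z) * of_real (v \<zeta>) = 2 * (of_real (v \<zeta>) / (1 - z * cnj \<zeta>)) - of_real (v \<zeta>)"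
    if "norm \<zeta> = 1" for \<zeta>
    unfolding herglotz_kernel(1)[OF that z] by (simp add: left_diff_distrib)
  have "herglotz v z = (LINT \<zeta>|circle. 2 * (of_real (v \<zeta>) / (1 - z * cnj \<zeta>)) - of_real (v \<zeta>))"
    unfolding herglotz_def by (rule integral_circle_cong[OF _ _ e]) measurable
  also have "\<dots> = 2 * (LINT \<zeta>|circle. of_real (v \<zeta>) / (1 - z * cnj \<zeta>)) - (LINT \<zeta>|circle. of_real (v \<zeta>))"
    using Bochner_Integration.integral_diff[OF integrable_mult_right[OF k, of 2] vc]
    by (simp only: integral_mult_right_zero)
  finally show "herglotz v z = 2 * (LINT \<zeta>|circle. of_real (v \<zeta>) / (1 - z * cnj \<zeta>)) - (LINT \<zeta>|circle. of_real (v \<zeta>))" .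
  have "integrable circle (\<lambda>\<zeta>. 2 * (of_real (v \<zeta>) / (1 - z * cnj \<zeta>)) - of_real (v \<zeta>))"
    by (intro Bochner_Integration.integrable_diff integrable_mult_right k vc)
  then show "integrable circle (\<lambda>\<zeta>. (\<zeta> + z) / (\<zeta> - z) * of_real (v \<zeta>))"
    by (rule integrable_cong_AE_imp) (use e in \<open>auto intro!: AE_circleI\<close>)
qed

lemma herglotz_add:
  assumes "integrable circle u" "integrable circle v" "norm z < 1"
  shows "herglotz (\<lambda>\<zeta>. u \<zeta> + v \<zeta>) z = herglotz u z + herglotz v z"
  using herglotz_eq(2)[OF assms(1,3)] herglotz_eq(2)[OF assms(2,3)]
  by (simp add: herglotz_def distrib_left)

lemma herglotz_0: "integrable circle v \<Longrightarrow> herglotz v 0 = of_real (LINT \<zeta>|circle. v \<zeta>)"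
  using herglotz_eq(1)[of v 0] by (simp add: integral_complex_of_real)

lemma herglotz_const:
  assumes "norm z < 1"
  shows "herglotz (\<lambda>_. x) z = of_real x"
proof -
  have f: "fourier (\<lambda>_. complex_of_real x) n = (if n = 0 then of_real x else 0)" for n
    by (simp add: fourier_def integral_circle_power_cnj)
  have "(\<lambda>n. fourier (\<lambda>_. complex_of_real x) n * z ^ n) sums (LINT \<zeta>|circle. complex_of_real x / (1 - z * cnj \<zeta>))"
    by (rule cauchy_transform[OF _ assms]) simp
  moreover have "fourier (\<lambda>_. complex_of_real x) n * z ^ n = (if n = 0 then of_real x * z ^ n else 0)" for n
    by (simp add: f)
  ultimately have "(\<lambda>n. if n = 0 then of_real x * z ^ n else 0) sums (LINT \<zeta>|circle. complex_of_real x / (1 - z * cnj \<zeta>))"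
    by simp
  with sums_single[of 0 "\<lambda>n. of_real x * z ^ n"]
  have "(LINT \<zeta>|circle. complex_of_real x / (1 - z * cnj \<zeta>)) = of_real x"
    using sums_unique2 by fastforce
  then show ?thesis using herglotz_eq(1)[of "\<lambda>_. x", OF _ assms] by simp
qed

lemma herglotz_holomorphic:
  assumes v: "integrable circle v"
  shows "herglotz v holomorphic_on disc"
proof -
  have vc: "integrable circle (\<lambda>\<zeta>. complex_of_real (v \<zeta>))" by (rule integrable_of_real[OF v])
  define I where "I z = (LINT \<zeta>|circle. of_real (v \<zeta>) / (1 - z * cnj \<zeta>))" for z
  have "I holomorphic_on disc"
    by (rule power_series_holomorphic[of 0 1 "fourier (\<lambda>\<zeta>. of_real (v \<zeta>))"])
      (use cauchy_transform[OF vc] in \<open>simp add: I_def\<close>)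
  then have "(\<lambda>z. 2 * I z - (LINT \<zeta>|circle. of_real (v \<zeta>))) holomorphic_on disc"
    by (intro holomorphic_intros)
  then show ?thesis
    by (rule holomorphic_transform) (simp add: herglotz_eq(1)[OF v] I_def)
qed

text \<open>The real part of the kernel is nonnegative and constants are reproduced, so after
  subtraction of \<open>x\<close> the integrand is nonpositive.\<close>

lemma Re_herglotz_le:
  assumes v: "integrable circle v" and z: "norm z < 1" and le: "\<And>\<zeta>. v \<zeta> \<le> x"
  shows "Re (herglotz v z) \<le> x"
proof -
  have vx: "integrable circle (\<lambda>\<zeta>. v \<zeta> + - x)" using v by simp
  have "Re (herglotz (\<lambda>\<zeta>. v \<zeta> + - x) z) = (LINT \<zeta>|circle. Re ((\<zeta> + z) / (\<zeta> - z) * of_real (v \<zeta> + - x)))"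
    unfolding herglotz_def by (rule integral_Re[symmetric, OF herglotz_eq(2)[OF vx z]])
  also have "\<dots> \<le> (LINT \<zeta>|circle. 0)"
  proof (rule integral_mono_AE)
    show "integrable circle (\<lambda>\<zeta>. Re ((\<zeta> + z) / (\<zeta> - z) * of_real (v \<zeta> + - x)))"
      by (rule integrable_Re[OF herglotz_eq(2)[OF vx z]])
    show "AE \<zeta> in circle. Re ((\<zeta> + z) / (\<zeta> - z) * of_real (v \<zeta> + - x)) \<le> 0"
    proof (rule AE_circleI)
      fix \<zeta> :: complex assume n: "norm \<zeta> = 1"
      have "1 / 2 \<le> Re (1 / (1 - z * cnj \<zeta>))"
        using z n by (intro Re_cauchy_kernel_ge) (simp add: norm_mult)
      moreover have "Re ((\<zeta> + z) / (\<zeta> - z)) = 2 * Re (1 / (1 - z * cnj \<zeta>)) - 1"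
      proof -
        have "2 / (1 - z * cnj \<zeta>) = 1 / (1 - z * cnj \<zeta>) + 1 / (1 - z * cnj \<zeta>)"
          by (simp add: add_divide_distrib[symmetric])
        then have "Re (2 / (1 - z * cnj \<zeta>)) = 2 * Re (1 / (1 - z * cnj \<zeta>))"
          unfolding mult_2 by (simp only: plus_complex.sel)
        then show ?thesis unfolding herglotz_kernel(1)[OF n z] by simp
      qed
      ultimately have "0 \<le> Re ((\<zeta> + z) / (\<zeta> - z))" by simp
      then show "Re ((\<zeta> + z) / (\<zeta> - z) * of_real (v \<zeta> + - x)) \<le> 0"
        unfolding Re_mult_of_real using le[of \<zeta>] by (intro mult_nonneg_nonpos) auto
    qed
  qed simp
  also have "herglotz (\<lambda>\<zeta>. v \<zeta> + - x) z = herglotz v z - of_real x"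
    using herglotz_add[OF v _ z, of "\<lambda>_. - x"] herglotz_const[OF z, of "- x"] by simp
  finally show ?thesis by simp
qed

text \<open>If \<open>k = log |a|\<close> on the circle, then \<open>p\<^sub>n = exp (herglotz (min (-k) n))\<close> is bounded,
  \<open>|a p\<^sub>n| \<le> 1\<close> and \<open>a(0) p\<^sub>n(0)\<close> tends to a unimodular constant. The norm of a function in the
  unit ball of \<open>H\<^sup>2\<close> whose value at \<open>0\<close> is nearly unimodular is concentrated in the constant
  term.\<close>

lemma outer_approximate_inverse:
  assumes a: "a \<in> Hinf" "outer a"
  obtains c p where "norm c = 1" "\<And>n. p n \<in> Hinf" "\<And>n z. z \<in> disc \<Longrightarrow> norm (a z * p n z) \<le> 1"
    "(\<lambda>n. a 0 * p n 0) \<longlonglongrightarrow> c"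
proof -
  obtain c and k :: "complex \<Rightarrow> real" where c: "norm c = 1" and k: "integrable circle k"
    and ak: "\<And>z. norm z < 1 \<Longrightarrow> a z = c * exp (herglotz k z)"
    using a(2) unfolding outer_def herglotz_def by auto
  have [measurable]: "k \<in> borel_measurable borel" using borel_measurable_integrable[OF k] by simp
  \<comment> \<open>Here \<open>k + v n\<close> is the minimum of 0 and \<open>k + n\<close>: it is
    nonpositive, dominated by \<open>norm k\<close>, and eventually 0 at each point.\<close>
  define v where "v n \<zeta> = min (- k \<zeta>) (real n)" for n \<zeta>
  have [measurable]: "v n \<in> borel_measurable borel" for n unfolding v_def by measurable
  have v: "integrable circle (v n)" for n
    by (rule Bochner_Integration.integrable_bound[OF k]) (auto simp: v_def intro!: AE_I2)
  define p where "p n z = (if z \<in> disc then exp (herglotz (v n) z) else 0)" for n z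
  have ap: "a z * p n z = c * exp (herglotz (\<lambda>\<zeta>. k \<zeta> + v n \<zeta>) z)" if "norm z < 1" for n z
    unfolding herglotz_add[OF k v that] using that by (simp add: ak p_def exp_add)
  have kv: "integrable circle (\<lambda>\<zeta>. k \<zeta> + v n \<zeta>)" for n using k v by simp
  show thesis
  proof (rule that[OF c])
    fix n
    have "(\<lambda>z. exp (herglotz (v n) z)) holomorphic_on disc"
      by (intro holomorphic_intros herglotz_holomorphic v)
    then have "p n holomorphic_on disc"
      by (rule holomorphic_transform) (simp add: p_def)
    moreover have "norm (p n z) \<le> exp (real n)" if "z \<in> disc" for z
      using Re_herglotz_le[OF v, of z n "real n"] that by (simp add: p_def norm_exp_eq_Re v_def)
    moreover have "p n z = 0" if "z \<notin> disc" for z using that by (simp add: p_def)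
    ultimately show "p n \<in> Hinf" unfolding Hinf_def hol_disc_def bounded_iff by blast
  next
    fix n z assume "z \<in> disc"
    then have z: "norm z < 1" by simp
    have "Re (herglotz (\<lambda>\<zeta>. k \<zeta> + v n \<zeta>) z) \<le> 0"
      by (rule Re_herglotz_le[OF kv z]) (simp add: v_def)
    then show "norm (a z * p n z) \<le> 1"
      unfolding ap[OF z] norm_mult c norm_exp_eq_Re by simp
  next
    have "(\<lambda>n. LINT \<zeta>|circle. k \<zeta> + v n \<zeta>) \<longlonglongrightarrow> (LINT \<zeta>|circle. 0)"
    proof (rule integral_dominated_convergence[where w = "\<lambda>\<zeta>. norm (k \<zeta>)"])
      show "AE \<zeta> in circle. (\<lambda>n. k \<zeta> + v n \<zeta>) \<longlonglongrightarrow> 0"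
      proof (rule AE_I2)
        fix \<zeta>
        obtain N :: nat where N: "- k \<zeta> < real N" using reals_Archimedean2 by blast
        then have "k \<zeta> + v n \<zeta> = 0" if "n \<ge> N" for n using that by (simp add: v_def)
        then show "(\<lambda>n. k \<zeta> + v n \<zeta>) \<longlonglongrightarrow> 0"
          by (intro tendsto_eventually) (auto simp: eventually_sequentially)
      qed
      show "AE \<zeta> in circle. norm (k \<zeta> + v n \<zeta>) \<le> norm (k \<zeta>)" for n
        by (rule AE_I2) (auto simp: v_def)
    qed (use k kv in auto)
    then have "(\<lambda>n. c * exp (of_real (LINT \<zeta>|circle. k \<zeta> + v n \<zeta>))) \<longlonglongrightarrow> c * exp (of_real 0)"
      by (intro tendsto_intros) simp
    then show "(\<lambda>n. a 0 * p n 0) \<longlonglongrightarrow> c"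
      using ap[of 0] herglotz_0[OF kv] by simp
  qed
qed

text \<open>Vanishing coefficients make \<open>cnj a h\<close> orthogonal to every
  \<open>z ^ m * p n\<close>, so \<open>h\<close> is orthogonal to \<open>z ^ m\<close> times
  \<open>F n = a * p n\<close>. As \<open>F n\<close> tends to the constant \<open>c\<close> in mean
  square, the coefficient of \<open>h\<close> at \<open>m\<close> must vanish.\<close>

lemma outer_toeplitz_injective:
  assumes a: "a \<in> Hinf" "outer a" and h: "h \<in> H2" and 0: "\<And>n. toeplitz_coef a h n = 0"
  shows "h = (\<lambda>z. 0)"
proof -
  obtain c p where c: "norm c = 1" and p: "\<And>n. p n \<in> Hinf"
    and ap: "\<And>n z. z \<in> disc \<Longrightarrow> norm (a z * p n z) \<le> 1" and lim: "(\<lambda>n. a 0 * p n 0) \<longlonglongrightarrow> c"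
    using outer_approximate_inverse[OF a] by blast
  define F where "F n z = a z * p n z" for n z
  have F: "F n \<in> H2" for n unfolding F_def by (rule Hinf_mult_H2[OF a(1) Hinf_H2[OF p]])
  have F1: "AE \<zeta> in circle. norm (bdry (F n) \<zeta>) \<le> 1" for n
    by (rule AE_bdry_le[OF F]) (use ap in \<open>simp add: F_def\<close>)
  define A where "A = (LINT \<zeta>|circle. (norm (bdry h \<zeta>))\<^sup>2)"
  \<comment> \<open>Bounds the squared distance on the circle between \<open>F n\<close> and the
    constant \<open>c\<close>, since \<open>norm c = 1\<close> and the boundary values of
    \<open>F n\<close> have modulus at most 1 almost everywhere.\<close>
  define D where "D n = 2 - 2 * Re (cnj c * F n 0)" for n
  have D: "D \<longlonglongrightarrow> 0"
  proof -
    have "(\<lambda>n. F n 0) \<longlonglongrightarrow> c" using lim by (simp add: F_def)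
    then have "D \<longlonglongrightarrow> 2 - 2 * Re (cnj c * c)" unfolding D_def by (intro tendsto_intros)
    moreover have "cnj c * c = 1" using circle_cancel[OF c] by simp
    ultimately show ?thesis by simp
  qed
  have hL: "bdry h \<in> L2_circle" by (rule bdry_L2[OF h])
  note hm [measurable] = L2_circle_measurable[OF hL]
  \<comment> \<open>The free weight \<open>e\<close> stands in for the Cauchy-Schwarz inequality:
    first \<open>n\<close> tends to infinity, then \<open>e\<close> to 0.\<close>
  have bound: "norm (coef h m) \<le> e * A + (1 / e) * D n" if e: "0 < e" for m n e
  proof -
    note Fm [measurable] = L2_circle_measurable[OF bdry_L2[OF F[of n]]]
    have am [measurable]: "bdry a \<in> borel_measurable borel" "bdry (p n) \<in> borel_measurable borel"
      using bdry_measurable a(1) p by (auto simp: Hinf_def)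
    have q: "(\<lambda>z. z ^ m * p n z) \<in> H2" "AE \<zeta> in circle. bdry (\<lambda>z. z ^ m * p n z) \<zeta> = \<zeta> ^ m * bdry (p n) \<zeta>"
      using H2_mult_power[OF Hinf_H2[OF p]] by auto
    have qm [measurable]: "bdry (\<lambda>z. z ^ m * p n z) \<in> borel_measurable borel" by (rule L2_circle_measurable[OF bdry_L2[OF q(1)]])
    have "(\<lambda>j. toeplitz_coef a h j * cnj (coef (\<lambda>z. z ^ m * p n z) j)) sums
        L2_inner (\<lambda>\<zeta>. cnj (bdry a \<zeta>) * bdry h \<zeta>) (bdry (\<lambda>z. z ^ m * p n z))"
      unfolding toeplitz_coef_def by (rule L2_inner_bdry[OF L2_circle_cnj_bdry_mult[OF a(1) hL] q(1)])
    then have "0 = L2_inner (\<lambda>\<zeta>. cnj (bdry a \<zeta>) * bdry h \<zeta>) (bdry (\<lambda>z. z ^ m * p n z))"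
      by (simp add: 0 sums_iff)
    also have "\<dots> = (LINT \<zeta>|circle. bdry h \<zeta> * cnj \<zeta> ^ m * cnj (bdry (F n) \<zeta>))"
      unfolding L2_inner_def
    proof (rule integral_cong_AE)
      show "AE \<zeta> in circle. cnj (bdry a \<zeta>) * bdry h \<zeta> * cnj (bdry (\<lambda>z. z ^ m * p n z) \<zeta>) =
          bdry h \<zeta> * cnj \<zeta> ^ m * cnj (bdry (F n) \<zeta>)"
        using q(2) bdry_mult[OF Hinf_H2[OF a(1)] Hinf_H2[OF p[of n]]]
        by eventually_elim (simp add: F_def[abs_def] mult_ac)
    qed measurable
    finally have z: "(LINT \<zeta>|circle. bdry h \<zeta> * cnj \<zeta> ^ m * cnj (bdry (F n) \<zeta>)) = 0" by simp
    have hz: "(\<lambda>\<zeta>. bdry h \<zeta> * cnj \<zeta> ^ m) \<in> L2_circle"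
      by (rule L2_circle_dominated[OF hL, of _ 1]) (auto intro!: AE_circleI simp: norm_mult norm_power)
    have "cnj c * coef h m = (LINT \<zeta>|circle. bdry h \<zeta> * cnj \<zeta> ^ m * cnj c)"
      unfolding fourier_bdry[OF h, symmetric] fourier_def by simp
    also have "\<dots> = (LINT \<zeta>|circle. bdry h \<zeta> * cnj \<zeta> ^ m * cnj c - bdry h \<zeta> * cnj \<zeta> ^ m * cnj (bdry (F n) \<zeta>))"
      using Bochner_Integration.integral_diff[OF L2_circle_inner_integrable[OF hz L2_circle_const[of c]] L2_circle_inner_integrable[OF hz bdry_L2[OF F[of n]]]] z
      by simp
    finally have e1: "cnj c * coef h m = (LINT \<zeta>|circle. bdry h \<zeta> * cnj \<zeta> ^ m * cnj c - bdry h \<zeta> * cnj \<zeta> ^ m * cnj (bdry (F n) \<zeta>))" .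
    have "norm (coef h m) = norm (cnj c * coef h m)" using c by (simp add: norm_mult)
    also have "\<dots> \<le> (LINT \<zeta>|circle. norm (bdry h \<zeta> * cnj \<zeta> ^ m * cnj c - bdry h \<zeta> * cnj \<zeta> ^ m * cnj (bdry (F n) \<zeta>)))"
      unfolding e1 by (rule integral_norm_bound)
    also have "\<dots> \<le> (LINT \<zeta>|circle. e * (norm (bdry h \<zeta>))\<^sup>2 + (1 / e) * (2 - 2 * Re (cnj c * bdry (F n) \<zeta>)))"
    proof (rule integral_mono_AE)
      show "integrable circle (\<lambda>\<zeta>. norm (bdry h \<zeta> * cnj \<zeta> ^ m * cnj c - bdry h \<zeta> * cnj \<zeta> ^ m * cnj (bdry (F n) \<zeta>)))"
        by (intro integrable_norm Bochner_Integration.integrable_diff L2_circle_inner_integrable hz bdry_L2 F L2_circle_const[of c])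
      have "integrable circle (\<lambda>\<zeta>. Re (cnj c * bdry (F n) \<zeta>))"
        by (intro integrable_Re integrable_mult_right L2_circle_integrable bdry_L2 F)
      then show "integrable circle (\<lambda>\<zeta>. e * (norm (bdry h \<zeta>))\<^sup>2 + (1 / e) * (2 - 2 * Re (cnj c * bdry (F n) \<zeta>)))"
        using hL by (intro Bochner_Integration.integrable_add integrable_mult_right Bochner_Integration.integrable_diff) (auto simp: L2_circle_def)
      show "AE \<zeta> in circle. norm (bdry h \<zeta> * cnj \<zeta> ^ m * cnj c - bdry h \<zeta> * cnj \<zeta> ^ m * cnj (bdry (F n) \<zeta>)) \<le>
         e * (norm (bdry h \<zeta>))\<^sup>2 + (1 / e) * (2 - 2 * Re (cnj c * bdry (F n) \<zeta>))"
        using F1[of n] AE_circle_norm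
      proof eventually_elim
        case (elim \<zeta>)
        define x y where "x = norm (bdry h \<zeta>)" and "y = norm (c - bdry (F n) \<zeta>)"
        have "bdry h \<zeta> * cnj \<zeta> ^ m * cnj c - bdry h \<zeta> * cnj \<zeta> ^ m * cnj (bdry (F n) \<zeta>) =
            bdry h \<zeta> * cnj \<zeta> ^ m * cnj (c - bdry (F n) \<zeta>)" by (simp add: right_diff_distrib)
        then have "norm (bdry h \<zeta> * cnj \<zeta> ^ m * cnj c - bdry h \<zeta> * cnj \<zeta> ^ m * cnj (bdry (F n) \<zeta>)) = x * y"
          using elim(2) by (simp only: norm_mult norm_power complex_mod_cnj x_def y_def) simp
        also have "x * y \<le> e * x\<^sup>2 + (1 / e) * y\<^sup>2"
        proof -
          have "0 \<le> (e * x - y)\<^sup>2 + e * (x * y)" using e by (auto simp: x_def y_def)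
          then have "e * (x * y) \<le> e\<^sup>2 * x\<^sup>2 + y\<^sup>2"
            unfolding power2_diff by (simp add: power_mult_distrib)
          then have "e * (x * y) \<le> e * (e * x\<^sup>2 + (1 / e) * y\<^sup>2)"
            using e by (simp add: power2_eq_square algebra_simps)
          then show ?thesis using e by simp
        qed
        also have "y\<^sup>2 \<le> 2 - 2 * Re (cnj c * bdry (F n) \<zeta>)"
        proof -
          have "(norm (bdry (F n) \<zeta>))\<^sup>2 \<le> 1" using elim(1) by (simp add: power_le_one)
          moreover have "(norm c)\<^sup>2 = 1" using c by simp
          ultimately show ?thesis
            unfolding y_def cmod_power2 by (simp add: power2_eq_square algebra_simps)
        qed
        then have "e * x\<^sup>2 + (1 / e) * y\<^sup>2 \<le> e * x\<^sup>2 + (1 / e) * (2 - 2 * Re (cnj c * bdry (F n) \<zeta>))"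
          using e by (intro add_mono mult_left_mono) auto
        finally show ?case by (simp add: x_def)
      qed
    qed
    also have "\<dots> = e * A + (1 / e) * D n"
    proof -
      have i: "integrable circle (\<lambda>\<zeta>. cnj c * bdry (F n) \<zeta>)"
        by (intro integrable_mult_right L2_circle_integrable bdry_L2 F)
      have "(LINT \<zeta>|circle. cnj c * bdry (F n) \<zeta>) = cnj c * F n 0"
        using fourier_bdry[OF F, of n 0] coef_sums[OF H2_hol[OF F], of 0 n] by (simp add: fourier_def coef_def)
      then have "(LINT \<zeta>|circle. Re (cnj c * bdry (F n) \<zeta>)) = Re (cnj c * F n 0)"
        using integral_Re[OF i] by (simp only:)
      moreover define R where "R \<zeta> = Re (cnj c * bdry (F n) \<zeta>)" for \<zeta>
      ultimately have R: "(LINT \<zeta>|circle. R \<zeta>) = Re (cnj c * F n 0)" "integrable circle R"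
        using integrable_Re[OF i] by (simp_all only: R_def[abs_def])
      have "integrable circle (\<lambda>\<zeta>. (norm (bdry h \<zeta>))\<^sup>2)" using hL by (simp add: L2_circle_def)
      then have "(LINT \<zeta>|circle. e * (norm (bdry h \<zeta>))\<^sup>2 + (1 / e) * (2 - 2 * R \<zeta>)) =
          e * A + (1 / e) * (2 - 2 * (LINT \<zeta>|circle. R \<zeta>))"
        using R(2) by (simp add: A_def)
      then show ?thesis unfolding R(1) unfolding R_def D_def .
    qed
    finally show ?thesis .
  qed
  have coef0: "coef h m = 0" for m
  proof -
    have eb: "norm (coef h m) \<le> e * A" if e: "0 < e" for e
    proof (rule LIMSEQ_le_const)
      show "(\<lambda>n. e * A + (1 / e) * D n) \<longlonglongrightarrow> e * A"
        using tendsto_add[OF tendsto_const[of "e * A"] tendsto_mult_right_zero[OF D, of "1 / e"]] by simp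
    qed (use bound[OF e] in auto)
    have "norm (coef h m) \<le> 0"
      by (rule nonpos_if_le_epsilon_mult[OF _ eb]) (simp add: A_def)
    then show ?thesis by simp
  qed
  show ?thesis
  proof (rule hol_disc_coef_eqI)
    show z: "(\<lambda>z. 0) \<in> hol_disc" by (simp add: hol_disc_def)
    have "coef (\<lambda>z. 0) = (\<lambda>n. 0)" by (rule coef_unique[OF z]) simp
    then show "coef h = coef (\<lambda>z. 0)" using coef0 by auto
  qed (rule H2_hol[OF h])
qed

section \<open>The de Branges--Rovnyak space of a Pythagorean pair\<close>

text \<open>Limits exist coordinate by coordinate. The Cauchy estimate passes to them on finite
  partial sums, with a bound independent of the length, and so to the full sums. Summability of the
  limit comes from writing it as one term of the sequence plus a summable difference.\<close>

lemma square_summable_complete: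
  fixes x :: "nat \<Rightarrow> nat \<Rightarrow> complex"
  assumes x: "\<And>k. summable (\<lambda>n. (norm (x k n))\<^sup>2)"
    and cauchy: "\<And>e. 0 < e \<Longrightarrow> \<exists>N. \<forall>k\<ge>N. \<forall>l\<ge>N. (\<Sum>n. (norm (x k n - x l n))\<^sup>2) \<le> e"
  shows "\<exists>y. summable (\<lambda>n. (norm (y n))\<^sup>2) \<and> (\<lambda>k. \<Sum>n. (norm (x k n - y n))\<^sup>2) \<longlonglongrightarrow> 0"
proof -
  have diff: "summable (\<lambda>n. (norm (x k n - x l n))\<^sup>2)" for k l
    using square_summable_add[OF x, of "\<lambda>n. - x l n" k] x[of l] by simp
  have "Cauchy (\<lambda>k. x k n)" for n
  proof (rule metric_CauchyI)
    fix e :: real assume e: "0 < e"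
    obtain N where N: "\<And>k l. k \<ge> N \<Longrightarrow> l \<ge> N \<Longrightarrow> (\<Sum>n. (norm (x k n - x l n))\<^sup>2) \<le> (e / 2)\<^sup>2"
      using cauchy[of "(e / 2)\<^sup>2"] e by auto
    have "dist (x k n) (x l n) < e" if "k \<ge> N" "l \<ge> N" for k l
    proof -
      have "(norm (x k n - x l n))\<^sup>2 \<le> (\<Sum>n. (norm (x k n - x l n))\<^sup>2)"
        using sum_le_suminf[OF diff, of "{n}" k l] by simp
      also have "\<dots> \<le> (e / 2)\<^sup>2" by (rule N[OF that])
      finally have "norm (x k n - x l n) \<le> e / 2" using e by (simp add: power2_le_iff_abs_le)
      then show ?thesis using e by (simp add: dist_norm)
    qed
    then show "\<exists>M. \<forall>k\<ge>M. \<forall>l\<ge>M. dist (x k n) (x l n) < e" by blast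
  qed
  then have "\<exists>l. (\<lambda>k. x k n) \<longlonglongrightarrow> l" for n by (simp add: Cauchy_convergent_iff convergent_def)
  then obtain y where y: "\<And>n. (\<lambda>k. x k n) \<longlonglongrightarrow> y n" by metis
  have fin: "(\<Sum>n<M. (norm (x k n - y n))\<^sup>2) \<le> e"
    if N: "\<And>k l. k \<ge> N \<Longrightarrow> l \<ge> N \<Longrightarrow> (\<Sum>n. (norm (x k n - x l n))\<^sup>2) \<le> e" and k: "k \<ge> N" for k N e M
  proof (rule LIMSEQ_le_const2)
    show "(\<lambda>l. \<Sum>n<M. (norm (x k n - x l n))\<^sup>2) \<longlonglongrightarrow> (\<Sum>n<M. (norm (x k n - y n))\<^sup>2)"
      by (intro tendsto_intros y)
    have "(\<Sum>n<M. (norm (x k n - x l n))\<^sup>2) \<le> e" if "l \<ge> N" for l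
      using sum_le_suminf[OF diff, of "{..<M}" k l] N[OF k that] by simp
    then show "\<exists>N. \<forall>l\<ge>N. (\<Sum>n<M. (norm (x k n - x l n))\<^sup>2) \<le> e" by blast
  qed
  obtain N1 where N1: "\<And>k l. k \<ge> N1 \<Longrightarrow> l \<ge> N1 \<Longrightarrow> (\<Sum>n. (norm (x k n - x l n))\<^sup>2) \<le> 1"
    using cauchy[of 1] by auto
  have "summable (\<lambda>n. (norm (x N1 n - y n))\<^sup>2)"
    by (rule summableI_nonneg_bounded[OF _ fin[OF N1 order_refl]]) auto
  from square_summable_add[OF _ x[of N1], of "\<lambda>n. y n - x N1 n"] this
  have ys: "summable (\<lambda>n. (norm (y n))\<^sup>2)" by (simp add: norm_minus_commute)
  have ds: "summable (\<lambda>n. (norm (x k n - y n))\<^sup>2)" for k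
    using square_summable_add[OF x, of "\<lambda>n. - y n" k] ys by simp
  have "(\<lambda>k. \<Sum>n. (norm (x k n - y n))\<^sup>2) \<longlonglongrightarrow> 0"
  proof (rule tendstoI)
    fix e :: real assume e: "0 < e"
    obtain N where N: "\<And>k l. k \<ge> N \<Longrightarrow> l \<ge> N \<Longrightarrow> (\<Sum>n. (norm (x k n - x l n))\<^sup>2) \<le> e / 2"
      using cauchy[of "e / 2"] e by auto
    have "dist (\<Sum>n. (norm (x k n - y n))\<^sup>2) 0 < e" if "k \<ge> N" for k
      using suminf_le_const[OF ds fin[OF N that]] suminf_nonneg[OF ds, of k] e by (simp add: dist_real_def)
    then show "\<forall>\<^sub>F k in sequentially. dist (\<Sum>n. (norm (x k n - y n))\<^sup>2) 0 < e"
      by (auto simp: eventually_sequentially)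
  qed
  with ys show ?thesis by blast
qed

text \<open>Taken on coefficients, where positivity and completeness are facts about sequences;
  \<open>h2_inner_eq\<close> returns to the boundary integral.\<close>

definition h2_inner :: "(complex \<Rightarrow> complex) \<Rightarrow> (complex \<Rightarrow> complex) \<Rightarrow> complex" where
  "h2_inner f g = (\<Sum>n. coef f n * cnj (coef g n))"

lemma h2_inner_summable:
  assumes "f \<in> H2" "g \<in> H2"
  shows "summable (\<lambda>n. coef f n * cnj (coef g n))"
  by (rule summable_norm_cancel[OF square_summable_imp_inner]) (use assms H2_summable in auto)

lemma h2_inner_eq:
  assumes "f \<in> H2" "g \<in> H2"
  shows "h2_inner f g = L2_inner (bdry f) (bdry g)"
  using L2_inner_bdry[OF bdry_L2[OF assms(1)] assms(2)]
  by (simp add: h2_inner_def fourier_bdry[OF assms(1)] sums_iff)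

lemma h2_inner_add:
  assumes "f \<in> H2" "g \<in> H2" "h \<in> H2"
  shows "h2_inner (\<lambda>z. f z + g z) h = h2_inner f h + h2_inner g h"
  using suminf_add[OF h2_inner_summable[OF assms(1,3)] h2_inner_summable[OF assms(2,3)]]
  by (simp add: h2_inner_def coef_add[OF H2_hol[OF assms(1)] H2_hol[OF assms(2)]] distrib_right)

lemma h2_inner_scale:
  assumes "f \<in> H2" "h \<in> H2"
  shows "h2_inner (\<lambda>z. c * f z) h = c * h2_inner f h"
  using suminf_mult[OF h2_inner_summable[OF assms], of c]
  by (simp add: h2_inner_def coef_scale[OF H2_hol[OF assms(1)]] mult.assoc)

lemma h2_inner_cnj:
  assumes "f \<in> H2" "g \<in> H2"
  shows "h2_inner g f = cnj (h2_inner f g)"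
proof -
  have "(\<lambda>n. cnj (coef f n * cnj (coef g n))) sums cnj (h2_inner f g)"
    unfolding sums_cnj h2_inner_def by (rule summable_sums[OF h2_inner_summable[OF assms]])
  then show ?thesis by (simp add: h2_inner_def sums_iff mult.commute)
qed

lemma Re_h2_inner_self:
  assumes "f \<in> H2"
  shows "Re (h2_inner f f) = (\<Sum>n. (norm (coef f n))\<^sup>2)"
proof -
  have e: "coef f n * cnj (coef f n) = of_real ((norm (coef f n))\<^sup>2)" for n
    by (rule complex_norm_square[symmetric])
  show ?thesis
    unfolding h2_inner_def e suminf_of_real[OF H2_summable[OF assms], symmetric] by (rule Re_complex_of_real)
qed

lemma h2_inner_pos:
  assumes f: "f \<in> H2" and "f \<noteq> (\<lambda>z. 0)"
  shows "0 < Re (h2_inner f f)"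
proof -
  have z: "(\<lambda>z. 0) \<in> hol_disc" by (simp add: hol_disc_def)
  have "coef (\<lambda>z. 0) = (\<lambda>n. 0)" by (rule coef_unique[OF z]) simp
  then obtain n where "coef f n \<noteq> 0"
    using hol_disc_coef_eqI[OF H2_hol[OF f] z] assms(2) by fastforce
  then show ?thesis
    unfolding Re_h2_inner_self[OF f]
    by (intro suminf_pos2[OF H2_summable[OF f], of n]) auto
qed

lemma fourier_cong_AE:
  assumes "u \<in> borel_measurable borel" "v \<in> borel_measurable borel" "AE \<zeta> in circle. u \<zeta> = v \<zeta>"
  shows "fourier u n = fourier v n"
proof -
  have [measurable]: "u \<in> borel_measurable borel" "v \<in> borel_measurable borel" by fact+
  show ?thesis unfolding fourier_def
  proof (rule integral_cong_AE)
    show "AE \<zeta> in circle. u \<zeta> * cnj \<zeta> ^ n = v \<zeta> * cnj \<zeta> ^ n"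
      using assms(3) by eventually_elim simp
  qed measurable
qed

lemma toeplitz_coef_add:
  assumes p: "p \<in> Hinf" and f: "f \<in> H2" and g: "g \<in> H2"
  shows "toeplitz_coef p (\<lambda>z. f z + g z) n = toeplitz_coef p f n + toeplitz_coef p g n"
proof -
  note m = L2_circle_cnj_bdry_mult[OF p bdry_L2]
  have "toeplitz_coef p (\<lambda>z. f z + g z) n =
     fourier (\<lambda>\<zeta>. cnj (bdry p \<zeta>) * bdry f \<zeta> + cnj (bdry p \<zeta>) * bdry g \<zeta>) n"
    unfolding toeplitz_coef_def
  proof (rule fourier_cong_AE)
    show "AE \<zeta> in circle. cnj (bdry p \<zeta>) * bdry (\<lambda>z. f z + g z) \<zeta> =
        cnj (bdry p \<zeta>) * bdry f \<zeta> + cnj (bdry p \<zeta>) * bdry g \<zeta>"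
      using bdry_add[OF f g] by eventually_elim (simp add: distrib_left)
  qed (intro L2_circle_measurable L2_circle_add m f g H2_add)+
  also have "\<dots> = toeplitz_coef p f n + toeplitz_coef p g n"
    unfolding toeplitz_coef_def by (intro fourier_add L2_circle_integrable m f g)
  finally show ?thesis .
qed

lemma toeplitz_coef_scale:
  assumes p: "p \<in> Hinf" and f: "f \<in> H2"
  shows "toeplitz_coef p (\<lambda>z. c * f z) n = c * toeplitz_coef p f n"
proof -
  note m = L2_circle_cnj_bdry_mult[OF p bdry_L2]
  have "toeplitz_coef p (\<lambda>z. c * f z) n = fourier (\<lambda>\<zeta>. c * (cnj (bdry p \<zeta>) * bdry f \<zeta>)) n"
    unfolding toeplitz_coef_def
  proof (rule fourier_cong_AE)
    show "AE \<zeta> in circle. cnj (bdry p \<zeta>) * bdry (\<lambda>z. c * f z) \<zeta> = c * (cnj (bdry p \<zeta>) * bdry f \<zeta>)"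
      using bdry_scale[OF f, of c] by eventually_elim simp
  qed (intro L2_circle_measurable L2_circle_scale m f H2_scale)+
  then show ?thesis by (simp add: fourier_scale toeplitz_coef_def)
qed

lemma toeplitz_coef_diff:
  assumes p: "p \<in> Hinf" and f: "f \<in> H2" and g: "g \<in> H2"
  shows "toeplitz_coef p (\<lambda>z. f z - g z) n = toeplitz_coef p f n - toeplitz_coef p g n"
  using toeplitz_coef_add[OF p f H2_scale[OF g, of "-1"]] toeplitz_coef_scale[OF p g, of "-1"] by simp

text \<open>Bessel's inequality for \<open>cnj (bdry p) * bdry f\<close>, with \<open>bdry p\<close>
  essentially bounded. One constant serves all \<open>f\<close>, so that it applies to the
  differences in a convergent sequence.\<close>

lemma toeplitz_coef_bound:
  assumes p: "p \<in> Hinf"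
  shows "\<exists>B. \<forall>f\<in>H2. \<forall>n. (norm (toeplitz_coef p f n))\<^sup>2 \<le> B * (\<Sum>n. (norm (coef f n))\<^sup>2)"
proof -
  obtain B where B: "AE \<zeta> in circle. norm (bdry p \<zeta>) \<le> B" by (rule bdry_Hinf_bounded[OF p])
  have "(norm (toeplitz_coef p f n))\<^sup>2 \<le> B\<^sup>2 * (\<Sum>n. (norm (coef f n))\<^sup>2)" if f: "f \<in> H2" for f n
  proof -
    define u where "u \<zeta> = cnj (bdry p \<zeta>) * bdry f \<zeta>" for \<zeta>
    have u: "u \<in> L2_circle" unfolding u_def by (rule L2_circle_cnj_bdry_mult[OF p bdry_L2[OF f]])
    have fi: "integrable circle (\<lambda>\<zeta>. (norm (bdry f \<zeta>))\<^sup>2)" using bdry_L2[OF f] by (simp add: L2_circle_def)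
    have "(norm (fourier u n))\<^sup>2 \<le> (\<Sum>k<Suc n. (norm (fourier u k))\<^sup>2)" by (simp add: sum_nonneg)
    also have "\<dots> \<le> (LINT \<zeta>|circle. (norm (u \<zeta>))\<^sup>2)" by (rule bessel[OF u])
    also have "\<dots> \<le> (LINT \<zeta>|circle. B\<^sup>2 * (norm (bdry f \<zeta>))\<^sup>2)"
    proof (rule integral_mono_AE)
      show "AE \<zeta> in circle. (norm (u \<zeta>))\<^sup>2 \<le> B\<^sup>2 * (norm (bdry f \<zeta>))\<^sup>2"
        using B by eventually_elim (auto simp: u_def norm_mult power_mult_distrib intro!: mult_right_mono power_mono)
    qed (use u fi in \<open>auto simp: L2_circle_def\<close>)
    also have "\<dots> = B\<^sup>2 * (LINT \<zeta>|circle. (norm (bdry f \<zeta>))\<^sup>2)" by simp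
    also have "(LINT \<zeta>|circle. (norm (bdry f \<zeta>))\<^sup>2) = (\<Sum>n. (norm (coef f n))\<^sup>2)"
      unfolding Re_h2_inner_self[OF f, symmetric] h2_inner_eq[OF f f] L2_inner_def complex_norm_square[symmetric]
        integral_complex_of_real by simp
    finally show ?thesis by (simp add: u_def toeplitz_coef_def)
  qed
  then show ?thesis by blast
qed

text \<open>Makes the relation between a function and its partner closed under limits, on which
  completeness of the space rests.\<close>

lemma toeplitz_coef_limit:
  assumes p: "p \<in> Hinf" and f: "\<And>k. f k \<in> H2" and g: "g \<in> H2"
    and lim: "(\<lambda>k. \<Sum>n. (norm (coef (f k) n - coef g n))\<^sup>2) \<longlonglongrightarrow> 0"
  shows "(\<lambda>k. toeplitz_coef p (f k) n) \<longlonglongrightarrow> toeplitz_coef p g n"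
proof -
  obtain B where B: "\<forall>f\<in>H2. \<forall>n. (norm (toeplitz_coef p f n))\<^sup>2 \<le> B * (\<Sum>n. (norm (coef f n))\<^sup>2)"
    using toeplitz_coef_bound[OF p] by (elim exE)
  have b: "(norm (toeplitz_coef p (f k) n - toeplitz_coef p g n))\<^sup>2 \<le> B * (\<Sum>n. (norm (coef (f k) n - coef g n))\<^sup>2)" for k
    using bspec[OF B H2_diff[OF f g], of k]
    by (simp add: toeplitz_coef_diff[OF p f g] coef_diff[OF H2_hol[OF f] H2_hol[OF g]])
  have "(\<lambda>k. (norm (toeplitz_coef p (f k) n - toeplitz_coef p g n))\<^sup>2) \<longlonglongrightarrow> 0"
  proof (rule tendsto_sandwich[OF _ _ tendsto_const])
    show "(\<lambda>k. B * (\<Sum>n. (norm (coef (f k) n - coef g n))\<^sup>2)) \<longlonglongrightarrow> 0"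
      by (rule tendsto_mult_right_zero[OF lim])
  qed (use b in auto)
  then have "(\<lambda>k. norm (toeplitz_coef p (f k) n - toeplitz_coef p g n)) \<longlonglongrightarrow> 0"
    by (simp add: power_tendsto_0_iff)
  then have "(\<lambda>k. toeplitz_coef p (f k) n - toeplitz_coef p g n) \<longlonglongrightarrow> 0" by (rule tendsto_norm_zero_cancel)
  then show ?thesis by (rule LIM_zero_cancel)
qed

text \<open>The right-hand sides are the coefficients of \<open>cnj (G w)\<close> times the Szego
  kernel: this is the eigenvector property. It is the conjugate of Cauchy's formula for
  \<open>z ^ n * G z\<close> at \<open>w\<close>.\<close>

lemma fourier_cnj_bdry_cauchy:
  assumes G: "G \<in> H2" and w: "w \<in> disc"
  shows "fourier (\<lambda>\<zeta>. cnj (bdry G \<zeta>) / (1 - cnj w * \<zeta>)) n = cnj (w ^ n * G w)"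
proof -
  note q = H2_mult_power[OF G, of n]
  have w1: "norm w < 1" using w by simp
  have [measurable]: "bdry G \<in> borel_measurable borel" "bdry (\<lambda>z. z ^ n * G z) \<in> borel_measurable borel"
    using L2_circle_measurable bdry_L2 G q(1) by auto
  have "w ^ n * G w = (LINT \<zeta>|circle. bdry (\<lambda>z. z ^ n * G z) \<zeta> / (1 - w * cnj \<zeta>))"
    by (rule cauchy_formula_bdry[OF q(1) w1])
  also have "\<dots> = (LINT \<zeta>|circle. cnj (cnj (bdry G \<zeta>) / (1 - cnj w * \<zeta>) * cnj \<zeta> ^ n))"
  proof (rule integral_cong_AE)
    show "AE \<zeta> in circle. bdry (\<lambda>z. z ^ n * G z) \<zeta> / (1 - w * cnj \<zeta>) =
        cnj (cnj (bdry G \<zeta>) / (1 - cnj w * \<zeta>) * cnj \<zeta> ^ n)"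
      using q(2) by eventually_elim simp
  qed measurable
  also have "\<dots> = cnj (fourier (\<lambda>\<zeta>. cnj (bdry G \<zeta>) / (1 - cnj w * \<zeta>)) n)"
    unfolding fourier_def by (rule Bochner_Integration.integral_cnj)
  finally show ?thesis by simp
qed

section \<open>The Hilbert space of functions with a partner, for a fixed pair\<close>

locale mate =
  fixes a b :: "complex \<Rightarrow> complex"
  assumes b: "b \<in> Hinf_unit_ball" and ab: "pythagorean_mate b a"
begin

lemma a_Hinf: "a \<in> Hinf" and a_outer: "outer a"
  using ab by (auto simp: pythagorean_mate_def)

lemma b_Hinf: "b \<in> Hinf"
  using b by (simp add: Hinf_unit_ball_def)

lemma AE_mate: "AE \<zeta> in circle. cnj (bdry b \<zeta>) * bdry b \<zeta> + cnj (bdry a \<zeta>) * bdry a \<zeta> = 1"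
proof -
  have "AE \<zeta> in circle. (norm (bdry a \<zeta>))\<^sup>2 + (norm (bdry b \<zeta>))\<^sup>2 = 1"
    using ab by (simp add: pythagorean_mate_def)
  then show ?thesis
  proof eventually_elim
    case (elim \<zeta>)
    have "cnj (bdry b \<zeta>) * bdry b \<zeta> + cnj (bdry a \<zeta>) * bdry a \<zeta> =
       of_real ((norm (bdry a \<zeta>))\<^sup>2 + (norm (bdry b \<zeta>))\<^sup>2)"
      unfolding of_real_add complex_norm_square by (simp add: mult.commute add.commute)
    then show ?case unfolding elim by simp
  qed
qed

text \<open>A relation on coefficients, so that linearity and limits are treated apart from the
  definite description in \<open>dbr_plus\<close>.\<close>

definition plus_pair :: "(complex \<Rightarrow> complex) \<Rightarrow> (complex \<Rightarrow> complex) \<Rightarrow> bool" where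
  "plus_pair f h \<longleftrightarrow> f \<in> H2 \<and> h \<in> H2 \<and> toeplitz_coef b f = toeplitz_coef a h"

lemma plus_pair_H2: "plus_pair f h \<Longrightarrow> f \<in> H2" "plus_pair f h \<Longrightarrow> h \<in> H2"
  by (simp_all add: plus_pair_def)

lemma plus_pair_unique:
  assumes "plus_pair f h" "plus_pair f h'"
  shows "h = h'"
proof -
  have h: "h \<in> H2" "h' \<in> H2" "toeplitz_coef a h = toeplitz_coef a h'"
    using assms by (auto simp: plus_pair_def)
  have "(\<lambda>z. h z - h' z) = (\<lambda>z. 0)"
    by (rule outer_toeplitz_injective[OF a_Hinf a_outer H2_diff[OF h(1,2)]])
      (simp add: toeplitz_coef_diff[OF a_Hinf h(1,2)] h(3))
  then show ?thesis by (simp add: fun_eq_iff)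
qed

lemma plus_pair_add:
  assumes "plus_pair f h" "plus_pair f' h'"
  shows "plus_pair (\<lambda>z. f z + f' z) (\<lambda>z. h z + h' z)"
  using assms by (auto simp: plus_pair_def H2_add fun_eq_iff toeplitz_coef_add a_Hinf b_Hinf)

lemma plus_pair_scale: "plus_pair f h \<Longrightarrow> plus_pair (\<lambda>z. c * f z) (\<lambda>z. c * h z)"
  by (auto simp: plus_pair_def H2_scale fun_eq_iff toeplitz_coef_scale a_Hinf b_Hinf)

lemma plus_pair_diff:
  assumes "plus_pair f h" "plus_pair f' h'"
  shows "plus_pair (\<lambda>z. f z - f' z) (\<lambda>z. h z - h' z)"
  using plus_pair_add[OF assms(1) plus_pair_scale[OF assms(2), of "-1"]] by simp

lemma dbr_plus_eq:
  assumes "plus_pair f h"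
  shows "dbr_plus b a f = h"
  unfolding dbr_plus_def
proof (rule the_equality)
  have eq: "h' \<in> H2 \<and> toeplitz (\<lambda>\<zeta>. cnj (bdry b \<zeta>)) f = toeplitz (\<lambda>\<zeta>. cnj (bdry a \<zeta>)) h' \<longleftrightarrow> plus_pair f h'" for h'
    using toeplitz_cnj_eq_iff[OF b_Hinf _ a_Hinf] plus_pair_H2[OF assms] by (auto simp: plus_pair_def)
  show "h \<in> H2 \<and> toeplitz (\<lambda>\<zeta>. cnj (bdry b \<zeta>)) f = toeplitz (\<lambda>\<zeta>. cnj (bdry a \<zeta>)) h"
    unfolding eq by (rule assms)
  show "h' = h" if "h' \<in> H2 \<and> toeplitz (\<lambda>\<zeta>. cnj (bdry b \<zeta>)) f = toeplitz (\<lambda>\<zeta>. cnj (bdry a \<zeta>)) h'" for h'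
    using that unfolding eq by (rule plus_pair_unique[OF _ assms])
qed

definition plus_space :: "(complex \<Rightarrow> complex) set" where
  "plus_space = {f. \<exists>h. plus_pair f h}"

definition plus_inner :: "(complex \<Rightarrow> complex) \<Rightarrow> (complex \<Rightarrow> complex) \<Rightarrow> complex" where
  "plus_inner f g = h2_inner f g + h2_inner (dbr_plus b a f) (dbr_plus b a g)"

lemma plus_pair_dbr_plus: "f \<in> plus_space \<Longrightarrow> plus_pair f (dbr_plus b a f)"
  by (auto simp: plus_space_def dbr_plus_eq)

lemma plus_spaceI: "plus_pair f h \<Longrightarrow> f \<in> plus_space"
  by (auto simp: plus_space_def)

lemma plus_inner_eq:
  "plus_pair f h \<Longrightarrow> plus_pair f' h' \<Longrightarrow> plus_inner f f' = h2_inner f f' + h2_inner h h'"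
  by (simp add: plus_inner_def dbr_plus_eq)

lemma mult_szego_H2: "f \<in> H2 \<Longrightarrow> w \<in> disc \<Longrightarrow> (\<lambda>z. f z * szego w z) \<in> H2"
  using Hinf_mult_H2[OF szego_Hinf, of w f] by (simp add: mult.commute)

lemma bdry_mult_szego:
  assumes "f \<in> H2" "w \<in> disc"
  shows "AE \<zeta> in circle. bdry (\<lambda>z. f z * szego w z) \<zeta> = bdry f \<zeta> / (1 - cnj w * \<zeta>)"
  using bdry_mult[OF assms(1) Hinf_H2[OF szego_Hinf[OF assms(2)]]] bdry_szego[OF assms(2)]
  by eventually_elim simp

lemma dbr_kernel_eq: "dbr_kernel b w = (\<lambda>z. szego w z - cnj (b w) * (b z * szego w z))"
  by (auto simp: dbr_kernel_def szego_def fun_eq_iff diff_divide_distrib)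

text \<open>Let \<open>k\<close> be the Szego kernel at \<open>w\<close>. The image of
  \<open>k\<close> under the operator with symbol \<open>cnj b\<close> is \<open>cnj (b w)\<close>
  times \<open>k\<close>, and by \<open>AE_mate\<close> the images of \<open>b k\<close> and
  \<open>a k\<close> under their operators add up to \<open>k\<close>. Eliminating \<open>k\<close>
  leaves \<open>cnj (b w)\<close> times the image of \<open>a k\<close>.\<close>

lemma plus_pair_kernel:
  assumes w: "w \<in> disc"
  shows "plus_pair (dbr_kernel b w) (\<lambda>z. cnj (b w) * (a z * szego w z))"
proof -
  have aH: "a \<in> H2" and bH: "b \<in> H2" using a_Hinf b_Hinf Hinf_H2 by auto
  note k = Hinf_H2[OF szego_Hinf[OF w]]
  note bk = mult_szego_H2[OF bH w] and ak = mult_szego_H2[OF aH w]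
  \<comment> \<open>The constant 1, cut off outside the disc, so that the coefficients of
    \<open>k\<close> itself come from the eigenvector property with \<open>G = 1\<close>.\<close>
  have one: "(\<lambda>z. if z \<in> disc then 1 else 0) \<in> Hinf"
  proof -
    have "(\<lambda>z. if z \<in> disc then 1 else 0 :: complex) holomorphic_on disc"
      by (rule holomorphic_transform[of "\<lambda>z. 1"]) auto
    then show ?thesis by (auto simp: Hinf_def hol_disc_def bounded_iff intro!: exI[of _ 1])
  qed
  have [measurable]: "bdry a \<in> borel_measurable borel" "bdry b \<in> borel_measurable borel"
    "bdry (szego w) \<in> borel_measurable borel" "bdry (\<lambda>z. b z * szego w z) \<in> borel_measurable borel"
    "bdry (\<lambda>z. a z * szego w z) \<in> borel_measurable borel"
    using L2_circle_measurable[OF bdry_L2] aH bH k bk ak by auto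
  have t1: "toeplitz_coef b (szego w) n = cnj (w ^ n * b w)" for n
  proof -
    have "toeplitz_coef b (szego w) n = fourier (\<lambda>\<zeta>. cnj (bdry b \<zeta>) / (1 - cnj w * \<zeta>)) n"
      unfolding toeplitz_coef_def
    proof (rule fourier_cong_AE)
      show "AE \<zeta> in circle. cnj (bdry b \<zeta>) * bdry (szego w) \<zeta> = cnj (bdry b \<zeta>) / (1 - cnj w * \<zeta>)"
        using bdry_szego[OF w] by eventually_elim simp
    qed measurable
    then show ?thesis unfolding fourier_cnj_bdry_cauchy[OF bH w] .
  qed
  have t2: "toeplitz_coef b (\<lambda>z. b z * szego w z) n + toeplitz_coef a (\<lambda>z. a z * szego w z) n = cnj (w ^ n)" for n
  proof -
    have "toeplitz_coef b (\<lambda>z. b z * szego w z) n + toeplitz_coef a (\<lambda>z. a z * szego w z) n =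
      fourier (\<lambda>\<zeta>. cnj (bdry b \<zeta>) * bdry (\<lambda>z. b z * szego w z) \<zeta> + cnj (bdry a \<zeta>) * bdry (\<lambda>z. a z * szego w z) \<zeta>) n"
      unfolding toeplitz_coef_def
      by (intro fourier_add[symmetric] L2_circle_integrable L2_circle_cnj_bdry_mult a_Hinf b_Hinf bdry_L2 ak bk)
    also have "\<dots> = fourier (\<lambda>\<zeta>. cnj (bdry (\<lambda>z. if z \<in> disc then 1 else 0) \<zeta>) / (1 - cnj w * \<zeta>)) n"
    proof (rule fourier_cong_AE)
      have "AE \<zeta> in circle. bdry (\<lambda>z. if z \<in> disc then 1 else 0) \<zeta> = (1::complex)"
      proof (rule AE_circleI)
        fix \<zeta> :: complex assume n: "norm \<zeta> = 1"
        have "\<forall>\<^sub>F r in at_left 1. (if of_real r * \<zeta> \<in> disc then 1 else 0 :: complex) = 1"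
          using eventually_at_left_real[of 0 1] n by (auto elim!: eventually_mono simp: norm_mult)
        then show "bdry (\<lambda>z. if z \<in> disc then 1 else 0) \<zeta> = (1::complex)"
          by (intro radial_tendsto_imp_bdry tendsto_eventually)
      qed
      then show "AE \<zeta> in circle. cnj (bdry b \<zeta>) * bdry (\<lambda>z. b z * szego w z) \<zeta> + cnj (bdry a \<zeta>) * bdry (\<lambda>z. a z * szego w z) \<zeta> =
         cnj (bdry (\<lambda>z. if z \<in> disc then 1 else 0) \<zeta>) / (1 - cnj w * \<zeta>)"
        using bdry_mult_szego[OF bH w] bdry_mult_szego[OF aH w] AE_mate
        by eventually_elim (simp add: add_divide_distrib[symmetric])
      show "(\<lambda>\<zeta>. cnj (bdry (\<lambda>z. if z \<in> disc then 1 else 0) \<zeta>) / (1 - cnj w * \<zeta>)) \<in> borel_measurable borel"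
        using L2_circle_measurable[OF bdry_L2[OF Hinf_H2[OF one]]] by measurable
    qed measurable
    also have "\<dots> = cnj (w ^ n)" unfolding fourier_cnj_bdry_cauchy[OF Hinf_H2[OF one] w] using w by simp
    finally show ?thesis .
  qed
  have "toeplitz_coef b (dbr_kernel b w) n = toeplitz_coef a (\<lambda>z. cnj (b w) * (a z * szego w z)) n" for n
  proof -
    have e: "toeplitz_coef a (\<lambda>z. a z * szego w z) n = cnj (w ^ n) - toeplitz_coef b (\<lambda>z. b z * szego w z) n"
      using t2[of n] by (simp only: eq_diff_eq add.commute)
    show ?thesis
      unfolding dbr_kernel_eq toeplitz_coef_diff[OF b_Hinf k H2_scale[OF bk]]
        toeplitz_coef_scale[OF b_Hinf bk] toeplitz_coef_scale[OF a_Hinf ak] t1 e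
      by (simp only: complex_cnj_mult right_diff_distrib mult.commute)
  qed
  moreover have "dbr_kernel b w \<in> H2" unfolding dbr_kernel_eq by (intro H2_diff H2_scale k bk)
  ultimately show ?thesis using H2_scale[OF ak] by (auto simp: plus_pair_def)
qed

text \<open>Multiplication by \<open>p\<close> is the adjoint of the Toeplitz operator with symbol
  \<open>cnj p\<close>, so both sides are the value at \<open>w\<close> of that operator applied to
  \<open>f\<close>.\<close>

lemma h2_inner_szego:
  assumes f: "f \<in> H2" and p: "p \<in> Hinf" and w: "w \<in> disc"
  shows "(\<lambda>n. toeplitz_coef p f n * w ^ n) sums h2_inner f (\<lambda>z. p z * szego w z)"
proof -
  have w1: "norm w < 1" using w by simp
  have pH: "p \<in> H2" by (rule Hinf_H2[OF p])
  note pk = mult_szego_H2[OF pH w]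
  have [measurable]: "bdry f \<in> borel_measurable borel" "bdry p \<in> borel_measurable borel"
    "bdry (\<lambda>z. p z * szego w z) \<in> borel_measurable borel"
    using L2_circle_measurable[OF bdry_L2] f pH pk by auto
  have "(\<lambda>n. toeplitz_coef p f n * w ^ n) sums (LINT \<zeta>|circle. cnj (bdry p \<zeta>) * bdry f \<zeta> / (1 - w * cnj \<zeta>))"
    unfolding toeplitz_coef_def
    by (rule cauchy_transform[OF L2_circle_integrable[OF L2_circle_cnj_bdry_mult[OF p bdry_L2[OF f]]] w1])
  also have "(LINT \<zeta>|circle. cnj (bdry p \<zeta>) * bdry f \<zeta> / (1 - w * cnj \<zeta>)) = L2_inner (bdry f) (bdry (\<lambda>z. p z * szego w z))"
    unfolding L2_inner_def
  proof (rule integral_cong_AE)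
    show "AE \<zeta> in circle. cnj (bdry p \<zeta>) * bdry f \<zeta> / (1 - w * cnj \<zeta>) = bdry f \<zeta> * cnj (bdry (\<lambda>z. p z * szego w z) \<zeta>)"
      using bdry_mult_szego[OF pH w] by eventually_elim (simp add: mult.commute)
  qed measurable
  finally show ?thesis unfolding h2_inner_eq[OF f pk] .
qed

lemma h2_inner_reproducing:
  assumes f: "f \<in> H2" and w: "w \<in> disc"
  shows "h2_inner f (szego w) = f w"
proof -
  note k = Hinf_H2[OF szego_Hinf[OF w]]
  have [measurable]: "bdry f \<in> borel_measurable borel" "bdry (szego w) \<in> borel_measurable borel"
    using L2_circle_measurable[OF bdry_L2] f k by auto
  have "h2_inner f (szego w) = (LINT \<zeta>|circle. bdry f \<zeta> / (1 - w * cnj \<zeta>))"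
    unfolding h2_inner_eq[OF f k] L2_inner_def
  proof (rule integral_cong_AE)
    show "AE \<zeta> in circle. bdry f \<zeta> * cnj (bdry (szego w) \<zeta>) = bdry f \<zeta> / (1 - w * cnj \<zeta>)"
      using bdry_szego[OF w] by eventually_elim simp
  qed measurable
  then show ?thesis using cauchy_formula_bdry[OF f, of w] w by simp
qed

lemma h2_inner_diff_right:
  assumes "f \<in> H2" "g \<in> H2" "h \<in> H2"
  shows "h2_inner f (\<lambda>z. g z - c * h z) = h2_inner f g - cnj c * h2_inner f h"
proof -
  have "h2_inner (\<lambda>z. g z + (- c) * h z) f = h2_inner g f + (- c) * h2_inner h f"
    using assms by (simp only: h2_inner_add h2_inner_scale H2_scale)
  then have "cnj (h2_inner (\<lambda>z. g z - c * h z) f) = cnj (h2_inner g f) - cnj c * cnj (h2_inner h f)" by simp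
  then show ?thesis
    using assms H2_diff[OF assms(2) H2_scale[OF assms(3), of c]] by (simp only: h2_inner_cnj[symmetric])
qed

lemma rkhs_plus_space: "rkhs disc (dbr_kernel b) plus_space plus_inner"
proof
  note pp = plus_pair_dbr_plus
  show "f z = 0" if "f \<in> plus_space" "z \<notin> disc" for f z
    using H2_hol[OF plus_pair_H2(1)[OF pp[OF that(1)]]] that(2) by (auto simp: hol_disc_def)
  show add: "(\<lambda>z. f z + g z) \<in> plus_space" if "f \<in> plus_space" "g \<in> plus_space" for f g
    by (rule plus_spaceI[OF plus_pair_add[OF pp[OF that(1)] pp[OF that(2)]]])
  show scale: "(\<lambda>z. c * f z) \<in> plus_space" if "f \<in> plus_space" for f c
    by (rule plus_spaceI[OF plus_pair_scale[OF pp[OF that]]])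
  show ker: "dbr_kernel b w \<in> plus_space" if "w \<in> disc" for w
    by (rule plus_spaceI[OF plus_pair_kernel[OF that]])
  have "0 \<in> disc" by simp
  from scale[OF ker[OF this], of 0] show "(\<lambda>z. 0) \<in> plus_space" by simp
  show "plus_inner (\<lambda>z. f z + g z) h = plus_inner f h + plus_inner g h"
    if "f \<in> plus_space" "g \<in> plus_space" "h \<in> plus_space" for f g h
    unfolding plus_inner_eq[OF plus_pair_add[OF pp[OF that(1)] pp[OF that(2)]] pp[OF that(3)]] unfolding plus_inner_def
    using that by (simp add: h2_inner_add plus_pair_H2[OF pp])
  show "plus_inner (\<lambda>z. c * f z) h = c * plus_inner f h"
    if "f \<in> plus_space" "h \<in> plus_space" for f h c
    unfolding plus_inner_eq[OF plus_pair_scale[OF pp[OF that(1)]] pp[OF that(2)]] unfolding plus_inner_def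
    using that by (simp add: h2_inner_scale plus_pair_H2[OF pp] distrib_left)
  show "plus_inner g f = cnj (plus_inner f g)" if "f \<in> plus_space" "g \<in> plus_space" for f g
    unfolding plus_inner_def complex_cnj_add using plus_pair_H2[OF pp[OF that(1)]] plus_pair_H2[OF pp[OF that(2)]]
    by (simp only: h2_inner_cnj[of f g] h2_inner_cnj[of "dbr_plus b a f" "dbr_plus b a g"])
  show "0 < Re (plus_inner f f)" if "f \<in> plus_space" "f \<noteq> (\<lambda>z. 0)" for f
  proof -
    note h = plus_pair_H2[OF pp[OF that(1)]]
    have "0 \<le> Re (h2_inner (dbr_plus b a f) (dbr_plus b a f))"
      unfolding Re_h2_inner_self[OF h(2)] by (intro suminf_nonneg H2_summable h) simp
    with h2_inner_pos[OF h(1) that(2)] show ?thesis by (simp add: plus_inner_def)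
  qed
  show "plus_inner f (dbr_kernel b w) = f w" if w: "w \<in> disc" and f: "f \<in> plus_space" for f w
  proof -
    note h = plus_pair_H2[OF pp[OF f]]
    have aH: "a \<in> H2" and bH: "b \<in> H2" using a_Hinf b_Hinf Hinf_H2 by auto
    note k = Hinf_H2[OF szego_Hinf[OF w]]
    note bk = mult_szego_H2[OF bH w] and ak = mult_szego_H2[OF aH w]
    \<comment> \<open>Both are the value at \<open>w\<close> of the common Toeplitz image of
      \<open>f\<close> and its partner. In the pairing with the kernel function they carry the
      factors \<open>- b w\<close> and \<open>b w\<close> and cancel, which leaves
      \<open>f w\<close>.\<close>
    have e: "h2_inner f (\<lambda>z. b z * szego w z) = h2_inner (dbr_plus b a f) (\<lambda>z. a z * szego w z)"
    proof (rule sums_unique2[OF h2_inner_szego[OF h(1) b_Hinf w]])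
      show "(\<lambda>n. toeplitz_coef b f n * w ^ n) sums h2_inner (dbr_plus b a f) (\<lambda>z. a z * szego w z)"
        using h2_inner_szego[OF h(2) a_Hinf w] pp[OF f] by (simp add: plus_pair_def)
    qed
    have "h2_inner (dbr_plus b a f) (\<lambda>z. cnj (b w) * (a z * szego w z)) = b w * h2_inner (dbr_plus b a f) (\<lambda>z. a z * szego w z)"
      using h2_inner_cnj[OF H2_scale[OF ak, of "cnj (b w)"] h(2)] h2_inner_cnj[OF ak h(2)] h2_inner_scale[OF ak h(2), of "cnj (b w)"]
      by simp
    then show ?thesis
      unfolding plus_inner_eq[OF pp[OF f] plus_pair_kernel[OF w]]
      unfolding dbr_kernel_eq h2_inner_diff_right[OF h(1) k bk]
        h2_inner_reproducing[OF h(1) w] by (simp add: e)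
  qed
  fix X :: "nat \<Rightarrow> complex \<Rightarrow> complex"
  assume X: "\<And>n. X n \<in> plus_space"
    and C: "\<And>e. 0 < e \<Longrightarrow> \<exists>N. \<forall>m\<ge>N. \<forall>n\<ge>N. sqrt (Re (plus_inner (\<lambda>z. X m z - X n z) (\<lambda>z. X m z - X n z))) < e"
  define Y where "Y n = dbr_plus b a (X n)" for n
  have XY: "plus_pair (X n) (Y n)" for n unfolding Y_def by (rule pp[OF X])
  note XH = plus_pair_H2(1)[OF XY] and YH = plus_pair_H2(2)[OF XY]
  \<comment> \<open>The squared norm of a difference splits into two sequence norms, so a Cauchy
    sequence is Cauchy in both components and the limits can be taken separately.\<close>
  have n2: "Re (plus_inner (\<lambda>z. f z - f' z) (\<lambda>z. f z - f' z)) =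
      (\<Sum>n. (norm (coef f n - coef f' n))\<^sup>2) + (\<Sum>n. (norm (coef h n - coef h' n))\<^sup>2)"
    if "plus_pair f h" "plus_pair f' h'" for f f' h h'
  proof -
    note p = plus_pair_diff[OF that]
    note H = plus_pair_H2[OF that(1)] plus_pair_H2[OF that(2)]
    show ?thesis
      unfolding plus_inner_eq[OF p p] plus_complex.sel Re_h2_inner_self[OF plus_pair_H2(1)[OF p]] Re_h2_inner_self[OF plus_pair_H2(2)[OF p]]
        coef_diff(2)[OF H2_hol[OF H(1)] H2_hol[OF H(3)]] coef_diff(2)[OF H2_hol[OF H(2)] H2_hol[OF H(4)]] ..
  qed
  have dn: "0 \<le> (\<Sum>n. (norm (coef f n - coef f' n))\<^sup>2)" if "f \<in> H2" "f' \<in> H2" for f f'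
    using H2_summable[OF H2_diff[OF that]] coef_diff(2)[OF H2_hol[OF that(1)] H2_hol[OF that(2)]]
    by (intro suminf_nonneg) simp_all
  have C2: "\<exists>N. \<forall>k\<ge>N. \<forall>l\<ge>N. (\<Sum>n. (norm (coef (X k) n - coef (X l) n))\<^sup>2) \<le> e \<and> (\<Sum>n. (norm (coef (Y k) n - coef (Y l) n))\<^sup>2) \<le> e"
    if e: "0 < e" for e
  proof -
    obtain N where N: "\<And>m n. m \<ge> N \<Longrightarrow> n \<ge> N \<Longrightarrow> sqrt (Re (plus_inner (\<lambda>z. X m z - X n z) (\<lambda>z. X m z - X n z))) < sqrt e"
      using C[of "sqrt e"] e by auto
    have "(\<Sum>n. (norm (coef (X k) n - coef (X l) n))\<^sup>2) \<le> e \<and> (\<Sum>n. (norm (coef (Y k) n - coef (Y l) n))\<^sup>2) \<le> e"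
      if "k \<ge> N" "l \<ge> N" for k l
      using N[OF that] dn[OF XH XH, of k l] dn[OF YH YH, of k l] unfolding n2[OF XY XY] real_sqrt_less_iff by linarith
    then show ?thesis by blast
  qed
  have CX: "\<exists>N. \<forall>k\<ge>N. \<forall>l\<ge>N. (\<Sum>n. (norm (coef (X k) n - coef (X l) n))\<^sup>2) \<le> e"
    and CY: "\<exists>N. \<forall>k\<ge>N. \<forall>l\<ge>N. (\<Sum>n. (norm (coef (Y k) n - coef (Y l) n))\<^sup>2) \<le> e" if "0 < e" for e
    using C2[OF that] by blast+
  have LX: "\<exists>y. summable (\<lambda>n. (norm (y n))\<^sup>2) \<and> (\<lambda>k. \<Sum>n. (norm (coef (X k) n - y n))\<^sup>2) \<longlonglongrightarrow> 0"
    by (rule square_summable_complete[OF H2_summable[OF XH]]) (rule CX)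
  have LY: "\<exists>y. summable (\<lambda>n. (norm (y n))\<^sup>2) \<and> (\<lambda>k. \<Sum>n. (norm (coef (Y k) n - y n))\<^sup>2) \<longlonglongrightarrow> 0"
    by (rule square_summable_complete[OF H2_summable[OF YH]]) (rule CY)
  obtain x where x: "summable (\<lambda>n. (norm (x n))\<^sup>2)" "(\<lambda>k. \<Sum>n. (norm (coef (X k) n - x n))\<^sup>2) \<longlonglongrightarrow> 0"
    using LX by (elim exE conjE)
  obtain y where y: "summable (\<lambda>n. (norm (y n))\<^sup>2)" "(\<lambda>k. \<Sum>n. (norm (coef (Y k) n - y n))\<^sup>2) \<longlonglongrightarrow> 0"
    using LY by (elim exE conjE)
  define f h where "f = of_coef x" and "h = of_coef y"
  have f: "f \<in> H2" "coef f = x" and h: "h \<in> H2" "coef h = y"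
    unfolding f_def h_def using of_coef_H2[OF x(1)] of_coef_H2[OF y(1)] by auto
  have "toeplitz_coef b f n = toeplitz_coef a h n" for n
  proof (rule LIMSEQ_unique)
    show "(\<lambda>k. toeplitz_coef b (X k) n) \<longlonglongrightarrow> toeplitz_coef b f n"
      by (rule toeplitz_coef_limit[OF b_Hinf XH f(1)]) (simp add: f(2) x(2))
    have "(\<lambda>k. toeplitz_coef a (Y k) n) \<longlonglongrightarrow> toeplitz_coef a h n"
      by (rule toeplitz_coef_limit[OF a_Hinf YH h(1)]) (simp add: h(2) y(2))
    then show "(\<lambda>k. toeplitz_coef b (X k) n) \<longlonglongrightarrow> toeplitz_coef a h n"
      using XY by (simp add: plus_pair_def)
  qed
  then have fh: "plus_pair f h" using f h by (auto simp: plus_pair_def)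
  have "(\<lambda>k. sqrt (Re (plus_inner (\<lambda>z. X k z - f z) (\<lambda>z. X k z - f z)))) \<longlonglongrightarrow> sqrt (0 + 0)"
    unfolding n2[OF XY fh] f(2) h(2) by (intro tendsto_intros x y)
  then show "\<exists>f\<in>plus_space. (\<lambda>k. sqrt (Re (plus_inner (\<lambda>z. X k z - f z) (\<lambda>z. X k z - f z)))) \<longlonglongrightarrow> 0"
    using plus_spaceI[OF fh] by auto
qed

lemma dbr_space_eq: "dbr_space b = plus_space"
  unfolding dbr_space_def
proof (rule the_equality)
  show "\<exists>ip. rkhs disc (dbr_kernel b) plus_space ip" by (rule exI) (rule rkhs_plus_space)
  show "H = plus_space" if "\<exists>ip. rkhs disc (dbr_kernel b) H ip" for H
    using that by (elim exE) (rule rkhs_unique[OF _ rkhs_plus_space])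
qed

text \<open>Equal Toeplitz images mean that \<open>u\<close> has frequencies at most -1 only.
  Conjugation turns them into frequencies at least 1, and the factor \<open>cnj \<zeta>\<close>
  lowers them by one, so \<open>v\<close> is the boundary function of an element of
  \<open>H2\<close>.\<close>

lemma dbr_coanalytic:
  assumes "plus_pair f h"
  shows "dbr_coanalytic b a f \<in> H2"
    and "AE \<zeta> in circle. cnj (bdry b \<zeta>) * bdry f \<zeta> =
      cnj (bdry a \<zeta>) * bdry h \<zeta> + cnj (\<zeta> * bdry (dbr_coanalytic b a f) \<zeta>)"
proof -
  note H = plus_pair_H2[OF assms]
  define u where "u \<zeta> = cnj (bdry b \<zeta>) * bdry f \<zeta> - cnj (bdry a \<zeta>) * bdry h \<zeta>" for \<zeta>
  have u: "u \<in> L2_circle"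
    unfolding u_def by (intro L2_circle_diff L2_circle_cnj_bdry_mult a_Hinf b_Hinf bdry_L2 H)
  have fu: "fourier u n = 0" for n
    using fun_cong[of "toeplitz_coef b f" "toeplitz_coef a h" n] assms
    unfolding u_def toeplitz_coef_def plus_pair_def
    by (subst fourier_diff) (auto intro!: L2_circle_integrable L2_circle_cnj_bdry_mult a_Hinf b_Hinf bdry_L2)
  have [measurable]: "u \<in> borel_measurable borel" by (rule L2_circle_measurable[OF u])
  define v where "v \<zeta> = cnj \<zeta> * cnj (u \<zeta>)" for \<zeta>
  have v: "v \<in> L2_circle"
    by (rule L2_circle_dominated[OF u, of _ 1]) (auto simp: v_def[abs_def] norm_mult intro!: AE_circleI)
  have "(LINT \<zeta>|circle. v \<zeta> * \<zeta> ^ n) = 0" if n: "0 < n" for n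
  proof -
    obtain m where m: "n = Suc m" using n gr0_implies_Suc by blast
    have "(LINT \<zeta>|circle. v \<zeta> * \<zeta> ^ n) = (LINT \<zeta>|circle. cnj (u \<zeta> * cnj \<zeta> ^ m))"
    proof (rule integral_circle_cong)
      fix \<zeta> :: complex assume "norm \<zeta> = 1"
      have "v \<zeta> * \<zeta> ^ n = (cnj \<zeta> * \<zeta>) * (cnj (u \<zeta>) * \<zeta> ^ m)" by (simp add: v_def m mult_ac)
      then show "v \<zeta> * \<zeta> ^ n = cnj (u \<zeta> * cnj \<zeta> ^ m)" unfolding circle_cancel[OF \<open>norm \<zeta> = 1\<close>] by simp
    qed (simp_all add: v_def)
    also have "\<dots> = cnj (fourier u m)" unfolding fourier_def by (rule Bochner_Integration.integral_cnj)
    finally show ?thesis by (simp add: fu)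
  qed
  then have vg: "AE \<zeta> in circle. v \<zeta> = bdry (of_coef (fourier v)) \<zeta>" by (rule L2_circle_eq_bdry[OF v])
  define g where "g = of_coef (fourier v)"
  have g: "g \<in> H2" unfolding g_def by (rule of_coef_H2[OF bessel_summable(1)[OF v]])
  have ug: "AE \<zeta> in circle. cnj (bdry b \<zeta>) * bdry f \<zeta> = cnj (bdry a \<zeta>) * bdry h \<zeta> + cnj (\<zeta> * bdry g \<zeta>)"
    using vg AE_circle_norm
  proof eventually_elim
    case (elim \<zeta>)
    have "\<zeta> * v \<zeta> = cnj (u \<zeta>)" using circle_cancel[OF elim(2)] by (simp add: v_def mult.assoc[symmetric])
    then have "cnj (\<zeta> * bdry g \<zeta>) = u \<zeta>" using elim(1) by (simp add: g_def)
    then show ?case by (simp add: u_def)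
  qed
  have "dbr_coanalytic b a f = g"
    unfolding dbr_coanalytic_def dbr_plus_eq[OF assms]
  proof (rule the_equality)
    show "g \<in> H2 \<and> (AE \<zeta> in circle. cnj (bdry b \<zeta>) * bdry f \<zeta> = cnj (bdry a \<zeta>) * bdry h \<zeta> + cnj (\<zeta> * bdry g \<zeta>))"
      using g ug by blast
    fix g' assume g': "g' \<in> H2 \<and> (AE \<zeta> in circle. cnj (bdry b \<zeta>) * bdry f \<zeta> = cnj (bdry a \<zeta>) * bdry h \<zeta> + cnj (\<zeta> * bdry g' \<zeta>))"
    have "AE \<zeta> in circle. bdry g' \<zeta> = bdry g \<zeta>"
      using conjunct2[OF g'] ug AE_circle_norm
    proof eventually_elim
      case (elim \<zeta>)
      have "cnj (\<zeta> * bdry g' \<zeta>) = cnj (\<zeta> * bdry g \<zeta>)"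
        using trans[OF elim(1)[symmetric] elim(2)] by (simp only: add_left_cancel)
      then have "\<zeta> * bdry g' \<zeta> = \<zeta> * bdry g \<zeta>" by (simp only: complex_cnj_cancel_iff)
      moreover have "\<zeta> \<noteq> 0" using elim(3) by auto
      ultimately show ?case by simp
    qed
    then have "fourier (bdry g') n = fourier (bdry g) n" for n
      using g g' by (intro fourier_cong_AE L2_circle_measurable bdry_L2) auto
    then show "g' = g"
      using g g' by (intro hol_disc_coef_eqI H2_hol) (auto simp: fourier_bdry)
  qed
  then show "dbr_coanalytic b a f \<in> H2" "AE \<zeta> in circle. cnj (bdry b \<zeta>) * bdry f \<zeta> =
      cnj (bdry a \<zeta>) * bdry h \<zeta> + cnj (\<zeta> * bdry (dbr_coanalytic b a f) \<zeta>)"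
    using g ug by auto
qed

text \<open>For any choice of \<open>\<gamma>\<close> the eigenvector property leaves
  \<open>cnj (G w)\<close> times the Szego kernel as the difference of the two Toeplitz images; the
  stated \<open>\<gamma>\<close> is the solution of \<open>G w = 0\<close>.\<close>

lemma plus_pair_mult_szego:
  assumes fh: "plus_pair f h" and w: "w \<in> disc"
  defines "g \<equiv> dbr_coanalytic b a f"
  shows "plus_pair (\<lambda>z. f z * szego w z)
    (\<lambda>z. h z * szego w z + cnj (w * g w) / cnj (a w) * szego w z)"
proof -
  note H = plus_pair_H2[OF fh]
  define \<gamma> where "\<gamma> = w * g w / a w"
  have g: "g \<in> H2" "AE \<zeta> in circle. cnj (bdry b \<zeta>) * bdry f \<zeta> = cnj (bdry a \<zeta>) * bdry h \<zeta> + cnj (\<zeta> * bdry g \<zeta>)"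
    using dbr_coanalytic[OF fh] by (auto simp: g_def)
  have aH: "a \<in> H2" by (rule Hinf_H2[OF a_Hinf])
  note k = Hinf_H2[OF szego_Hinf[OF w]]
  note fk = mult_szego_H2[OF H(1) w] and hk = mult_szego_H2[OF H(2) w]
  define h' where "h' z = h z * szego w z + cnj \<gamma> * szego w z" for z
  have h': "h' \<in> H2" unfolding h'_def by (intro H2_add hk H2_scale k)
  \<comment> \<open>An outer function is a unimodular constant times an exponential, so the quotient
    in \<open>\<gamma>\<close> is a genuine one.\<close>
  have "a w \<noteq> 0"
  proof -
    obtain c and k :: "complex \<Rightarrow> real" where c: "norm c = 1"
      and a: "\<forall>z\<in>disc. a z = c * exp (LINT \<zeta>|circle. (\<zeta> + z) / (\<zeta> - z) * of_real (k \<zeta>))"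
      using a_outer unfolding outer_def by blast
    have "c \<noteq> 0" using c by auto
    then show ?thesis unfolding bspec[OF a w] by simp
  qed
  \<comment> \<open>Written with \<open>z ^ 1\<close> to match \<open>H2_mult_power\<close>.\<close>
  define G where "G z = z ^ 1 * g z - \<gamma> * a z" for z
  have G: "G \<in> H2" unfolding G_def by (intro H2_diff H2_mult_power g H2_scale aH)
  have Gw: "G w = 0" using \<open>a w \<noteq> 0\<close> by (simp add: G_def \<gamma>_def)
  have bG: "AE \<zeta> in circle. bdry G \<zeta> = \<zeta> * bdry g \<zeta> - \<gamma> * bdry a \<zeta>"
    using bdry_add[OF H2_mult_power(1)[OF g(1), of 1] H2_scale[OF aH, of "- \<gamma>"]]
      bdry_scale[OF aH, of "- \<gamma>"] H2_mult_power(2)[OF g(1), of 1]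
    by eventually_elim (simp add: G_def[abs_def])
  have bh': "AE \<zeta> in circle. bdry h' \<zeta> = bdry h \<zeta> / (1 - cnj w * \<zeta>) + cnj \<gamma> / (1 - cnj w * \<zeta>)"
    using bdry_add[OF hk H2_scale[OF k, of "cnj \<gamma>"]] bdry_scale[OF k, of "cnj \<gamma>"] bdry_mult_szego[OF H(2) w] bdry_szego[OF w]
    by eventually_elim (simp add: h'_def[abs_def])
  have "toeplitz_coef b (\<lambda>z. f z * szego w z) n = toeplitz_coef a h' n" for n
  proof -
    note m = L2_circle_cnj_bdry_mult[OF b_Hinf bdry_L2[OF fk]] L2_circle_cnj_bdry_mult[OF a_Hinf bdry_L2[OF h']]
    have "toeplitz_coef b (\<lambda>z. f z * szego w z) n - toeplitz_coef a h' n =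
        fourier (\<lambda>\<zeta>. cnj (bdry b \<zeta>) * bdry (\<lambda>z. f z * szego w z) \<zeta> - cnj (bdry a \<zeta>) * bdry h' \<zeta>) n"
      unfolding toeplitz_coef_def by (intro fourier_diff[symmetric] L2_circle_integrable m)
    also have "\<dots> = fourier (\<lambda>\<zeta>. cnj (bdry G \<zeta>) / (1 - cnj w * \<zeta>)) n"
    proof (rule fourier_cong_AE)
      show "(\<lambda>\<zeta>. cnj (bdry G \<zeta>) / (1 - cnj w * \<zeta>)) \<in> borel_measurable borel"
        using L2_circle_measurable[OF bdry_L2[OF G]] by measurable
      show "AE \<zeta> in circle. cnj (bdry b \<zeta>) * bdry (\<lambda>z. f z * szego w z) \<zeta> - cnj (bdry a \<zeta>) * bdry h' \<zeta> =
          cnj (bdry G \<zeta>) / (1 - cnj w * \<zeta>)"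
        using bdry_mult_szego[OF H(1) w] bh' bG g(2)
      proof eventually_elim
        case (elim \<zeta>)
        have "cnj (bdry b \<zeta>) * bdry (\<lambda>z. f z * szego w z) \<zeta> - cnj (bdry a \<zeta>) * bdry h' \<zeta> =
          (cnj (bdry b \<zeta>) * bdry f \<zeta> - cnj (bdry a \<zeta>) * bdry h \<zeta> - cnj \<gamma> * cnj (bdry a \<zeta>)) / (1 - cnj w * \<zeta>)"
          unfolding elim(1,2) by (simp add: diff_divide_distrib distrib_left mult.commute)
        then show ?case unfolding elim(3,4) by simp
      qed
    qed (intro L2_circle_measurable L2_circle_diff m)
    also have "\<dots> = 0" unfolding fourier_cnj_bdry_cauchy[OF G w] Gw by simp
    finally show ?thesis by simp
  qed
  then have "plus_pair (\<lambda>z. f z * szego w z) h'" using fk h' by (auto simp: plus_pair_def)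
  then show ?thesis by (simp add: h'_def[abs_def] \<gamma>_def)
qed

end

theorem lemma2p4:
  fixes a b f g :: "complex \<Rightarrow> complex" and w :: complex
  assumes "b \<in> Hinf_unit_ball"
    and "\<not> b constant_on disc"
    and "log_integrable (\<lambda>\<zeta>. 1 - norm (bdry b \<zeta>))"
    and "pythagorean_mate b a"
    and "f \<in> dbr_space b"
    and "w \<in> disc"
    and "g = dbr_coanalytic b a f"
  shows "(\<lambda>z. f z * szego w z) \<in> dbr_space b \<and>
    dbr_plus b a (\<lambda>z. f z * szego w z) =
      (\<lambda>z. dbr_plus b a f z * szego w z + cnj (w * g w) / cnj (a w) * szego w z)"
proof -
  interpret mate a b using assms by unfold_locales
  have "plus_pair f (dbr_plus b a f)"
    using assms(5) unfolding dbr_space_eq by (rule plus_pair_dbr_plus)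
  from plus_pair_mult_szego[OF this assms(6)] assms(7) show ?thesis
    unfolding dbr_space_eq by (simp add: plus_spaceI dbr_plus_eq)
qed

end
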